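(* Let $\gamma>0$, $\mu>0$, and for $\nu\in(0,1]$ let $\tilde u^{\gamma,\mu}_\nu(x,t)=\int_0^\infty \tilde g^{\gamma}_{\mu}(x,s)\,l_\nu(s,t)\,ds$, $x>0$, $t>0$. (i) For $\nu=1/(2n+1)$, $n\in\mathbb{N}\cup\{0\}$, the function $\tilde u^{\gamma,\mu}_\nu$ is a solution of $$D^\nu_t\,\tilde u^{\gamma,\mu}_\nu=\mathcal{G}_{\gamma,\mu}\,\tilde u^{\gamma,\mu}_\nu,\qquad x>0,\ t>0,$$ and it is represented as $$\tilde u^{\gamma,\mu}_\nu(x,t)=\frac{\gamma\,x^{\gamma\mu-1}}{\Gamma(\mu)}\,\frac{\nu^{\frac{1-3\nu}{4\nu}}}{(\pi^2t^{3\nu})^{\frac{1-\nu}{4\nu}}}\int_0^\infty s^{\frac{1}{4\nu}-\frac14-\mu}\,e^{-x^\gamma/s}\,v_\nu(s,t)\,ds,\qquad x>0,\ t>0,$$ where, with $\mathcal{Q}_{\frac{1-\nu}{2}}(x,t)=K_{\frac{1-\nu}{2}}\big(2\sqrt{(x/t)^{1/\nu}}\big)$ for $x,t>0$, $$v_\nu(s,t)=\int_0^\infty\cdots\int_0^\infty \mathcal{Q}_{\frac{1-\nu}{2}}(s,s_1)\,\mathcal{Q}_{\frac{1-\nu}{2}}(s_1,s_2)\cdots\mathcal{Q}_{\frac{1-\nu}{2}}(s_{n-1},t^\nu/\nu)\,ds_1\cdots ds_{n-1}$$ ($n$ factors and $n-1$ integrations; for $n=1$, $v_\nu(s,t)=\mathcal{Q}_{\frac{1-\nu}{2}}(s,t^\nu/\nu)$;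 for $n=0$, i.e. $\nu=1$, $v_1(s,t)\,ds$ is understood as the unit point mass at $s=t$). (ii) Moreover, for every $\nu\in(0,1]$, the solution $\tilde u^{\gamma,\mu}_\nu$ of the same equation is given in terms of the Fox H function by $$\tilde u^{\gamma,\mu}_\nu(x,t)=\frac{\gamma}{x}\,H^{2,0}_{2,2}\left[\frac{x^\gamma}{t^\nu}\,\bigg|\,\begin{array}{cc}(1,\nu);&(\mu,0)\\(1,1);&(\mu,1)\end{array}\right],\qquad x>0,\ t>0.$$
   Context: For $\gamma>0$, $\mu>0$: $g^\gamma_\mu(x,t)=\gamma\,\frac{x^{\gamma\mu-1}}{t^{\gamma\mu}\Gamma(\mu)}\exp\{-x^\gamma/t^\gamma\}$ for $x,t>0$, and $\tilde g^\gamma_\mu(x,t)=g^\gamma_\mu(x,t^{1/\gamma})=\gamma\,\frac{x^{\gamma\mu-1}}{t^{\mu}\Gamma(\mu)}\exp\{-x^\gamma/t\}$. For $\nu\in(0,1)$, $h_\nu(\cdot,t)$ is the density of the $\nu$-stable subordinator $\tilde\tau^{(\nu)}_t$, the non-decreasing Lévy process with $E\exp\{-\lambda\tilde\tau^{(\nu)}_t\}=\exp\{-t\lambda^\nu\}$, $\lambda>0$; $L^{(\nu)}_t$ is its inverse process, $\Pr\{L^{(\nu)}_t<x\}=\Pr\{\tilde\tau^{(\nu)}_x>t\}$, and $l_\nu(\cdot,t)$ is the density of $L^{(\nu)}_t$, i.e. $l_\nu(x,t)=\int_t^\infty\frac{\partial}{\partial x}h_\nu(s,x)\,ds$, $x,t>0$.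 For $\nu=1$, $L^{(1)}_t=t$, so $l_1(s,t)\,ds$ is the unit point mass at $s=t$ and $\tilde u^{\gamma,\mu}_1=\tilde g^\gamma_\mu$. The operator is $\mathcal{G}_{\gamma,\mu}f=\frac{1}{\gamma^2}\left(\frac{\partial}{\partial x}\Big(x^{2-\gamma}\frac{\partial f}{\partial x}\Big)-(\gamma\mu-1)\frac{\partial}{\partial x}\big(x^{1-\gamma}f\big)\right)$, $x>0$. $D^\nu_t$ is the Riemann–Liouville fractional derivative in $t$: for $0<\nu<1$, $D^\nu_tf(t)=\frac{1}{\Gamma(1-\nu)}\frac{d}{dt}\int_0^t(t-s)^{-\nu}f(s)\,ds$; for $\nu=1$ it is $\partial/\partial t$. $K_\alpha$ is the modified Bessel function of the second kind of order $\alpha$. Fox H functions are identified by their Mellin transforms: $\int_0^\infty x^{\eta}H^{m,n}_{p,q}\left[x\,\Big|\,\begin{array}{l}(a_i,\alpha_i)_{i=1,\dots,p}\\(b_j,\beta_j)_{j=1,\dots,q}\end{array}\right]\frac{dx}{x}=\frac{\prod_{j=1}^m\Gamma(b_j+\eta\beta_j)\prod_{i=1}^n\Gamma(1-a_i-\eta\alpha_i)}{\prod_{j=m+1}^q\Gamma(1-b_j-\eta\beta_j)\prod_{i=n+1}^p\Gamma(a_i+\eta\alpha_i)}$ on a suitable vertical strip. In particular, the function used here is $H^{2,0}_{2,2}[z\,|\cdots]=\frac{1}{2\pi i}\int_{\theta-i\infty}^{\theta+i\infty}\frac{\Gamma(1+\eta)\Gamma(\mu+\eta)}{\Gamma(1+\nu\eta)\Gamma(\mu)}z^{-\eta}\,d\eta$,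 $z>0$, with real $\theta>-\min(1,\mu)$. *)

theory Defs
  imports "HOL-Probability.Probability"
begin

definition g_density :: "real \<Rightarrow> real \<Rightarrow> real \<Rightarrow> real \<Rightarrow> real" where
  "g_density \<gamma> \<mu> x t =
     \<gamma> * x powr (\<gamma> * \<mu> - 1) / (t powr (\<gamma> * \<mu>) * Gamma \<mu>)
       * exp (- (x powr \<gamma> / t powr \<gamma>))"

definition g_tilde :: "real \<Rightarrow> real \<Rightarrow> real \<Rightarrow> real \<Rightarrow> real" where
  "g_tilde \<gamma> \<mu> x t = g_density \<gamma> \<mu> x (t powr (1 / \<gamma>))"

definition levy_process :: "'a measure \<Rightarrow> (real \<Rightarrow> 'a \<Rightarrow> real) \<Rightarrow> bool" where
  "levy_process M X \<longleftrightarrow>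
     prob_space M \<and>
     (\<forall>t\<ge>0. X t \<in> borel_measurable M) \<and>
     (AE \<omega> in M. X 0 \<omega> = 0) \<and>
     (\<forall>(n::nat) ts. 0 \<le> ts 0 \<and> (\<forall>i<n. ts i \<le> ts (Suc i)) \<longrightarrow>
        prob_space.indep_vars M (\<lambda>_. borel)
          (\<lambda>i \<omega>. X (ts (Suc i)) \<omega> - X (ts i) \<omega>) {..<n}) \<and>
     (\<forall>s\<ge>0. \<forall>t\<ge>0.
        distr M borel (\<lambda>\<omega>. X (s + t) \<omega> - X s \<omega>) = distr M borel (X t)) \<and>
     (\<forall>t\<ge>0. \<forall>e>0.
        ((\<lambda>s. measure M {\<omega> \<in> space M. e < \<bar>X s \<omega> - X t \<omega>\<bar>}) \<longlongrightarrow> 0)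
          (at t within {0..})) \<and>
     (AE \<omega> in M.
        (\<forall>t\<ge>0. ((\<lambda>s. X s \<omega>) \<longlongrightarrow> X t \<omega>) (at_right t)) \<and>
        (\<forall>t>0. \<exists>l. ((\<lambda>s. X s \<omega>) \<longlongrightarrow> l) (at_left t)))"

definition stable_subordinator ::
  "'a measure \<Rightarrow> real \<Rightarrow> (real \<Rightarrow> 'a \<Rightarrow> real) \<Rightarrow> bool" where
  "stable_subordinator M \<nu> \<tau> \<longleftrightarrow>
     levy_process M \<tau> \<and>
     (AE \<omega> in M. mono_on {0..} (\<lambda>t. \<tau> t \<omega>)) \<and>
     (\<forall>t\<ge>0. \<forall>c>0.
        integrable M (\<lambda>\<omega>. exp (- c * \<tau> t \<omega>)) \<and>
        (\<integral>\<omega>. exp (- c * \<tau> t \<omega>) \<partial>M) = exp (- t * c powr \<nu>))"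

text \<open>
  A density is only determined almost everywhere, but \<open>inverse_density\<close> below differentiates
  \<open>h s t\<close> with respect to \<open>t\<close> for fixed \<open>s\<close>. Continuity in \<open>s\<close> selects the (unique) version
  of the density on the positive half-line for which this makes sense.
\<close>

definition marginal_density ::
  "'a measure \<Rightarrow> (real \<Rightarrow> 'a \<Rightarrow> real) \<Rightarrow> (real \<Rightarrow> real \<Rightarrow> real) \<Rightarrow> bool" where
  "marginal_density M \<tau> h \<longleftrightarrow>
     (\<forall>t>0. (\<forall>s. 0 \<le> h s t) \<and>
        distributed M lborel (\<tau> t) (\<lambda>s. ennreal (h s t)) \<and>
        continuous_on {0<..} (\<lambda>s. h s t))"

definition inverse_density :: "(real \<Rightarrow> real \<Rightarrow> real) \<Rightarrow> real \<Rightarrow> real \<Rightarrow> real" where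
  "inverse_density h x t = (LBINT s:{t<..}. deriv (\<lambda>y. h s y) x)"

text \<open>
  For \<open>\<nu> = 1\<close> the inverse process is \<open>t\<close> itself, so its law is the point mass at \<open>t\<close>;
  the argument \<open>h\<close> is then irrelevant.
\<close>

definition u_tilde ::
  "real \<Rightarrow> real \<Rightarrow> real \<Rightarrow> (real \<Rightarrow> real \<Rightarrow> real) \<Rightarrow> real \<Rightarrow> real \<Rightarrow> real" where
  "u_tilde \<gamma> \<mu> \<nu> h x t =
     (if \<nu> = 1 then g_tilde \<gamma> \<mu> x t
      else (LBINT s:{0<..}. g_tilde \<gamma> \<mu> x s * inverse_density h s t))"

definition G_op :: "real \<Rightarrow> real \<Rightarrow> (real \<Rightarrow> real) \<Rightarrow> real \<Rightarrow> real" where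
  "G_op \<gamma> \<mu> f x =
     1 / \<gamma>\<^sup>2 * (deriv (\<lambda>y. y powr (2 - \<gamma>) * deriv f y) x
       - (\<gamma> * \<mu> - 1) * deriv (\<lambda>y. y powr (1 - \<gamma>) * f y) x)"

definition RL_integral :: "real \<Rightarrow> (real \<Rightarrow> real) \<Rightarrow> real \<Rightarrow> real" where
  "RL_integral \<nu> f t = (LBINT s:{0<..<t}. (t - s) powr (- \<nu>) * f s)"

definition RL_deriv :: "real \<Rightarrow> (real \<Rightarrow> real) \<Rightarrow> real \<Rightarrow> real" where
  "RL_deriv \<nu> f t =
     (if \<nu> = 1 then deriv f t else 1 / Gamma (1 - \<nu>) * deriv (RL_integral \<nu> f) t)"

text \<open>
  As \<open>deriv\<close> and the Lebesgue integral are total, the existence of all derivatives and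
  integrals occurring in the equation is part of being a solution.
\<close>

definition G_applicable :: "real \<Rightarrow> (real \<Rightarrow> real) \<Rightarrow> bool" where
  "G_applicable \<gamma> f \<longleftrightarrow>
     (\<forall>x>0. f differentiable at x \<and>
        (\<lambda>y. y powr (2 - \<gamma>) * deriv f y) differentiable at x \<and>
        (\<lambda>y. y powr (1 - \<gamma>) * f y) differentiable at x)"

definition RL_applicable :: "real \<Rightarrow> (real \<Rightarrow> real) \<Rightarrow> bool" where
  "RL_applicable \<nu> f \<longleftrightarrow>
     (if \<nu> = 1 then \<forall>t>0. f differentiable at t
      else \<forall>t>0. set_integrable lborel {0<..<t} (\<lambda>s. (t - s) powr (- \<nu>) * f s) \<and>
             RL_integral \<nu> f differentiable at t)"

definition solves_fractional_equation ::
  "real \<Rightarrow> real \<Rightarrow> real \<Rightarrow> (real \<Rightarrow> real \<Rightarrow> real) \<Rightarrow> bool" where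
  "solves_fractional_equation \<gamma> \<mu> \<nu> u \<longleftrightarrow>
     (\<forall>t>0. G_applicable \<gamma> (\<lambda>x. u x t)) \<and>
     (\<forall>x>0. RL_applicable \<nu> (\<lambda>t. u x t)) \<and>
     (\<forall>x>0. \<forall>t>0. RL_deriv \<nu> (\<lambda>s. u x s) t = G_op \<gamma> \<mu> (\<lambda>y. u y t) x)"

text \<open>
  The modified Bessel function of the second kind, for real order and positive argument,
  by its integral formula (Gradshteyn and Ryzhik 8.432.1).
\<close>

definition Bessel_K :: "real \<Rightarrow> real \<Rightarrow> real" where
  "Bessel_K a x = (LBINT w:{0<..}. exp (- x * cosh w) * cosh (a * w))"

definition Q_kernel :: "real \<Rightarrow> real \<Rightarrow> real \<Rightarrow> real" where
  "Q_kernel \<nu> x t = Bessel_K ((1 - \<nu>) / 2) (2 * sqrt ((x / t) powr (1 / \<nu>)))"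

text \<open>\<open>iterated_Q k\<close> has \<open>k + 1\<close> factors and \<open>k\<close> integrations.\<close>

primrec iterated_Q :: "nat \<Rightarrow> real \<Rightarrow> real \<Rightarrow> real \<Rightarrow> real" where
  "iterated_Q 0 \<nu> s r = Q_kernel \<nu> s r"
| "iterated_Q (Suc k) \<nu> s r = (LBINT s':{0<..}. Q_kernel \<nu> s s' * iterated_Q k \<nu> s' r)"

definition v_function :: "nat \<Rightarrow> real \<Rightarrow> real \<Rightarrow> real \<Rightarrow> real" where
  "v_function n \<nu> s t = iterated_Q (n - 1) \<nu> s (t powr \<nu> / \<nu>)"

text \<open>
  \<open>v_integral n \<nu> t \<phi>\<close> is the integral of \<open>\<phi> s\<close> against \<open>v\<^sub>\<nu>(s, t) ds\<close> over the positive
  half-line; for \<open>n = 0\<close> this is the unit point mass at \<open>t\<close>.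
\<close>

definition v_integral :: "nat \<Rightarrow> real \<Rightarrow> real \<Rightarrow> (real \<Rightarrow> real) \<Rightarrow> real" where
  "v_integral n \<nu> t \<phi> =
     (if n = 0 then \<phi> t else (LBINT s:{0<..}. \<phi> s * v_function n \<nu> s t))"

text \<open>
  The parameter lists hold the pairs \<open>(a\<^sub>i, \<alpha>\<^sub>i)\<close> and \<open>(b\<^sub>j, \<beta>\<^sub>j)\<close>, indexed from \<open>0\<close>.
  In the denominators the conventions \<open>Gamma z = 0\<close> at the poles and \<open>c / 0 = 0\<close> together
  yield the correct value of the reciprocal Gamma function.
\<close>

definition fox_kernel ::
  "nat \<Rightarrow> nat \<Rightarrow> (real \<times> real) list \<Rightarrow> (real \<times> real) list \<Rightarrow> complex \<Rightarrow> complex" where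
  "fox_kernel m n as bs \<eta> =
     (\<Prod>j<m. Gamma (of_real (fst (bs ! j)) + \<eta> * of_real (snd (bs ! j)))) *
     (\<Prod>i<n. Gamma (1 - of_real (fst (as ! i)) - \<eta> * of_real (snd (as ! i)))) /
     ((\<Prod>j=m..<length bs. Gamma (1 - of_real (fst (bs ! j)) - \<eta> * of_real (snd (bs ! j)))) *
      (\<Prod>i=n..<length as. Gamma (of_real (fst (as ! i)) + \<eta> * of_real (snd (as ! i)))))"

text \<open>
  Mellin--Barnes integral along the line \<open>Re \<eta> = \<theta>\<close>, parametrised by \<open>\<eta> = \<theta> + \<i> y\<close>;
  the factor \<open>\<i>\<close> from \<open>d\<eta> = \<i> dy\<close> cancels against \<open>1 / (2 \<pi> \<i>)\<close>.
\<close>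

definition fox_H ::
  "nat \<Rightarrow> nat \<Rightarrow> (real \<times> real) list \<Rightarrow> (real \<times> real) list \<Rightarrow> real \<Rightarrow> real \<Rightarrow> complex" where
  "fox_H m n as bs \<theta> z =
     1 / (2 * of_real pi) *
       (\<integral>y. fox_kernel m n as bs (Complex \<theta> y) * of_real z powr (- Complex \<theta> y) \<partial>lborel)"

end

theory Submission
  imports Defs "HOL-Complex_Analysis.Complex_Analysis" "HOL-Real_Asymp.Real_Asymp"
begin

text \<open>
  Everything is read off Mellin transforms. Integrating the differentiated Laplace transform
  \<open>E[\<tau> exp (- c \<tau>)]\<close> against \<open>c powr - p\<close> gives \<open>E[\<tau> powr p]\<close> for real \<open>p < \<nu>\<close>, the identity theorem extends it
  to complex exponents, and Mellin inversion yields an explicit smooth stable density. Hence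
  \<open>inverse_density h s t = t / (\<nu> * s) * h t s\<close>, whose Mellin transform in \<open>s\<close> is
  \<open>t powr (\<nu> \<eta>) \<Gamma>(1 + \<eta>) / \<Gamma>(1 + \<nu> \<eta>)\<close>. Since \<open>u\<close> is the multiplicative convolution of this law with
  \<open>w powr \<mu> * exp (- w)\<close>, it is a Mellin--Barnes integral along every admissible vertical line, which is the H function.
  The fractional derivative of the integral along \<open>Re \<eta> = 1\<close> and the operator \<open>\<G>\<close> applied to the integral
  along \<open>Re \<eta> = 0\<close> have the same integrand after the shift \<open>\<eta> \<mapsto> \<eta> - 1\<close>. For \<open>\<nu> = 1 / (2n + 1)\<close>,
  Gauss's multiplication formula splits \<open>\<Gamma>(1 + \<eta>) / \<Gamma>(1 + \<nu> \<eta>)\<close> into \<open>n\<close> pairs of Gamma functions, each the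
  Mellin transform of a Bessel kernel.
\<close>

section \<open>Substitution and differentiation in Lebesgue integrals\<close>

text \<open>What is known of \<open>h\<close> is its Laplace transform at real c and continuity in
  s; nothing says that \<open>h s y\<close> is differentiable in y, although
  \<open>inverse_density\<close> differentiates it. Continuity forces \<open>h\<close> to equal an
  explicit integral at every point, not just almost everywhere, and the derivative is taken there.
  The inversion line is Re z = \<nu>/2 because 1 - z/\<nu> then has real part 1/2, where the
  reflection formula gives the modulus of Gamma exactly; this replaces Stirling's formula. No
  contour is moved: inversion of the Gamma kernel works on each line Re \<eta> = \<theta> with
  \<theta> > - min 1 \<mu> separately. The operator in x lowers the exponent -\<gamma>\<eta> - 1 by
  \<gamma>, the derivative in t lowers \<nu>\<eta> by \<nu>, so two lines at distance 1 have to be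
  compared; 0 and 1 are both admissible. For N = 1/\<nu> = 2n + 1 Gauss's formula leaves 2n Gamma
  factors once Gamma (\<nu> p) is split off. The arguments of factors k and k + n differ by n/N = (1
  - \<nu>)/2, which is the order of the Bessel function.\<close>

lemma nn_integral_exp_substitution:
  fixes f :: "real \<Rightarrow> ennreal"
  assumes [measurable]: "f \<in> borel_measurable borel"
  shows "(\<integral>\<^sup>+s. f s * indicator {0<..} s \<partial>lborel) = (\<integral>\<^sup>+u. f (exp u) * ennreal (exp u) \<partial>lborel)"
proof -
  \<comment> \<open>The half-line is exhausted by the images under exp of [-(n+1), n+1];
    \<open>Suc n\<close> keeps the interval nondegenerate for n = 0. Monotone convergence on both
    sides does the rest.\<close>
  have *: "(\<integral>\<^sup>+s. f s * indicator {exp (- real (Suc n))..exp (real (Suc n))} s \<partial>lborel)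
      = (\<integral>\<^sup>+u. f (exp u) * ennreal (exp u) * indicator {- real (Suc n)..real (Suc n)} u \<partial>lborel)" for n
    by (subst nn_integral_substitution_aux[where g = exp and g' = exp and a = "- real (Suc n)" and b = "real (Suc n)"])
       (auto intro!: derivative_eq_intros continuous_intros nn_integral_cong simp: mult_ac)
  have inc1: "incseq (\<lambda>n s. f s * indicator {exp (- real (Suc n))..exp (real (Suc n))} s)"
  proof (intro incseq_SucI le_funI mult_left_mono)
    fix n s
    have "{exp (- real (Suc n))..exp (real (Suc n))} \<subseteq> {exp (- real (Suc (Suc n)))..exp (real (Suc (Suc n)))}"
      by (simp add: atLeastatMost_subset_iff)
    then show "indicator {exp (- real (Suc n))..exp (real (Suc n))} s \<le> (indicator {exp (- real (Suc (Suc n)))..exp (real (Suc (Suc n)))} s :: ennreal)"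
      by (intro indicator_leI) blast
  qed auto
  have inc2: "incseq (\<lambda>n u. f (exp u) * ennreal (exp u) * indicator {- real (Suc n)..real (Suc n)} u)"
    by (intro incseq_SucI le_funI mult_left_mono indicator_leI) auto
  have "(SUP n. indicator {exp (- real (Suc n))..exp (real (Suc n))} s) = (indicator {0<..} s :: ennreal)" for s :: real
  proof (cases "s > 0")
    case True
    obtain n where "\<bar>ln s\<bar> \<le> real n" using real_arch_simple by blast
    then have "exp (- real (Suc n)) \<le> exp (ln s)" "exp (ln s) \<le> exp (real (Suc n))" by (auto simp del: exp_ln)
    with True have "s \<in> {exp (- real (Suc n))..exp (real (Suc n))}" by simp
    then have "(1::ennreal) \<le> (SUP n. indicator {exp (- real (Suc n))..exp (real (Suc n))} s)"
      by (intro SUP_upper2[of n]) auto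
    moreover have "(SUP n. indicator {exp (- real (Suc n))..exp (real (Suc n))} s) \<le> (1::ennreal)"
      by (intro SUP_least) (auto simp: indicator_def)
    ultimately show ?thesis using True by (auto intro!: antisym)
  next
    case False
    then have "s \<notin> {exp (- real (Suc n))..exp (real (Suc n))}" for n
      using exp_gt_zero[of "- real (Suc n)"] by (auto simp del: exp_gt_zero)
    then show ?thesis using False by simp
  qed
  then have "(\<integral>\<^sup>+s. f s * indicator {0<..} s \<partial>lborel) = (\<integral>\<^sup>+s. (SUP n. f s * indicator {exp (- real (Suc n))..exp (real (Suc n))} s) \<partial>lborel)"
    by (simp only: SUP_mult_left_ennreal[symmetric])
  also have "\<dots> = (SUP n. \<integral>\<^sup>+s. f s * indicator {exp (- real (Suc n))..exp (real (Suc n))} s \<partial>lborel)"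
    by (rule nn_integral_monotone_convergence_SUP[OF inc1]) auto
  also have "\<dots> = (SUP n. \<integral>\<^sup>+u. f (exp u) * ennreal (exp u) * indicator {- real (Suc n)..real (Suc n)} u \<partial>lborel)"
    by (simp only: *)
  also have "\<dots> = (\<integral>\<^sup>+u. (SUP n. f (exp u) * ennreal (exp u) * indicator {- real (Suc n)..real (Suc n)} u) \<partial>lborel)"
    by (rule nn_integral_monotone_convergence_SUP[OF inc2, symmetric]) auto
  also have "\<dots> = (\<integral>\<^sup>+u. f (exp u) * ennreal (exp u) \<partial>lborel)"
  proof (intro nn_integral_cong)
    fix u :: real
    obtain n where "\<bar>u\<bar> \<le> real n" using real_arch_simple by blast
    then have "u \<in> {- real (Suc n)..real (Suc n)}" by auto
    then have "(1::ennreal) \<le> (SUP n. indicator {- real (Suc n)..real (Suc n)} u)"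
      by (intro SUP_upper2[of n]) auto
    moreover have "(SUP n. indicator {- real (Suc n)..real (Suc n)} u) \<le> (1::ennreal)"
      by (intro SUP_least) (auto simp: indicator_def)
    ultimately have "(SUP n. indicator {- real (Suc n)..real (Suc n)} u) = (1::ennreal)" by (rule antisym[rotated])
    then show "(SUP n. f (exp u) * ennreal (exp u) * indicator {- real (Suc n)..real (Suc n)} u) = f (exp u) * ennreal (exp u)"
      by (simp only: SUP_mult_left_ennreal[symmetric] mult_1_right)
  qed
  finally show ?thesis .
qed


text \<open>As an identity of measures the substitution s = exp u transfers integrability and value
  of Banach-valued integrals together, through \<open>density\<close> and
  \<open>distr\<close>.\<close>

lemma lborel_pos_conv_exp:
  "density lborel (\<lambda>s. ennreal (indicator {0<..} s)) = distr (density lborel (\<lambda>u::real. ennreal (exp u))) borel exp"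
  (is "?L = ?R")
proof (rule measure_eqI)
  fix A :: "real set" assume "A \<in> sets ?L"
  then have A[measurable]: "A \<in> sets borel" by simp
  have "emeasure ?L A = (\<integral>\<^sup>+s. indicator A s * indicator {0<..} s \<partial>lborel)"
    by (subst emeasure_density) (auto intro!: nn_integral_cong simp: mult.commute ennreal_indicator)
  also have "\<dots> = (\<integral>\<^sup>+u. indicator A (exp u) * ennreal (exp u) \<partial>lborel)"
    by (rule nn_integral_exp_substitution) measurable
  also have "\<dots> = emeasure (density lborel (\<lambda>u::real. ennreal (exp u))) (exp -` A)"
    using measurable_sets[of exp borel borel A] A
    by (subst emeasure_density) (auto intro!: nn_integral_cong simp: mult.commute indicator_def)
  also have "\<dots> = emeasure ?R A"
    by (subst emeasure_distr) auto
  finally show "emeasure ?L A = emeasure ?R A" .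
qed simp

lemma
  fixes f :: "real \<Rightarrow> 'b::{banach, second_countable_topology}"
  assumes f[measurable]: "f \<in> borel_measurable borel"
  shows set_integrable_exp_substitution:
      "set_integrable lborel {0<..} f \<longleftrightarrow> integrable lborel (\<lambda>u. exp u *\<^sub>R f (exp u))"
    and set_integral_exp_substitution:
      "(LBINT s:{0<..}. f s) = (\<integral>u. exp u *\<^sub>R f (exp u) \<partial>lborel)"
proof -
  have "set_integrable lborel {0<..} f \<longleftrightarrow> integrable (density lborel (\<lambda>s. ennreal (indicator {0<..} s))) f"
    unfolding set_integrable_def by (subst integrable_density) auto
  also have "\<dots> \<longleftrightarrow> integrable (density lborel (\<lambda>u::real. ennreal (exp u))) (\<lambda>u. f (exp u))"
    unfolding lborel_pos_conv_exp by (subst integrable_distr_eq) auto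
  also have "\<dots> \<longleftrightarrow> integrable lborel (\<lambda>u. exp u *\<^sub>R f (exp u))"
    by (subst integrable_density) auto
  finally show "set_integrable lborel {0<..} f \<longleftrightarrow> integrable lborel (\<lambda>u. exp u *\<^sub>R f (exp u))" .
  have "(LBINT s:{0<..}. f s) = (\<integral>s. f s \<partial>density lborel (\<lambda>s. ennreal (indicator {0<..} s)))"
    unfolding set_lebesgue_integral_def by (subst integral_density) auto
  also have "\<dots> = (\<integral>u. f (exp u) \<partial>density lborel (\<lambda>u::real. ennreal (exp u)))"
    unfolding lborel_pos_conv_exp by (subst integral_distr) auto
  also have "\<dots> = (\<integral>u. exp u *\<^sub>R f (exp u) \<partial>lborel)"
    by (subst integral_density) auto
  finally show "(LBINT s:{0<..}. f s) = (\<integral>u. exp u *\<^sub>R f (exp u) \<partial>lborel)" .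
qed
text \<open>Dominated convergence for the difference quotients: the bound on \<open>F'\<close>
  majorises them through the mean value inequality on the convex ball. The scalar field is left open
  because both real parameters and complex Mellin arguments occur.\<close>

lemma has_field_derivative_lebesgue_integral:
  fixes F :: "'a::{real_normed_field, banach, second_countable_topology} \<Rightarrow> 'b \<Rightarrow> 'a"
  assumes r: "0 < r"
    and int: "\<And>x. x \<in> ball x0 r \<Longrightarrow> integrable M (F x)"
    and D: "AE w in M. \<forall>x\<in>ball x0 r. ((\<lambda>x. F x w) has_field_derivative F' x w) (at x)"
    and B: "AE w in M. \<forall>x\<in>ball x0 r. norm (F' x w) \<le> g w"
    and g: "integrable M g"
    and meas: "F' x0 \<in> borel_measurable M"
  shows "((\<lambda>x. \<integral>w. F x w \<partial>M) has_field_derivative (\<integral>w. F' x0 w \<partial>M)) (at x0)"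
proof -
  let ?q = "\<lambda>x w. (F x w - F x0 w) / (x - x0)"
  have lim: "((\<lambda>n. \<integral>w. ?q (X n) w \<partial>M) \<longlonglongrightarrow> (\<integral>w. F' x0 w \<partial>M))"
    if X: "\<forall>n. X n \<in> ball x0 r - {x0}" "X \<longlonglongrightarrow> x0" for X
  proof (rule integral_dominated_convergence[OF meas _ g])
    show "(\<lambda>w. ?q (X n) w) \<in> borel_measurable M" for n
      using X(1) r by (intro borel_measurable_integrable integrable_divide Bochner_Integration.integrable_diff int) auto
    show "AE w in M. (\<lambda>n. ?q (X n) w) \<longlonglongrightarrow> F' x0 w"
      using D
    proof eventually_elim
      case (elim w)
      then have "((\<lambda>x. ?q x w) \<longlongrightarrow> F' x0 w) (at x0)"
        using r by (auto simp: has_field_derivative_iff)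
      then show ?case using X by (auto simp: tendsto_at_iff_sequentially o_def)
    qed
    show "AE w in M. norm (?q (X n) w) \<le> g w" for n
      using D B
    proof eventually_elim
      case (elim w)
      have "norm (F (X n) w - F x0 w) \<le> g w * norm (X n - x0)"
        using elim X(1) r
        by (intro field_differentiable_bound[OF convex_ball[of x0 r], where f' = "\<lambda>x. F' x w"])
           (auto intro: has_field_derivative_at_within)
      moreover have "norm (X n - x0) > 0" using X(1) by auto
      ultimately show ?case by (simp add: norm_divide divide_simps)
    qed
  qed
  have "((\<lambda>x. \<integral>w. ?q x w \<partial>M) \<longlongrightarrow> (\<integral>w. F' x0 w \<partial>M)) (at x0 within ball x0 r)"
    unfolding tendsto_at_iff_sequentially o_def using lim by blast
  then have "((\<lambda>x. \<integral>w. ?q x w \<partial>M) \<longlongrightarrow> (\<integral>w. F' x0 w \<partial>M)) (at x0)"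
    using r at_within_open[of x0 "ball x0 r"] by (simp only: centre_in_ball open_ball)
  moreover have "eventually (\<lambda>x. x \<in> ball x0 r) (at x0)"
    using r by (intro eventually_at_in_open') auto
  then have "eventually (\<lambda>x. (\<integral>w. ?q x w \<partial>M) = ((\<integral>w. F x w \<partial>M) - (\<integral>w. F x0 w \<partial>M)) / (x - x0)) (at x0)"
  proof eventually_elim
    case (elim x)
    have "integrable M (F x)" "integrable M (F x0)" using elim r by (auto intro: int)
    then show ?case by (simp only: integral_divide_zero Bochner_Integration.integral_diff)
  qed
  ultimately show ?thesis unfolding has_field_derivative_iff by (rule Lim_transform_eventually)
qed

section \<open>Mellin transforms\<close>

text \<open>In logarithmic coordinates \<open>s = exp u\<close>, so that \<open>mellin f z\<close> is the integral of
  \<open>f s * s powr (z - 1)\<close> over the positive half-line.\<close>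

definition mellin :: "(real \<Rightarrow> real) \<Rightarrow> complex \<Rightarrow> complex" where
  "mellin f z = (\<integral>u. complex_of_real (f (exp u)) * exp (z * complex_of_real u) \<partial>lborel)"

text \<open>By the identity theorem, a Mellin transform of a nonnegative function that is known at real
  arguments is known on the whole vertical strip.\<close>

lemma
  fixes f :: "real \<Rightarrow> real"
  assumes f[measurable]: "f \<in> borel_measurable borel"
    and nonneg: "\<And>s. s > 0 \<Longrightarrow> 0 \<le> f s"
    and ab: "a < Re z" "Re z < b"
    and hol: "m holomorphic_on {z. a < Re z \<and> Re z < b}"
    and M: "\<And>p. a < p \<Longrightarrow> p < b \<Longrightarrow> (\<integral>\<^sup>+u. ennreal (f (exp u) * exp (p * u)) \<partial>lborel) = ennreal (M p)"
    and M0: "\<And>p. a < p \<Longrightarrow> p < b \<Longrightarrow> 0 \<le> M p"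
    and mM: "\<And>p. a < p \<Longrightarrow> p < b \<Longrightarrow> m (of_real p) = of_real (M p)"
  shows mellin_integrable_of_real:
      "integrable lborel (\<lambda>u. complex_of_real (f (exp u)) * exp (z * complex_of_real u))"
    and mellin_eq_of_real: "mellin f z = m z"
proof -
  let ?S = "{z. a < Re z \<and> Re z < b}"
  have intR: "integrable lborel (\<lambda>u. f (exp u) * exp (p * u))" if "a < p" "p < b" for p
    using that M[OF that] nonneg
    by (intro integrableI_bounded) (simp_all add: abs_mult)
  have int: "integrable lborel (\<lambda>u. complex_of_real (f (exp u)) * exp (z * complex_of_real u))" if "z \<in> ?S" for z
    using that nonneg by (intro Bochner_Integration.integrable_bound[OF intR[of "Re z"]]) (auto simp: norm_mult)
  then show "integrable lborel (\<lambda>u. complex_of_real (f (exp u)) * exp (z * complex_of_real u))"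
    using ab by simp
  have opn: "open ?S"
    using open_halfspace_Re_gt[of a] open_halfspace_Re_lt[of b] by (auto intro!: open_Int simp: Collect_conj_eq)
  have conv: "convex ?S"
    using convex_halfspace_Re_gt[of a] convex_halfspace_Re_lt[of b] by (auto intro!: convex_Int simp: Collect_conj_eq)
  have "mellin f field_differentiable at z0" if z0: "z0 \<in> ?S" for z0
  proof -
    \<comment> \<open>A third of the distance to the boundary: the exponents p - 2r and p + 2r must
      remain strictly inside the strip.\<close>
    define r where "r = min (Re z0 - a) (b - Re z0) / 3"
    define p where "p = Re z0"
    have r: "r > 0" using z0 by (auto simp: r_def)
    have p: "a < p - 2 * r" "p + 2 * r < b" using z0 by (auto simp: p_def r_def min_def field_simps)
    \<comment> \<open>Differentiation in z brings down a factor u, paid for by exp (r |u|); moving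
      the exponent by less than r costs the same again. Splitting exp (2r |u|) by the sign of u
      leaves two real exponents at which f is integrable.\<close>
    have bnd: "\<bar>u\<bar> * exp (q * u) \<le> (1 / r) * (exp ((p + 2 * r) * u) + exp ((p - 2 * r) * u))"
      if q: "\<bar>q - p\<bar> < r" for q u :: real
    proof -
      have "\<bar>u\<bar> = (1/r) * (r * \<bar>u\<bar>)" using r by simp
      also have "\<dots> \<le> (1/r) * exp (r * \<bar>u\<bar>)"
        using r exp_ge_add_one_self[of "r * \<bar>u\<bar>"] by (intro mult_left_mono) (linarith, simp)
      finally have 1: "\<bar>u\<bar> \<le> (1/r) * exp (r * \<bar>u\<bar>)" .
      have "(q - p) * u \<le> \<bar>q - p\<bar> * \<bar>u\<bar>" by (metis abs_ge_self abs_mult)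
      also have "\<dots> \<le> r * \<bar>u\<bar>" using q by (intro mult_right_mono) auto
      finally have 2: "exp (q * u) \<le> exp (p * u + r * \<bar>u\<bar>)" by (simp add: algebra_simps)
      have "\<bar>u\<bar> * exp (q * u) \<le> ((1/r) * exp (r * \<bar>u\<bar>)) * exp (p * u + r * \<bar>u\<bar>)"
        using 1 2 r by (intro mult_mono) auto
      also have "\<dots> = (1/r) * exp (p * u + 2 * r * \<bar>u\<bar>)" by (simp add: algebra_simps flip: exp_add)
      also have "\<dots> \<le> (1/r) * (exp ((p + 2 * r) * u) + exp ((p - 2 * r) * u))"
        using r by (intro mult_left_mono) (cases "u \<ge> 0", auto simp: algebra_simps)
      finally show ?thesis .
    qed
    have "((\<lambda>z. \<integral>u. complex_of_real (f (exp u)) * exp (z * complex_of_real u) \<partial>lborel) has_field_derivative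
        (\<integral>u. complex_of_real (f (exp u)) * (complex_of_real u * exp (z0 * complex_of_real u)) \<partial>lborel)) (at z0)"
    proof (rule has_field_derivative_lebesgue_integral[where r = r and
          F' = "\<lambda>z u. complex_of_real (f (exp u)) * (complex_of_real u * exp (z * complex_of_real u))" and
          g = "\<lambda>u. (1/r) * (f (exp u) * exp ((p + 2 * r) * u) + f (exp u) * exp ((p - 2 * r) * u))"])
      have near: "\<bar>Re x - p\<bar> < r" if "x \<in> ball z0 r" for x
        using that abs_Re_le_cmod[of "x - z0"] by (simp add: p_def dist_norm norm_minus_commute)
      show "integrable lborel (\<lambda>u. complex_of_real (f (exp u)) * exp (x * complex_of_real u))" if "x \<in> ball z0 r" for x
      proof (rule int)
        show "x \<in> ?S" using near[OF that] p r by (auto simp: abs_real_def split: if_splits)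
      qed
      show "AE u in lborel. \<forall>x\<in>ball z0 r. ((\<lambda>x. complex_of_real (f (exp u)) * exp (x * complex_of_real u))
          has_field_derivative complex_of_real (f (exp u)) * (complex_of_real u * exp (x * complex_of_real u))) (at x)"
        by (auto intro!: derivative_eq_intros AE_I2)
      show "integrable lborel (\<lambda>u. (1/r) * (f (exp u) * exp ((p + 2 * r) * u) + f (exp u) * exp ((p - 2 * r) * u)))"
        using p r by (intro integrable_mult_right Bochner_Integration.integrable_add intR) auto
      show "AE u in lborel. \<forall>x\<in>ball z0 r. norm (complex_of_real (f (exp u)) * (complex_of_real u * exp (x * complex_of_real u)))
          \<le> (1/r) * (f (exp u) * exp ((p + 2 * r) * u) + f (exp u) * exp ((p - 2 * r) * u))"
      proof (intro AE_I2 ballI)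
        fix u x assume "x \<in> ball z0 r"
        from mult_left_mono[OF bnd[OF near[OF this], of u] nonneg[of "exp u"]]
        show "norm (complex_of_real (f (exp u)) * (complex_of_real u * exp (x * complex_of_real u)))
          \<le> (1/r) * (f (exp u) * exp ((p + 2 * r) * u) + f (exp u) * exp ((p - 2 * r) * u))"
          using nonneg[of "exp u"] by (simp add: norm_mult algebra_simps)
      qed
    qed (use r in auto)
    then show ?thesis unfolding mellin_def[abs_def] field_differentiable_def by blast
  qed
  then have holf: "mellin f holomorphic_on ?S"
    by (auto simp: holomorphic_on_def intro: field_differentiable_at_within)
  \<comment> \<open>A point of the strip at which the real segment accumulates; on that segment both
    functions are known to agree.\<close>
  define c where "c = (a + b) / 2"
  have c: "a < c" "c < b" using ab by (auto simp: c_def)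
  have "mellin f z - m z = 0"
  proof (rule analytic_continuation[where f = "\<lambda>z. mellin f z - m z" and w = z and S = ?S and U = "of_real ` {a<..<b}" and \<xi> = "of_real c"])
    show "(\<lambda>z. mellin f z - m z) holomorphic_on ?S" by (intro holomorphic_intros holf hol)
    show "connected ?S" by (rule convex_connected[OF conv])
    show "complex_of_real c islimpt of_real ` {a<..<b}"
    proof (rule islimptI)
      fix T assume T: "complex_of_real c \<in> T" "open T"
      then obtain e where e: "e > 0" "ball (complex_of_real c) e \<subseteq> T" by (auto simp: open_contains_ball)
      define x where "x = c + min (e / 2) ((b - c) / 2)"
      have "a < x" "x < b" "x \<noteq> c" "\<bar>x - c\<bar> < e" using e c by (auto simp: x_def min_def field_simps)
      then show "\<exists>y\<in>of_real ` {a<..<b}. y \<in> T \<and> y \<noteq> complex_of_real c"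
        using e by (intro bexI[of _ "of_real x"]) (auto simp: dist_norm subset_iff norm_minus_commute simp flip: of_real_diff)
    qed
    show "mellin f x - m x = 0" if x: "x \<in> of_real ` {a<..<b}" for x
    proof -
      obtain p where p: "x = of_real p" "a < p" "p < b" using x by auto
      have "mellin f x = of_real (\<integral>u. f (exp u) * exp (p * u) \<partial>lborel)"
        unfolding mellin_def integral_complex_of_real[symmetric] by (simp add: p exp_of_real[symmetric])
      also have "(\<integral>u. f (exp u) * exp (p * u) \<partial>lborel) = M p"
        using M[OF p(2,3)] M0[OF p(2,3)] nonneg
        by (subst integral_eq_nn_integral) auto
      finally show ?thesis using mM p by simp
    qed
  qed (use ab c opn in auto)
  then show "mellin f z = m z" by simp
qed


section \<open>Fourier and Mellin inversion of nonnegative functions\<close>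

lemma continuous_nonneg_integral_zero_imp_zero:
  fixes p :: "real \<Rightarrow> real"
  assumes "continuous_on UNIV p" "\<And>x. 0 \<le> p x" "integrable lborel p" "(\<integral>x. p x \<partial>lborel) = 0"
  shows "p x = 0"
proof (rule ccontr)
  assume ne: "p x \<noteq> 0"
  have "AE x in lborel. p x = 0"
    using assms integral_nonneg_eq_0_iff_AE[of lborel p] by simp
  moreover have "p \<in> borel_measurable borel" using assms(3) by auto
  ultimately have "{x. p x \<noteq> 0} \<in> null_sets lborel"
    by (subst AE_iff_null_sets) auto
  then have "negligible {x. p x \<noteq> 0}"
    by (simp add: negligible_iff_null_sets null_sets_completionI)
  moreover have "open {x. p x \<noteq> 0}"
    using assms(1) by (intro open_Collect_neq) auto
  ultimately show False using ne open_not_negligible by blast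
qed

text \<open>Divided by its integral c, p is a probability density with characteristic function
  \<phi>/c, so Levy inversion expresses its mass on an interval ending at b through \<phi>.
  Differentiating in b at x recovers p x, at first as a real part; the symmetry of \<phi> under
  conjugation shows that the imaginary part vanishes. The case c = 0, where normalisation fails, is
  the preceding lemma.\<close>

lemma fourier_inversion_nonneg:
  fixes p :: "real \<Rightarrow> real"
  assumes cont: "continuous_on UNIV p"
    and nonneg: "\<And>x. 0 \<le> p x"
    and int: "integrable lborel p"
    and \<phi>: "\<And>t. \<phi> t = (\<integral>u. complex_of_real (p u) * iexp (t * u) \<partial>lborel)"
    and int\<phi>: "integrable lborel \<phi>"
  shows "complex_of_real (p x) = 1 / (2 * pi) * (\<integral>t. \<phi> t * iexp (- (t * x)) \<partial>lborel)"
proof (cases "(\<integral>x. p x \<partial>lborel) = 0")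
  case True
  then have "p x = 0" for x using continuous_nonneg_integral_zero_imp_zero[OF cont nonneg int] by blast
  then show ?thesis using \<phi> by simp
next
  case False
  define c where "c = (\<integral>x. p x \<partial>lborel)"
  have c: "c > 0" using False nonneg by (simp add: c_def less_le integral_nonneg_AE)
  have [measurable]: "p \<in> borel_measurable borel" using int by auto
  have [measurable]: "\<phi> \<in> borel_measurable borel" using int\<phi> by auto
  define M where "M = density lborel (\<lambda>x. ennreal (p x / c))"
  have "emeasure M UNIV = (\<integral>\<^sup>+x. ennreal (p x / c) \<partial>lborel)"
    by (simp add: M_def emeasure_density)
  also have "\<dots> = ennreal (\<integral>x. p x / c \<partial>lborel)"
    using nonneg c int by (intro nn_integral_eq_integral) auto
  also have "\<dots> = 1" using c by (simp add: c_def)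
  finally have "prob_space M" by (intro prob_spaceI) (simp add: M_def)
  then interpret M: real_distribution M
    by (simp add: real_distribution_def real_distribution_axioms_def M_def)
  have charM: "char M t = \<phi> t / c" for t
  proof -
    have "char M t = (\<integral>u. (p u / c) *\<^sub>R iexp (t * u) \<partial>lborel)"
      unfolding char_def M_def using c nonneg by (subst integral_density) auto
    also have "\<dots> = (\<integral>u. (complex_of_real (p u) * iexp (t * u)) / c \<partial>lborel)"
      by (simp add: scaleR_conv_of_real)
    also have "\<dots> = \<phi> t / c" unfolding \<phi> by (rule integral_divide_zero)
    finally show ?thesis .
  qed
  \<comment> \<open>A fixed left endpoint; the distance 1 matches the unit ball around x in which b
    varies below.\<close>
  define a where "a = x - 1"
  let ?F = "\<lambda>b t. (iexp (- (t * a)) - iexp (- (t * b))) / (\<i> * t)"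
  have F_bound: "cmod (?F b t) \<le> b - a" if "a \<le> b" for b t
  proof (cases "t = 0")
    case False
    then show ?thesis using Levy_Inversion_aux2[of "-b" "-a" t] that by simp
  qed (use that in simp)
  have int_F: "integrable lborel (\<lambda>t. ?F b t * (\<phi> t / c))" if "a \<le> b" for b
  proof (rule Bochner_Integration.integrable_bound)
    show "integrable lborel (\<lambda>t. (b - a) * (norm (\<phi> t) / c))"
      using int\<phi> by (intro integrable_mult_right integrable_divide integrable_norm)
    show "AE t in lborel. norm (?F b t * (\<phi> t / c)) \<le> norm ((b - a) * (norm (\<phi> t) / c))"
      using that c mult_right_mono[OF F_bound[OF that], of "norm (\<phi> t / c)" for t]
      by (intro AE_I2) (simp only: norm_mult norm_divide real_norm_def norm_of_real abs_of_nonneg abs_mult abs_divide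
            abs_norm_cancel, simp)
  qed measurable
  have G: "1 / (2 * pi) * (\<integral>t. ?F b t * (\<phi> t / c) \<partial>lborel) = complex_of_real (measure M {a<..b})" if ab: "a \<le> b" for b
  proof -
    have M0: "measure M {y} = 0" for y
    proof -
      have "emeasure M {y} = 0" by (simp add: M_def emeasure_density nn_integral_null_set)
      then show ?thesis by (simp add: measure_def)
    qed
    have 1: "(\<lambda>T. 1 / (2 * pi) * (CLBINT t=-T..T. ?F b t * char M t)) \<longlonglongrightarrow> complex_of_real (measure M {a<..b})"
      by (rule M.Levy_Inversion[OF ab M0 M0])
    \<comment> \<open>Levy inversion only gives a limit over symmetric intervals. Integrability of
      \<phi> and the bound on \<open>?F\<close> turn it into an absolutely convergent
      integral.\<close>
    have "(\<lambda>T::nat. \<integral>t. indicator {-real T<..<real T} t *\<^sub>R (?F b t * (\<phi> t / c)) \<partial>lborel) \<longlonglongrightarrow> (\<integral>t. ?F b t * (\<phi> t / c) \<partial>lborel)"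
    proof (rule integral_dominated_convergence[where w = "\<lambda>t. norm (?F b t * (\<phi> t / c))"])
      show "integrable lborel (\<lambda>t. norm (?F b t * (\<phi> t / c)))" by (intro integrable_norm int_F ab)
      show "AE t in lborel. (\<lambda>T::nat. indicator {-real T<..<real T} t *\<^sub>R (?F b t * (\<phi> t / c))) \<longlonglongrightarrow> ?F b t * (\<phi> t / c)"
      proof (intro AE_I2 tendsto_eventually)
        fix t :: real
        obtain N :: nat where N: "\<bar>t\<bar> < real N" using reals_Archimedean2 by blast
        show "eventually (\<lambda>T::nat. indicator {-real T<..<real T} t *\<^sub>R (?F b t * (\<phi> t / c)) = ?F b t * (\<phi> t / c)) sequentially"
          using eventually_ge_at_top[of N]
        proof eventually_elim
          case (elim T)
          then have "t \<in> {-real T<..<real T}" using N by auto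
          then show ?case by simp
        qed
      qed
      show "AE t in lborel. norm (indicator {-real T<..<real T} t *\<^sub>R (?F b t * (\<phi> t / c))) \<le> norm (?F b t * (\<phi> t / c))" for T :: nat
        by (intro AE_I2) (simp add: indicator_def)
    qed measurable
    then have "(\<lambda>T::nat. 1 / (2 * pi) * (CLBINT t=-T..T. ?F b t * char M t)) \<longlonglongrightarrow> 1 / (2 * pi) * (\<integral>t. ?F b t * (\<phi> t / c) \<partial>lborel)"
      unfolding interval_lebesgue_integral_def set_lebesgue_integral_def charM
      by (intro tendsto_mult tendsto_const) simp
    from LIMSEQ_unique[OF this 1] show ?thesis by simp
  qed
  have G': "measure M {a<..b} = integral {a..b} p / c" if "a \<le> b" for b
  proof -
    have "set_integrable lborel {a<..b} p"
      using integrable_mult_indicator[OF _ int, of "{a<..b}"] by (simp add: set_integrable_def)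
    have "emeasure M {a<..b} = (\<integral>\<^sup>+x. ennreal (indicator {a<..b} x * p x / c) \<partial>lborel)"
      unfolding M_def by (subst emeasure_density) (auto intro!: nn_integral_cong simp: indicator_def)
    also have "\<dots> = ennreal (\<integral>x. indicator {a<..b} x * p x / c \<partial>lborel)"
      using nonneg c int integrable_mult_indicator[of "{a<..b}" lborel p] by (intro nn_integral_eq_integral) auto
    finally have "measure M {a<..b} = (\<integral>x. indicator {a<..b} x * p x / c \<partial>lborel)"
      using nonneg c by (simp add: measure_def integral_nonneg_AE)
    also have "\<dots> = (LBINT x:{a<..b}. p x) / c"
      by (simp add: set_lebesgue_integral_def)
    also have "(LBINT x:{a<..b}. p x) = integral {a<..b} p"
      by (rule set_borel_integral_eq_integral) fact
    also have "\<dots> = integral {a..b} p"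
      by (rule integral_spike_set) (auto intro: negligible_subset[of "{a}"])
    finally show ?thesis .
  qed
  have D1: "((\<lambda>b. integral {a..b} p / c) has_real_derivative p x / c) (at x)"
  proof -
    have "((\<lambda>b. integral {a..b} p) has_real_derivative p x) (at x within {a..x+1})"
      using cont by (intro integral_has_real_derivative) (auto simp: a_def intro: continuous_on_subset)
    then have "((\<lambda>b. integral {a..b} p) has_real_derivative p x) (at x)"
      using at_within_Icc_at[of a x "x+1"] by (simp add: a_def)
    then show ?thesis by (rule DERIV_cdivide)
  qed
  have D2: "((\<lambda>b. \<integral>t. Re (?F b t * (\<phi> t / c)) \<partial>lborel) has_real_derivative (\<integral>t. Re (iexp (- (t * x)) * (\<phi> t / c)) \<partial>lborel)) (at x)"
  proof (rule has_field_derivative_lebesgue_integral[where r = 1 and F' = "\<lambda>b t. Re (iexp (- (t * b)) * (\<phi> t / c))" and g = "\<lambda>t. norm (\<phi> t / c)"])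
    show "integrable lborel (\<lambda>t. Re (?F b t * (\<phi> t / c)))" if "b \<in> ball x 1" for b
      using that by (intro integrable_Re int_F) (auto simp: a_def dist_real_def)
    show "integrable lborel (\<lambda>t. norm (\<phi> t / c))"
      using int\<phi> by (intro integrable_norm integrable_divide)
    show "AE t in lborel. \<forall>b\<in>ball x 1. norm (Re (iexp (- (t * b)) * (\<phi> t / c))) \<le> norm (\<phi> t / c)"
    proof (intro AE_I2 ballI)
      fix t b
      have "norm (Re (iexp (- (t * b)) * (\<phi> t / c))) \<le> norm (iexp (- (t * b)) * (\<phi> t / c))"
        unfolding real_norm_def by (rule abs_Re_le_cmod)
      also have "\<dots> = norm (\<phi> t / c)"
        by (simp only: norm_mult norm_exp_i_times mult_1_left)
      finally show "norm (Re (iexp (- (t * b)) * (\<phi> t / c))) \<le> norm (\<phi> t / c)" .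
    qed
    \<comment> \<open>At t = 0 the quotient \<open>?F\<close> is 0 by the convention on division, so
      its derivative there is not the required one; this single point is discarded.\<close>
    have "AE t in lborel. t \<noteq> (0::real)" by (rule AE_lborel_singleton)
    then show "AE t in lborel. \<forall>b\<in>ball x 1. ((\<lambda>b. Re (?F b t * (\<phi> t / c))) has_field_derivative Re (iexp (- (t * b)) * (\<phi> t / c))) (at b)"
    proof eventually_elim
      case (elim t)
      have "((\<lambda>b. ?F b t * (\<phi> t / c)) has_vector_derivative iexp (- (t * b)) * (\<phi> t / c)) (at b)" for b
      proof -
        have "((\<lambda>z. (iexp (- (t * a)) - exp (- (\<i> * t * z))) / (\<i> * t) * (\<phi> t / c)) has_field_derivative
            exp (- (\<i> * t * of_real b)) * (\<phi> t / c)) (at (of_real b))"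
          using elim c by (auto intro!: derivative_eq_intros simp: field_simps)
        from has_vector_derivative_real_field[OF this] show ?thesis by (simp add: mult.assoc)
      qed
      then have "((\<lambda>b. Re (?F b t * (\<phi> t / c))) has_vector_derivative Re (iexp (- (t * b)) * (\<phi> t / c))) (at b)" for b
        by (rule bounded_linear.has_vector_derivative[OF bounded_linear_Re])
      then show ?case by (simp add: has_real_derivative_iff_has_vector_derivative)
    qed
  qed (measurable)
  let ?I = "\<integral>t. \<phi> t * iexp (- (t * x)) \<partial>lborel"
  have intI: "integrable lborel (\<lambda>t. \<phi> t * iexp (- (t * x)))"
    by (rule Bochner_Integration.integrable_bound[OF integrable_norm[OF int\<phi>]]) (auto simp: norm_mult)
  have "(\<integral>t. Re (iexp (- (t * x)) * (\<phi> t / c)) \<partial>lborel) = (\<integral>t. Re (\<phi> t * iexp (- (t * x)) / c) \<partial>lborel)"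
    by (simp only: times_divide_eq_right mult.commute[of "\<phi> _"])
  also have "\<dots> = Re (\<integral>t. \<phi> t * iexp (- (t * x)) / c \<partial>lborel)"
    by (intro integral_Re integrable_divide intI)
  also have "\<dots> = Re ?I / c" by simp
  finally have eq: "(\<integral>t. Re (iexp (- (t * x)) * (\<phi> t / c)) \<partial>lborel) = Re ?I / c" .
  have ev: "eventually (\<lambda>b. b \<in> {a<..}) (nhds x)"
    by (intro eventually_nhds_in_open) (auto simp: a_def)
  have "eventually (\<lambda>b. integral {a..b} p / c = 1 / (2 * pi) * (\<integral>t. Re (?F b t * (\<phi> t / c)) \<partial>lborel)) (nhds x)"
    using ev
  proof eventually_elim
    case (elim b)
    then have b: "a \<le> b" by simp
    have "integral {a..b} p / c = Re (complex_of_real (measure M {a<..b}))" using G'[OF b] by simp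
    also have "\<dots> = Re (complex_of_real (1 / (2 * pi)) * (\<integral>t. ?F b t * (\<phi> t / c) \<partial>lborel))" by (simp only: G[OF b])
    also have "\<dots> = 1 / (2 * pi) * Re (\<integral>t. ?F b t * (\<phi> t / c) \<partial>lborel)"
      by (simp only: Re_complex_of_real Im_complex_of_real times_complex.sel mult_zero_left diff_zero)
    also have "Re (\<integral>t. ?F b t * (\<phi> t / c) \<partial>lborel) = (\<integral>t. Re (?F b t * (\<phi> t / c)) \<partial>lborel)"
      by (rule integral_Re[OF int_F[OF b], symmetric])
    finally show ?case .
  qed
  from DERIV_cong_ev[OF refl this refl] D1
  have "((\<lambda>b. 1 / (2 * pi) * (\<integral>t. Re (?F b t * (\<phi> t / c)) \<partial>lborel)) has_real_derivative p x / c) (at x)"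
    by simp
  from DERIV_unique[OF this DERIV_cmult[OF D2]] have "p x / c = 1 / (2 * pi) * (Re ?I / c)"
    unfolding eq .
  then have Re: "p x = 1 / (2 * pi) * Re ?I" using c by (simp add: field_simps)
  \<comment> \<open>Since p is real, conjugation amounts to t \<mapsto> -t. The inversion integral
    therefore equals its own conjugate.\<close>
  have \<phi>m: "cnj (\<phi> t) = \<phi> (-t)" for t
  proof -
    have "cnj (\<phi> t) = (\<integral>u. cnj (complex_of_real (p u) * iexp (t * u)) \<partial>lborel)"
      unfolding \<phi> by (rule Bochner_Integration.integral_cnj[symmetric])
    also have "\<dots> = \<phi> (-t)"
      unfolding \<phi> by (intro Bochner_Integration.integral_cong refl) (simp add: exp_cnj)
    finally show ?thesis .
  qed
  have "cnj ?I = (\<integral>t. cnj (\<phi> t * iexp (- (t * x))) \<partial>lborel)"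
    by (rule Bochner_Integration.integral_cnj[symmetric])
  also have "\<dots> = (\<integral>t. \<phi> (-t) * iexp (- (-t * x)) \<partial>lborel)"
    by (intro Bochner_Integration.integral_cong refl) (simp add: exp_cnj \<phi>m)
  also have "\<dots> = ?I"
    using lborel_integral_real_affine[of "-1" "\<lambda>t. \<phi> t * iexp (- (t * x))" 0] by simp
  finally have "Im ?I = 0" by (simp add: complex_eq_iff)
  then have "complex_of_real (Re ?I) = ?I" by (simp add: complex_eq_iff)
  then have "complex_of_real (1 / (2 * pi)) * complex_of_real (Re ?I) = complex_of_real (1 / (2 * pi)) * ?I"
    by (rule arg_cong)
  then show ?thesis by (simp only: Re of_real_mult)
qed

lemma exp_Complex_mult_of_real: "exp (Complex \<sigma> y * of_real u) = of_real (exp (\<sigma> * u)) * iexp (y * u)"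
  by (simp add: Complex_eq algebra_simps flip: exp_of_real exp_add)

lemma borel_measurable_Complex[measurable]: "Complex \<sigma> \<in> borel_measurable borel"
  unfolding Complex_eq[abs_def] by measurable

lemma mellin_Complex:
  "mellin f (Complex \<sigma> y) = (\<integral>u. complex_of_real (f (exp u) * exp (\<sigma> * u)) * iexp (y * u) \<partial>lborel)"
  unfolding mellin_def
  by (intro Bochner_Integration.integral_cong refl)
     (simp add: exp_Complex_mult_of_real)

text \<open>On the line Re z = \<sigma> the Mellin transform is the Fourier transform of u \<mapsto>
  f (exp u) * exp (\<sigma> u), so Fourier inversion applies to that function; the weight is removed
  at the end.\<close>

lemma mellin_inversion:
  fixes f :: "real \<Rightarrow> real"
  assumes cont: "continuous_on {0<..} f"
    and nonneg: "\<And>s. s > 0 \<Longrightarrow> 0 \<le> f s"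
    and int: "integrable lborel (\<lambda>u. f (exp u) * exp (\<sigma> * u))"
    and intM: "integrable lborel (\<lambda>y. mellin f (Complex \<sigma> y))"
  shows "complex_of_real (f (exp u)) =
    1 / (2 * pi) * (\<integral>y. mellin f (Complex \<sigma> y) * exp (- Complex \<sigma> y * of_real u) \<partial>lborel)"
proof -
  have cont': "continuous_on UNIV (\<lambda>u. f (exp u) * exp (\<sigma> * u))"
    by (intro continuous_intros continuous_on_compose2[OF cont]) auto
  have "complex_of_real (f (exp u) * exp (\<sigma> * u)) =
      1 / (2 * pi) * (\<integral>y. mellin f (Complex \<sigma> y) * iexp (- (y * u)) \<partial>lborel)"
    by (rule fourier_inversion_nonneg[OF cont' _ int mellin_Complex intM]) (simp add: nonneg)
  then have "complex_of_real (f (exp u)) * exp (of_real (\<sigma> * u)) * exp (- of_real (\<sigma> * u)) =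
      1 / (2 * pi) * ((\<integral>y. mellin f (Complex \<sigma> y) * iexp (- (y * u)) \<partial>lborel) * exp (- of_real (\<sigma> * u)))"
    by (simp only: of_real_mult exp_of_real[symmetric] mult.assoc)
  also have "(\<integral>y. mellin f (Complex \<sigma> y) * iexp (- (y * u)) \<partial>lborel) * exp (- of_real (\<sigma> * u)) =
      (\<integral>y. mellin f (Complex \<sigma> y) * iexp (- (y * u)) * exp (- of_real (\<sigma> * u)) \<partial>lborel)"
    by (rule integral_mult_left_zero[symmetric])
  also have "\<dots> = (\<integral>y. mellin f (Complex \<sigma> y) * exp (- Complex \<sigma> y * of_real u) \<partial>lborel)"
    by (intro Bochner_Integration.integral_cong refl)
       (simp add: Complex_eq algebra_simps flip: exp_add)
  finally show ?thesis by (simp add: mult.assoc flip: exp_add)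
qed

text \<open>Only the factor f is inverted: its inversion formula is inserted, and after Fubini the
  inner integral assembles the transform of F. All decay in y thus rests on f, which will be the
  Gamma kernel.\<close>

lemma mellin_convolution_inversion:
  fixes f F :: "real \<Rightarrow> real"
  assumes cont: "continuous_on {0<..} f"
    and nonneg: "\<And>s. s > 0 \<Longrightarrow> 0 \<le> f s"
    and int: "integrable lborel (\<lambda>u. f (exp u) * exp (\<sigma> * u))"
    and intM: "integrable lborel (\<lambda>y. mellin f (Complex \<sigma> y))"
    and F[measurable]: "F \<in> borel_measurable borel"
    and intF: "integrable lborel (\<lambda>u. F (exp u) * exp (\<sigma> * u))"
  shows "complex_of_real (\<integral>u. f (exp (c - u)) * F (exp u) \<partial>lborel) =
    1 / (2 * pi) * (\<integral>y. mellin f (Complex \<sigma> y) * mellin F (Complex \<sigma> y) * exp (- Complex \<sigma> y * of_real c) \<partial>lborel)"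
proof -
  define m where "m y = mellin f (Complex \<sigma> y)" for y
  have int_m: "integrable lborel m" using intM by (simp add: m_def[abs_def])
  then have [measurable]: "m \<in> borel_measurable borel" by auto
  let ?g = "\<lambda>u y. m y * exp (- Complex \<sigma> y * of_real (c - u)) * of_real (F (exp u))"
  have meas: "case_prod ?g \<in> borel_measurable (lborel \<Otimes>\<^sub>M lborel)"
    by measurable
  have norm_g: "norm (?g u y) = norm (m y) * (exp (- \<sigma> * c) * \<bar>F (exp u) * exp (\<sigma> * u)\<bar>)" for u y
    by (simp add: norm_mult abs_mult algebra_simps flip: exp_add)
  have int_y: "integrable lborel (?g u)" for u
    by (rule Bochner_Integration.integrable_bound[OF integrable_mult_left[OF integrable_norm[OF int_m], of "exp (- \<sigma> * c) * \<bar>F (exp u) * exp (\<sigma> * u)\<bar>"]])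
       (measurable, simp only: norm_g real_norm_def abs_mult abs_norm_cancel abs_exp_cancel abs_abs, simp)
  have int_g: "integrable (lborel \<Otimes>\<^sub>M lborel) (case_prod ?g)"
  proof (rule lborel_pair.Fubini_integrable[OF meas])
    show "integrable lborel (\<lambda>u. \<integral>y. norm (case_prod ?g (u, y)) \<partial>lborel)"
      unfolding split norm_g
      using intF by (simp add: integrable_abs)
  qed (use int_y in simp)
  have "complex_of_real (\<integral>u. f (exp (c - u)) * F (exp u) \<partial>lborel) =
      (\<integral>u. complex_of_real (f (exp (c - u))) * of_real (F (exp u)) \<partial>lborel)"
    by (simp flip: integral_complex_of_real)
  also have "\<dots> = (\<integral>u. 1 / (2 * pi) * (\<integral>y. ?g u y \<partial>lborel) \<partial>lborel)"
    by (intro Bochner_Integration.integral_cong refl)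
       (simp add: mellin_inversion[OF cont nonneg int intM] m_def)
  also have "\<dots> = 1 / (2 * pi) * (\<integral>u. (\<integral>y. ?g u y \<partial>lborel) \<partial>lborel)"
    by (rule integral_mult_right_zero)
  also have "(\<integral>u. (\<integral>y. ?g u y \<partial>lborel) \<partial>lborel) = (\<integral>y. (\<integral>u. ?g u y \<partial>lborel) \<partial>lborel)"
    by (rule lborel_pair.Fubini_integral[OF int_g, symmetric])
  also have "\<dots> = (\<integral>y. m y * mellin F (Complex \<sigma> y) * exp (- Complex \<sigma> y * of_real c) \<partial>lborel)"
  proof (intro Bochner_Integration.integral_cong refl)
    fix y :: real
    have "(\<integral>u. ?g u y \<partial>lborel) = (\<integral>u. m y * exp (- Complex \<sigma> y * of_real c) * (of_real (F (exp u)) * exp (Complex \<sigma> y * of_real u)) \<partial>lborel)"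
      by (intro Bochner_Integration.integral_cong refl) (simp add: algebra_simps flip: exp_add)
    also have "\<dots> = m y * exp (- Complex \<sigma> y * of_real c) * mellin F (Complex \<sigma> y)"
      unfolding mellin_def by (rule integral_mult_right_zero)
    finally show "(\<integral>u. ?g u y \<partial>lborel) = m y * mellin F (Complex \<sigma> y) * exp (- Complex \<sigma> y * of_real c)"
      by (simp add: mult_ac)
  qed
  finally show ?thesis unfolding m_def .
qed

section \<open>Gamma and Beta functions on vertical lines\<close>

lemma nn_integral_Gamma_exp:
  fixes p :: real
  assumes "p > 0"
  shows "(\<integral>\<^sup>+u. ennreal (exp (p * u - exp u)) \<partial>lborel) = ennreal (Gamma p)"
proof -
  have "ennreal (Gamma p) = (\<integral>\<^sup>+t. ennreal (t powr (p - 1) / exp t) * indicator {0<..} t \<partial>lborel)"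
    unfolding Gamma_conv_nn_integral_real[OF assms]
  proof (rule nn_integral_cong_AE)
    have "AE t in lborel. t \<noteq> (0::real)" by (rule AE_lborel_singleton)
    then show "AE t in lborel. ennreal (indicator {0..} t * t powr (p - 1) / exp t) =
        ennreal (t powr (p - 1) / exp t) * indicator {0<..} t"
      by eventually_elim (auto simp: indicator_def)
  qed
  also have "\<dots> = (\<integral>\<^sup>+u. ennreal (exp u powr (p - 1) / exp (exp u)) * ennreal (exp u) \<partial>lborel)"
    by (rule nn_integral_exp_substitution) measurable
  also have "\<dots> = (\<integral>\<^sup>+u. ennreal (exp (p * u - exp u)) \<partial>lborel)"
    by (intro nn_integral_cong)
       (simp add: powr_def algebra_simps flip: ennreal_mult exp_add exp_diff)
  finally show ?thesis by simp
qed

lemma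
  assumes "Re z > - \<mu>"
  shows mellin_Gamma_integrable:
      "integrable lborel (\<lambda>u. complex_of_real (exp u powr \<mu> * exp (- exp u)) * exp (z * complex_of_real u))"
    and mellin_Gamma: "mellin (\<lambda>s. s powr \<mu> * exp (- s)) z = Gamma (z + of_real \<mu>)"
proof -
  have Gh: "(\<lambda>z. Gamma (z + of_real \<mu>)) holomorphic_on {z. - \<mu> < Re z \<and> Re z < Re z0 + 1}" for z0
    by (intro holomorphic_intros) (auto elim!: nonpos_Ints_cases simp: complex_eq_iff)
  note * = mellin_integrable_of_real[where f = "\<lambda>s. s powr \<mu> * exp (- s)" and a = "-\<mu>" and b = "Re z + 1" and M = "\<lambda>p. Gamma (p + \<mu>)", OF _ _ _ _ Gh]
   mellin_eq_of_real[where f = "\<lambda>s. s powr \<mu> * exp (- s)" and a = "-\<mu>" and b = "Re z + 1" and M = "\<lambda>p. Gamma (p + \<mu>)", OF _ _ _ _ Gh]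
  have nn: "(\<integral>\<^sup>+u. ennreal (exp u powr \<mu> * exp (- exp u) * exp (p * u)) \<partial>lborel) = ennreal (Gamma (p + \<mu>))"
    if "- \<mu> < p" for p
    using nn_integral_Gamma_exp[of "p + \<mu>"] that
    by (simp add: powr_def algebra_simps exp_diff exp_minus divide_inverse exp_add)
  show "integrable lborel (\<lambda>u. complex_of_real (exp u powr \<mu> * exp (- exp u)) * exp (z * complex_of_real u))"
    by (rule *(1)) (use assms nn in \<open>auto simp: Gamma_real_pos Gamma_complex_of_real simp flip: of_real_add\<close>)
  show "mellin (\<lambda>s. s powr \<mu> * exp (- s)) z = Gamma (z + of_real \<mu>)"
    by (rule *(2)) (use assms nn in \<open>auto simp: Gamma_real_pos Gamma_complex_of_real simp flip: of_real_add\<close>)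
qed

text \<open>The modulus of exp (z u) depends on Re z only, so a nonnegative f has its largest
  transform on the real axis. Applied to suitable f this bounds Gamma, quotients of Gamma functions
  and the inverse stable transform on vertical lines, without asymptotics.\<close>

lemma norm_mellin_le:
  assumes "\<And>s. s > 0 \<Longrightarrow> 0 \<le> f s"
  shows "cmod (mellin f z) \<le> cmod (mellin f (of_real (Re z)))"
proof -
  have "cmod (mellin f z) \<le> (\<integral>u. norm (complex_of_real (f (exp u)) * exp (z * of_real u)) \<partial>lborel)"
    unfolding mellin_def by (rule integral_norm_bound)
  also have "\<dots> = (\<integral>u. f (exp u) * exp (Re z * u) \<partial>lborel)"
    using assms by (intro Bochner_Integration.integral_cong refl) (simp add: norm_mult)
  also have "\<dots> \<le> cmod (of_real (\<integral>u. f (exp u) * exp (Re z * u) \<partial>lborel))"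
    by simp
  also have "of_real (\<integral>u. f (exp u) * exp (Re z * u) \<partial>lborel) = mellin f (of_real (Re z))"
    unfolding mellin_def integral_complex_of_real[symmetric] by (simp add: exp_of_real[symmetric])
  finally show ?thesis .
qed

lemma norm_Gamma_le:
  assumes "Re z > 0"
  shows "cmod (Gamma z) \<le> Gamma (Re z)"
  using norm_mellin_le[of "\<lambda>s. s powr 0 * exp (-s)" z] assms
  by (simp add: mellin_Gamma Gamma_complex_of_real Gamma_real_pos abs_of_pos del: powr_zero_eq_one)

lemma integrable_poly_decay:
  fixes A :: "real \<Rightarrow> complex"
  assumes [measurable]: "A \<in> borel_measurable borel"
    and A: "\<And>y. (1 + \<bar>y\<bar>) ^ 2 * cmod (A y) \<le> C"
  shows "integrable lborel A"
proof (rule Bochner_Integration.integrable_bound)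
  show "integrable lborel (\<lambda>y::real. C * inverse (1 + y^2))"
    using integrable_inverse_1_plus_square by (intro integrable_mult_right) (simp add: set_integrable_def)
  show "AE y in lborel. cmod (A y) \<le> norm (C * inverse (1 + y^2))"
  proof (intro AE_I2)
    fix y :: real
    have "(1 + y^2) * cmod (A y) \<le> (1 + \<bar>y\<bar>) ^ 2 * cmod (A y)"
      by (intro mult_right_mono) (auto simp: power2_eq_square algebra_simps)
    also have "\<dots> \<le> C" by (rule A)
    finally have "cmod (A y) \<le> C * inverse (1 + y^2)"
      by (simp add: field_simps add_pos_nonneg)
    then show "cmod (A y) \<le> norm (C * inverse (1 + y^2))" by simp
  qed
qed simp

text \<open>Each use of Gamma (z + 1) = z Gamma z trades a factor of size |z| for a shift of the
  line to \<sigma> + 1, and on every line to the right of 0 the modulus is bounded. Induction on n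
  therefore needs all \<sigma> at once.\<close>

lemma Gamma_vertical_decay:
  assumes "\<sigma> > 0"
  shows "\<exists>C. \<forall>y. (1 + \<bar>y\<bar>) ^ n * cmod (Gamma (Complex \<sigma> y)) \<le> C"
  using assms
proof (induction n arbitrary: \<sigma>)
  case 0
  then show ?case using norm_Gamma_le[of "Complex \<sigma> _"] by auto
next
  case (Suc n)
  obtain C where C: "\<And>y. (1 + \<bar>y\<bar>) ^ n * cmod (Gamma (Complex (\<sigma> + 1) y)) \<le> C"
    using Suc.IH[of "\<sigma> + 1"] Suc.prems by auto
  show ?case
  proof (intro exI allI)
    fix y
    let ?z = "Complex \<sigma> y"
    have "?z \<notin> \<int>\<^sub>\<le>\<^sub>0" using Suc.prems by (auto elim!: nonpos_Ints_cases simp: complex_eq_iff)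
    then have G: "Gamma (Complex (\<sigma> + 1) y) = ?z * Gamma ?z"
      using Gamma_plus1[of ?z] by (simp add: Complex_eq add_ac)
    have "\<sigma> \<le> cmod ?z" "\<bar>y\<bar> \<le> cmod ?z"
      using complex_Re_le_cmod[of ?z] abs_Im_le_cmod[of ?z] by auto
    then have "\<sigma> * (1 + \<bar>y\<bar>) \<le> (1 + \<sigma>) * cmod ?z"
      using Suc.prems add_mono[OF _ mult_left_mono[of "\<bar>y\<bar>" "cmod ?z" \<sigma>], of \<sigma> "cmod ?z"]
      by (simp add: algebra_simps)
    then have "(1 + \<bar>y\<bar>) \<le> (1 + \<sigma>) / \<sigma> * cmod ?z" using Suc.prems by (simp add: field_simps)
    then have "(1 + \<bar>y\<bar>) ^ Suc n * cmod (Gamma ?z) \<le> ((1 + \<sigma>) / \<sigma> * cmod ?z) * ((1 + \<bar>y\<bar>) ^ n * cmod (Gamma ?z))"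
      using mult_right_mono[of "1 + \<bar>y\<bar>" "(1 + \<sigma>) / \<sigma> * cmod ?z" "(1 + \<bar>y\<bar>) ^ n * cmod (Gamma ?z)"] by (simp add: mult_ac)
    also have "\<dots> = (1 + \<sigma>) / \<sigma> * ((1 + \<bar>y\<bar>) ^ n * cmod (Gamma (Complex (\<sigma> + 1) y)))"
      by (simp add: G norm_mult)
    also have "\<dots> \<le> (1 + \<sigma>) / \<sigma> * C"
      using C Suc.prems by (intro mult_left_mono) auto
    finally show "(1 + \<bar>y\<bar>) ^ Suc n * cmod (Gamma ?z) \<le> (1 + \<sigma>) / \<sigma> * C" .
  qed
qed

section \<open>The Beta transform and quotients of Gamma functions on vertical lines\<close>

lemma nn_integral_Beta_exp:
  fixes p b :: real
  assumes "p > 0" "b > 0"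
  shows "(\<integral>\<^sup>+u. ennreal ((if exp u < 1 then (1 - exp u) powr (b - 1) else 0) * exp (p * u)) \<partial>lborel) = ennreal (Beta p b)"
proof -
  have "ennreal (Beta p b) = (\<integral>\<^sup>+t. ennreal (indicator {0..1} t * (t powr (p - 1) * (1 - t) powr (b - 1))) \<partial>lborel)"
    using nn_integral_has_integral_lebesgue[OF _ has_integral_Beta_real[OF assms]] by simp
  also have "\<dots> = (\<integral>\<^sup>+t. ennreal ((if t < 1 then (1 - t) powr (b - 1) else 0) * t powr (p - 1)) * indicator {0<..} t \<partial>lborel)"
  proof (rule nn_integral_cong_AE)
    have "AE t in lborel. t \<noteq> (0::real)" "AE t in lborel. t \<noteq> (1::real)" by (rule AE_lborel_singleton)+
    then show "AE t in lborel. ennreal (indicator {0..1} t * (t powr (p - 1) * (1 - t) powr (b - 1))) =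
        ennreal ((if t < 1 then (1 - t) powr (b - 1) else 0) * t powr (p - 1)) * indicator {0<..} t"
      by eventually_elim (auto simp: indicator_def mult_ac)
  qed
  also have "\<dots> = (\<integral>\<^sup>+u. ennreal ((if exp u < 1 then (1 - exp u) powr (b - 1) else 0) * exp u powr (p - 1)) * ennreal (exp u) \<partial>lborel)"
    by (rule nn_integral_exp_substitution) measurable
  also have "\<dots> = (\<integral>\<^sup>+u. ennreal ((if exp u < 1 then (1 - exp u) powr (b - 1) else 0) * exp (p * u)) \<partial>lborel)"
    by (intro nn_integral_cong)
       (auto simp: powr_def algebra_simps simp flip: ennreal_mult exp_add)
  finally show ?thesis by simp
qed

lemma Beta_real_pos: "0 < a \<Longrightarrow> 0 < b \<Longrightarrow> 0 < Beta a (b::real)"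
  by (simp add: Beta_def Gamma_real_pos)

text \<open>This serves two purposes: with \<open>norm_mellin_le\<close> it compares Gamma on two
  vertical lines, and with b = 1 - \<nu> it is the effect of fractional integration on a complex
  power.\<close>

lemma
  fixes b :: real
  assumes "Re z > 0" "b > 0"
  shows mellin_Beta_integrable:
      "integrable lborel (\<lambda>u. complex_of_real (if exp u < 1 then (1 - exp u) powr (b - 1) else 0) * exp (z * complex_of_real u))"
    and mellin_Beta: "mellin (\<lambda>s. if s < 1 then (1 - s) powr (b - 1) else 0) z = Gamma z * Gamma (of_real b) / Gamma (z + of_real b)"
proof -
  \<comment> \<open>With 1/Gamma written as the entire function \<open>rGamma\<close>, holomorphy
    has to be checked for the numerator only.\<close>
  have hol: "(\<lambda>z. Gamma z * Gamma (of_real b) * rGamma (z + of_real b)) holomorphic_on {z. 0 < Re z \<and> Re z < Re z0 + 1}" for z0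
    using assms(2) by (intro holomorphic_intros) (auto elim!: nonpos_Ints_cases simp: complex_eq_iff)
  note * = mellin_integrable_of_real[where f = "\<lambda>s. if s < 1 then (1 - s) powr (b - 1) else 0" and a = 0 and b = "Re z + 1" and M = "\<lambda>p. Beta p b", OF _ _ _ _ hol]
   mellin_eq_of_real[where f = "\<lambda>s. if s < 1 then (1 - s) powr (b - 1) else 0" and a = 0 and b = "Re z + 1" and M = "\<lambda>p. Beta p b", OF _ _ _ _ hol]
  have MM: "Gamma (of_real p) * Gamma (of_real b) * rGamma (of_real p + of_real b) = complex_of_real (Beta p b)" for p
    by (simp add: Beta_altdef Gamma_complex_of_real rGamma_complex_of_real flip: of_real_add)
  show "integrable lborel (\<lambda>u. complex_of_real (if exp u < 1 then (1 - exp u) powr (b - 1) else 0) * exp (z * complex_of_real u))"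
    by (rule *(1)) (use assms nn_integral_Beta_exp MM in \<open>auto simp: Beta_real_pos less_imp_le\<close>)
  have "mellin (\<lambda>s. if s < 1 then (1 - s) powr (b - 1) else 0) z = Gamma z * Gamma (of_real b) * rGamma (z + of_real b)"
    by (rule *(2)) (use assms nn_integral_Beta_exp MM in \<open>auto simp: Beta_real_pos less_imp_le\<close>)
  then show "mellin (\<lambda>s. if s < 1 then (1 - s) powr (b - 1) else 0) z = Gamma z * Gamma (of_real b) / Gamma (z + of_real b)"
    by (simp add: Gamma_def divide_inverse)
qed

text \<open>With b = \<sigma>' - \<sigma> the quotient of the two values, times Gamma b, is a Beta
  transform and hence bounded by its value Beta \<sigma> b at the real point.\<close>

lemma Gamma_vertical_shift_le:
  assumes "0 < \<sigma>" "\<sigma> < \<sigma>'"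
  shows "\<exists>C>0. \<forall>y. cmod (Gamma (Complex \<sigma> y)) \<le> C * cmod (Gamma (Complex \<sigma>' y))"
proof -
  define b where "b = \<sigma>' - \<sigma>"
  have b: "b > 0" using assms by (simp add: b_def)
  have G: "Gamma b > 0" using b by (rule Gamma_real_pos)
  have "cmod (Gamma (Complex \<sigma> y)) \<le> Beta \<sigma> b / Gamma b * cmod (Gamma (Complex \<sigma>' y))" for y
  proof -
    have nz: "Gamma (Complex \<sigma>' y) \<noteq> 0"
      using assms by (subst Gamma_eq_zero_iff) (auto elim!: nonpos_Ints_cases simp: complex_eq_iff)
    have "cmod (Gamma (Complex \<sigma> y) * Gamma (of_real b) / Gamma (Complex \<sigma> y + of_real b)) \<le>
        cmod (Gamma (of_real \<sigma>) * Gamma (of_real b) / Gamma (of_real \<sigma> + of_real b))"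
      using norm_mellin_le[of "\<lambda>s. if s < 1 then (1 - s) powr (b - 1) else 0" "Complex \<sigma> y"] assms b
      by (simp add: mellin_Beta)
    also have "\<dots> = Beta \<sigma> b"
      using Gamma_real_pos[of \<sigma>] Gamma_real_pos[of b] Gamma_real_pos[of "\<sigma> + b"] assms b
      by (simp add: Beta_def Gamma_complex_of_real norm_mult norm_divide flip: of_real_add)
    also have "Complex \<sigma> y + of_real b = Complex \<sigma>' y" by (simp add: b_def complex_eq_iff)
    finally show ?thesis
      using nz G by (simp add: norm_mult norm_divide Gamma_complex_of_real field_simps)
  qed
  moreover have "Beta \<sigma> b / Gamma b > 0" using Beta_real_pos[OF assms(1) b] G by simp
  ultimately show ?thesis by blast
qed

text \<open>On Re z = 1/2 the reflection z \<mapsto> 1 - z is complex conjugation, so the reflection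
  formula yields the squared modulus. This identity is the source of the exponential decay used
  below.\<close>

lemma norm_Gamma_half_sq: "(cmod (Gamma (Complex (1/2) y)))\<^sup>2 = pi / cosh (pi * y)"
proof -
  have "Gamma (Complex (1/2) y) * Gamma (1 - Complex (1/2) y) = of_real pi / sin (of_real pi * Complex (1/2) y)"
    by (rule Gamma_reflection_complex)
  also have "1 - Complex (1/2) y = cnj (Complex (1/2) y)" by (simp add: complex_eq_iff)
  also have "sin (of_real pi * Complex (1/2) y) = of_real (cosh (pi * y))"
  proof -
    have "of_real pi * Complex (1/2) y = of_real (pi * y) * \<i> + of_real pi / 2"
      by (simp add: complex_eq_iff)
    also have "sin \<dots> = cos (\<i> * of_real (pi * y))"
      by (simp add: sin_add mult.commute)
    also have "\<dots> = cosh (of_real (pi * y))" by (simp add: cosh_conv_cos)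
    also have "\<dots> = of_real (cosh (pi * y))" by (simp add: cosh_def scaleR_conv_of_real flip: exp_of_real)
    finally show ?thesis .
  qed
  finally have "complex_of_real ((cmod (Gamma (Complex (1/2) y)))\<^sup>2) = of_real (pi / cosh (pi * y))"
    by (simp only: cnj_Gamma[symmetric] complex_norm_square of_real_divide)
  then show ?thesis by (simp only: of_real_eq_iff)
qed


lemma poly_times_exp_neg_bounded:
  fixes k x :: real
  assumes "k > 0" "x \<ge> 0"
  shows "(1 + x) ^ n * exp (- (k * x)) \<le> (real (Suc n) / k) ^ n * exp k"
proof -
  \<comment> \<open>Chosen so that the n-th power of 1 + x \<le> exp (c (1 + x)) / c has an exponent
    of at most k (1 + x); \<open>Suc n\<close> avoids a division by 0 when n = 0.\<close>
  define c where "c = k / real (Suc n)"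
  have c: "c > 0" "real n * c \<le> k" using assms by (auto simp: c_def field_simps)
  have "c * (1 + x) \<le> exp (c * (1 + x))" using exp_ge_add_one_self[of "c * (1 + x)"] by linarith
  then have "1 + x \<le> exp (c * (1 + x)) / c" using c by (simp add: field_simps)
  then have "(1 + x) ^ n \<le> (exp (c * (1 + x)) / c) ^ n" using assms by (intro power_mono) auto
  also have "\<dots> = (1 / c) ^ n * exp (real n * c * (1 + x))"
    by (simp add: power_divide exp_of_nat_mult[symmetric] mult.assoc)
  also have "\<dots> \<le> (1 / c) ^ n * exp (k * (1 + x))"
    using c assms by (intro mult_left_mono iffD2[OF exp_le_cancel_iff] mult_right_mono) auto
  finally have "(1 + x) ^ n * exp (- (k * x)) \<le> (1 / c) ^ n * exp (k * (1 + x)) * exp (- (k * x))"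
    by (intro mult_right_mono) auto
  also have "\<dots> = (real (Suc n) / k) ^ n * exp k"
    by (simp add: c_def algebra_simps exp_add exp_minus del: of_nat_Suc)
  finally show ?thesis .
qed

text \<open>The numerator lies on Re = 1/2, where its modulus is known exactly. The denominator lies
  on Re = 1 - \<nu>/2 > 1/2 and is bounded below by its counterpart on Re = 1/2. The quotient of the
  hyperbolic cosines then decays exponentially, because y/\<nu> outgrows y; k is half of that rate,
  since the identity concerns squares.\<close>

lemma Gamma_ratio_vertical_decay:
  fixes \<nu> :: real
  assumes \<nu>: "0 < \<nu>" "\<nu> < 1"
  shows "\<exists>C. \<forall>y. (1 + \<bar>y\<bar>) ^ n * cmod (Gamma (1 - Complex (\<nu>/2) y / of_real \<nu>) / Gamma (1 - Complex (\<nu>/2) y)) \<le> C"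
proof -
  obtain C where C: "C > 0" "\<And>y. cmod (Gamma (Complex (1/2) y)) \<le> C * cmod (Gamma (Complex (1 - \<nu>/2) y))"
    using Gamma_vertical_shift_le[of "1/2" "1 - \<nu>/2"] \<nu> by auto
  define k where "k = pi * (1 / \<nu> - 1) / 2"
  have k: "k > 0" using \<nu> by (simp add: k_def field_simps)
  have cosh_le: "cosh t \<le> exp \<bar>t\<bar>" and cosh_ge: "exp \<bar>t\<bar> / 2 \<le> cosh t" for t :: real
    by (cases "t \<ge> 0"; simp add: cosh_def abs_if)+
  have "cmod (Gamma (1 - Complex (\<nu>/2) y / of_real \<nu>) / Gamma (1 - Complex (\<nu>/2) y)) \<le> C * sqrt 2 * exp (- (k * \<bar>y\<bar>))" for y
  proof -
    have eq: "1 - Complex (\<nu>/2) y / of_real \<nu> = Complex (1/2) (- y / \<nu>)" "1 - Complex (\<nu>/2) y = Complex (1 - \<nu>/2) (- y)"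
      using \<nu> by (auto simp: complex_eq_iff)
    let ?a = "cmod (Gamma (Complex (1/2) (- y / \<nu>)))" and ?b = "cmod (Gamma (Complex (1/2) (- y)))"
      and ?d = "cmod (Gamma (Complex (1 - \<nu>/2) (- y)))"
    have b0: "?b > 0"
      by (simp, subst Gamma_eq_zero_iff) (auto elim!: nonpos_Ints_cases simp: complex_eq_iff)
    have "(?a / ?b)\<^sup>2 = cosh (pi * y) / cosh (pi * y / \<nu>)"
      using norm_Gamma_half_sq[of "- y / \<nu>"] norm_Gamma_half_sq[of "- y"]
      unfolding power_divide by simp
    also have "\<dots> \<le> exp \<bar>pi * y\<bar> / (exp \<bar>pi * y / \<nu>\<bar> / 2)"
      by (intro frac_le cosh_le cosh_ge) auto
    also have "\<dots> = 2 * (exp (\<bar>pi * y\<bar>) / exp (\<bar>pi * y / \<nu>\<bar>))" by simp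
    also have "\<dots> = 2 * exp (\<bar>pi * y\<bar> - \<bar>pi * y / \<nu>\<bar>)" by (simp add: exp_diff)
    also have "\<bar>pi * y\<bar> - \<bar>pi * y / \<nu>\<bar> = - (k * \<bar>y\<bar>) + - (k * \<bar>y\<bar>)"
      using \<nu> by (simp add: k_def abs_mult field_simps)
    also have "2 * exp (- (k * \<bar>y\<bar>) + - (k * \<bar>y\<bar>)) = (sqrt 2 * exp (- (k * \<bar>y\<bar>)))\<^sup>2"
      unfolding exp_add power_mult_distrib by (simp add: power2_eq_square)
    finally have "?a / ?b \<le> sqrt 2 * exp (- (k * \<bar>y\<bar>))"
      by (rule power2_le_imp_le) auto
    have "0 < C * ?d" using C(2)[of "-y"] b0 by linarith
    then have d0: "?d > 0" using C(1) by (simp add: zero_less_mult_iff)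
    have "?a / ?d \<le> C * (?a / ?b)"
      using C(1) C(2)[of "-y"] b0 d0 mult_left_mono[OF C(2)[of "-y"], of ?a] by (simp add: field_simps)
    also have "\<dots> \<le> C * (sqrt 2 * exp (- (k * \<bar>y\<bar>)))"
      using C(1) \<open>?a / ?b \<le> _\<close> by (intro mult_left_mono) auto
    finally show ?thesis unfolding eq norm_divide by (simp add: mult_ac)
  qed
  then have "(1 + \<bar>y\<bar>) ^ n * cmod (Gamma (1 - Complex (\<nu>/2) y / of_real \<nu>) / Gamma (1 - Complex (\<nu>/2) y)) \<le>
      (1 + \<bar>y\<bar>) ^ n * (C * sqrt 2 * exp (- (k * \<bar>y\<bar>)))" for y
    by (intro mult_left_mono) auto
  also have "(1 + \<bar>y\<bar>) ^ n * (C * sqrt 2 * exp (- (k * \<bar>y\<bar>))) \<le> C * sqrt 2 * ((real (Suc n) / k) ^ n * exp k)" for y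
  proof -
    have "(1 + \<bar>y\<bar>) ^ n * (C * sqrt 2 * exp (- (k * \<bar>y\<bar>))) = C * sqrt 2 * ((1 + \<bar>y\<bar>) ^ n * exp (- (k * \<bar>y\<bar>)))"
      by (simp only: mult_ac)
    also have "\<dots> \<le> C * sqrt 2 * ((real (Suc n) / k) ^ n * exp k)"
      by (intro mult_left_mono poly_times_exp_neg_bounded k mult_nonneg_nonneg) (use C(1) in auto)
    finally show ?thesis .
  qed
  finally show ?thesis by blast
qed

section \<open>Gauss's multiplication formula\<close>

text \<open>The polynomial 1 + X + ... + X^(N-1) factors over the nontrivial N-th roots of unity.
  Its value at 1 is N, and the distance of 1 from cis (2a) is 2 sin a.\<close>

lemma prod_sin_multiples:
  fixes N :: nat
  assumes "N > 0"
  shows "(\<Prod>k=1..<N. 2 * sin (pi * real k / real N)) = real N"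
proof -
  define w where "w k = cis (2 * pi * real k / real N)" for k
  define p where "p = (\<Prod>k=1..<N. [:- w k, 1:])"
  define q where "q = (\<Sum>k<N. monom (1::complex) k)"
  have inj: "inj_on w {..<N}"
    using Complex.bij_betw_roots_unity[OF assms] by (simp add: bij_betw_def w_def[abs_def])
  then have inj': "inj_on w {1..<N}" by (rule inj_on_subset) auto
  have wN: "w k ^ N = 1" if "k < N" for k
    using bij_betw_apply[OF Complex.bij_betw_roots_unity[OF assms], of k] that by (simp add: w_def)
  have w0: "w 0 = 1" by (simp add: w_def)
  \<comment> \<open>Both have degree at most N - 1 and the same coefficient there, so N - 1 common
    values suffice; at the nontrivial roots of unity both vanish.\<close>
  have "p = q"
  proof (rule poly_eqI_degree_lead_coeff[where n = "N - 1" and A = "w ` {1..<N}"])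
    have degp: "degree p = N - 1" unfolding p_def by (subst degree_prod_eq_sum_degree) auto
    then show "degree p \<le> N - 1" by simp
    have "lead_coeff p = 1" unfolding p_def by (subst lead_coeff_prod) simp
    then have "coeff p (N - 1) = 1" by (simp add: degp)
    moreover have "coeff q (N - 1) = 1" using assms by (simp add: q_def coeff_sum)
    ultimately show "coeff p (N - 1) = coeff q (N - 1)" by simp
    show "N - 1 \<le> card (w ` {1..<N})" using inj' by (simp add: card_image)
    show "degree q \<le> N - 1" unfolding q_def
      by (rule degree_sum_le) (auto simp: degree_monom_eq)
    fix z assume "z \<in> w ` {1..<N}"
    then obtain k where k: "k \<in> {1..<N}" "z = w k" by auto
    have "w k \<noteq> 1" using inj_onD[OF inj, of k 0] k w0 assms by auto
    then have "poly q z = 0"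
      by (simp add: q_def poly_sum poly_monom k(2) sum_gp_strict wN k(1)[simplified])
    moreover have "poly p z = 0" unfolding p_def poly_prod using k by (auto intro!: prod_zero)
    ultimately show "poly p z = poly q z" by simp
  qed
  then have "poly p 1 = poly q 1" by simp
  then have "(\<Prod>k=1..<N. 1 - w k) = of_nat N"
    by (simp add: p_def q_def poly_prod poly_sum poly_monom)
  then have "(\<Prod>k=1..<N. cmod (1 - w k)) = real N"
    by (metis norm_of_nat prod_norm)
  moreover have "cmod (1 - w k) = 2 * sin (pi * real k / real N)" if "k \<in> {1..<N}" for k
  proof -
    define a where "a = pi * real k / real N"
    have a: "0 \<le> a" "a \<le> pi" using that by (auto simp: a_def field_simps)
    have "(cmod (1 - w k))\<^sup>2 = (1 - cos (2 * a))\<^sup>2 + (sin (2 * a))\<^sup>2"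
      by (simp add: w_def cmod_power2 a_def mult.assoc)
    also have "\<dots> = 2 - 2 * cos (2 * a)"
      using sin_cos_squared_add[of "2 * a"] by (simp add: power2_eq_square algebra_simps)
    also have "\<dots> = (2 * sin a)\<^sup>2" by (simp add: cos_double_sin power_mult_distrib)
    finally have "cmod (1 - w k) = 2 * sin a"
      by (rule power2_eq_imp_eq) (use sin_ge_zero[OF a] in auto)
    then show ?thesis by (simp only: a_def)
  qed
  ultimately show ?thesis by simp
qed

lemma Gamma_reflection_real: "Gamma x * Gamma (1 - x) = pi / sin (pi * x)" for x :: real
proof -
  have "complex_of_real (Gamma x * Gamma (1 - x)) = Gamma (of_real x) * Gamma (1 - of_real x)"
    using Gamma_complex_of_real[of "1 - x"] by (simp add: Gamma_complex_of_real)
  also have "\<dots> = of_real pi / sin (of_real pi * of_real x)"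
    by (rule Gamma_reflection_complex)
  also have "\<dots> = of_real (pi / sin (pi * x))"
    using sin_of_real[of "pi * x", where 'a = complex] by simp
  finally show ?thesis by (simp only: of_real_eq_iff)
qed

text \<open>Multiplying the product by its own reversal pairs k with N - k, and the reflection
  formula turns every pair into a sine.\<close>

lemma prod_Gamma_multiples:
  fixes N :: nat
  assumes "N > 0"
  shows "(\<Prod>k=1..<N. Gamma (real k / real N)) = sqrt ((2 * pi) ^ (N - 1) / real N)"
proof -
  let ?P = "\<Prod>k=1..<N. Gamma (real k / real N)"
  have "?P = (\<Prod>k=1..<N. Gamma (real (N - k) / real N))"
    by (rule prod.reindex_bij_witness[of _ "\<lambda>k. N - k" "\<lambda>k. N - k"]) auto
  then have "?P * ?P = (\<Prod>k=1..<N. Gamma (real k / real N) * Gamma (real (N - k) / real N))"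
    by (simp add: prod.distrib)
  also have "\<dots> = (\<Prod>k=1..<N. 2 * pi / (2 * sin (pi * real k / real N)))"
  proof (intro prod.cong refl)
    fix k assume k: "k \<in> {1..<N}"
    have eq: "real (N - k) / real N = 1 - real k / real N" using k by (auto simp: of_nat_diff field_simps)
    show "Gamma (real k / real N) * Gamma (real (N - k) / real N) = 2 * pi / (2 * sin (pi * real k / real N))"
      using Gamma_reflection_real[of "real k / real N"] unfolding eq by simp
  qed
  also have "\<dots> = (2 * pi) ^ (N - 1) / real N"
    by (simp only: prod_dividef prod_sin_multiples[OF assms] prod_constant card_atLeastLessThan)
  finally have "?P\<^sup>2 = (2 * pi) ^ (N - 1) / real N" by (simp add: power2_eq_square)
  moreover have "?P \<ge> 0" by (intro prod_nonneg) (auto intro!: less_imp_le Gamma_real_pos)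
  ultimately show ?thesis by (rule real_sqrt_unique[symmetric])
qed

lemma convex_on_eqI:
  assumes f: "convex_on S f" and eq: "\<And>x. x \<in> S \<Longrightarrow> f x = g x"
  shows "convex_on S g"
proof -
  have S: "convex S" using f by (rule convex_on_imp_convex)
  show ?thesis
  proof (rule convex_onI[OF _ S])
    fix t :: real and x y assume *: "0 < t" "t < 1" "x \<in> S" "y \<in> S"
    then have "(1 - t) *\<^sub>R x + t *\<^sub>R y \<in> S" by (intro convexD_alt[OF S]) auto
    then show "g ((1 - t) *\<^sub>R x + t *\<^sub>R y) \<le> (1 - t) * g x + t * g y"
      using convex_onD[OF f, of t x y] * by (simp add: eq)
  qed
qed

text \<open>A Bohr-Mollerup argument: \<open>G\<close> is the right-hand side as a function of y = N
  x, normalised to 1 at y = 1. It satisfies the functional equation and is logarithmically convex,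
  hence is Gamma; the normalising constant is evaluated separately.\<close>

theorem Gamma_multiplication_real:
  fixes N :: nat and x :: real
  assumes N: "N > 0" and x: "x > 0"
  shows "Gamma (real N * x) = real N powr (real N * x - 1/2) / sqrt (2 * pi) ^ (N - 1) * (\<Prod>k<N. Gamma (x + real k / real N))"
proof -
  define P where "P = (\<Prod>k<N. Gamma ((1 + real k) / real N))"
  define G where "G y = real N powr (y - 1) * (\<Prod>k<N. Gamma ((y + real k) / real N)) / P" for y :: real
  have P: "P > 0" unfolding P_def using N by (intro prod_pos) (auto intro!: Gamma_real_pos)
  have prod_pos': "(\<Prod>k<N. Gamma ((y + real k) / real N)) > 0" if "y > 0" for y :: real
    using N that by (intro prod_pos) (auto intro!: Gamma_real_pos divide_pos_pos)
  have "G (real N * x) = Gamma (real N * x)"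
  proof (rule Gamma_pos_real_unique)
    show "real N * x > 0" using N x by simp
    show "G 1 = 1" using P N unfolding G_def P_def[symmetric] by simp
    show "G y > 0" if "y > 0" for y using prod_pos'[OF that] P N by (simp add: G_def)
    \<comment> \<open>Replacing y by y + 1 shifts k by one, so only the end factors change: Gamma
      (y/N) gives way to Gamma (y/N + 1) = y/N * Gamma (y/N). The stray 1/N is absorbed by the power
      of N in \<open>G\<close>.\<close>
    show "G (y + 1) = y * G y" if y: "y > 0" for y
    proof -
      have "(\<Prod>k<N. Gamma ((y + 1 + real k) / real N)) * Gamma (y / real N) = (\<Prod>k<Suc N. Gamma ((y + real k) / real N))"
        by (subst prod.lessThan_Suc_shift) (simp add: algebra_simps)
      also have "\<dots> = (\<Prod>k<N. Gamma ((y + real k) / real N)) * Gamma (y / real N + 1)"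
        using N by (simp add: add_divide_distrib)
      also have "Gamma (y / real N + 1) = y / real N * Gamma (y / real N)"
        using y N nonpos_Ints_nonpos[of "y / real N"] by (intro Gamma_plus1) (auto simp: field_simps)
      finally have "(\<Prod>k<N. Gamma ((y + 1 + real k) / real N)) * Gamma (y / real N) =
          (y / real N * (\<Prod>k<N. Gamma ((y + real k) / real N))) * Gamma (y / real N)" by (simp add: mult_ac)
      moreover have "Gamma (y / real N) > 0" using y N by (intro Gamma_real_pos) auto
      then have ne: "Gamma (y / real N) \<noteq> 0" by simp
      ultimately have "(\<Prod>k<N. Gamma ((y + 1 + real k) / real N)) = y / real N * (\<Prod>k<N. Gamma ((y + real k) / real N))"
        unfolding mult_right_cancel[OF ne] by blast
      then show ?thesis using N by (simp add: G_def powr_diff)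
    qed
    show "convex_on {0<..} (ln \<circ> G)"
    proof -
      have "convex_on {0<..} (\<lambda>y. (ln \<circ> Gamma) ((y + real k) / real N))" for k
      proof (rule convex_onI)
        fix t a b :: real assume *: "0 < t" "t < 1" "a \<in> {0<..}" "b \<in> {0<..}"
        have "((1 - t) *\<^sub>R a + t *\<^sub>R b + real k) / real N = (1 - t) *\<^sub>R ((a + real k) / real N) + t *\<^sub>R ((b + real k) / real N)"
          using N by (simp add: field_simps)
        then show "(ln \<circ> Gamma) (((1 - t) *\<^sub>R a + t *\<^sub>R b + real k) / real N) \<le>
            (1 - t) * (ln \<circ> Gamma) ((a + real k) / real N) + t * (ln \<circ> Gamma) ((b + real k) / real N)"
          using * N convex_onD[OF log_convex_Gamma_real, of t "(a + real k) / real N" "(b + real k) / real N"]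
          by (auto simp: add_pos_nonneg)
      qed (rule convex_real_interval)
      then have "convex_on {0<..} (\<lambda>y. \<Sum>k<m. (ln \<circ> Gamma) ((y + real k) / real N))" for m
        by (induction m) (auto intro!: convex_on_add simp: convex_on_const)
      moreover have "convex_on {0<..} (\<lambda>y::real. (y - 1) * ln (real N) - ln P)"
        by (intro convex_onI) (auto simp: algebra_simps)
      ultimately have "convex_on {0<..} (\<lambda>y. (\<Sum>k<N. (ln \<circ> Gamma) ((y + real k) / real N)) + ((y - 1) * ln (real N) - ln P))"
        by (rule convex_on_add)
      then show ?thesis
      proof (rule convex_on_eqI)
        fix y :: real assume y: "y \<in> {0<..}"
        define Q where "Q = (\<Prod>k<N. Gamma ((y + real k) / real N))"
        have Q: "Q > 0" using prod_pos'[of y] y by (simp add: Q_def)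
        have "ln Q = (\<Sum>k<N. ln (Gamma ((y + real k) / real N)))"
        proof -
          have pos: "Gamma ((y + real k) / real N) > 0" for k
            using y N by (intro Gamma_real_pos divide_pos_pos) auto
          show ?thesis unfolding Q_def by (rule ln_prod) (simp, metis pos order_less_irrefl)
        qed
        moreover have "G y = real N powr (y - 1) * Q / P" by (simp only: G_def Q_def)
        ultimately show "(\<Sum>k<N. (ln \<circ> Gamma) ((y + real k) / real N)) + ((y - 1) * ln (real N) - ln P) = (ln \<circ> G) y"
          using Q N P by (simp add: ln_mult ln_div ln_powr)
      qed
    qed
  qed
  moreover have "G (real N * x) = real N powr (real N * x - 1) / P * (\<Prod>k<N. Gamma (x + real k / real N))"
    using N by (simp add: G_def add_divide_distrib)
  \<comment> \<open>The last factor of \<open>P\<close> is Gamma 1 = 1; the remaining ones form the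
    product evaluated through the sines.\<close>
  moreover have "P = sqrt ((2 * pi) ^ (N - 1) / real N)"
  proof -
    have "P = (\<Prod>k<N. Gamma (real (Suc k) / real N))" by (simp add: P_def)
    also have "\<dots> = (\<Prod>k=1..<Suc N. Gamma (real k / real N))"
      by (rule prod.reindex_bij_witness[of _ "\<lambda>k. k - 1" Suc]) auto
    also have "\<dots> = (\<Prod>k=1..<N. Gamma (real k / real N))"
      using N by (simp add: prod.atLeastLessThan_Suc)
    finally show ?thesis using prod_Gamma_multiples[OF N] by simp
  qed
  moreover have "real N powr (real N * x - 1) / sqrt ((2 * pi) ^ (N - 1) / real N) = real N powr (real N * x - 1/2) / sqrt (2 * pi) ^ (N - 1)"
  proof -
    have "real N powr (real N * x - 1/2) = real N powr (real N * x - 1) * real N powr (1/2)"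
      by (simp flip: powr_add)
    then show ?thesis using N unfolding real_sqrt_divide real_sqrt_power by (simp add: powr_half_sqrt)
  qed
  ultimately show ?thesis by (simp only:)
qed

section \<open>The stable density\<close>

lemma stable_subordinator_nonneg:
  assumes "stable_subordinator M \<nu> \<tau>" "t \<ge> 0"
  shows "AE \<omega> in M. 0 \<le> \<tau> t \<omega>"
proof -
  have "AE \<omega> in M. \<tau> 0 \<omega> = 0" "AE \<omega> in M. mono_on {0..} (\<lambda>t. \<tau> t \<omega>)"
    using assms(1) by (auto simp: stable_subordinator_def levy_process_def)
  then show ?thesis
  proof eventually_elim
    case (elim \<omega>)
    then show ?case using mono_onD[OF elim(2), of 0 t] assms(2) by simp
  qed
qed

text \<open>The expectation sees the density on the positive half-line only, because \<tau> t > 0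
  almost surely: monotone paths starting at 0 are nonnegative, and a law with a density does not
  charge the point 0.\<close>

lemma stable_density_laplace:
  assumes S: "stable_subordinator M \<nu> \<tau>" and D: "marginal_density M \<tau> h"
    and t: "t > 0" and c: "c > 0"
  shows "(\<integral>\<^sup>+s. ennreal (h s t * exp (- c * s)) * indicator {0<..} s \<partial>lborel) = ennreal (exp (- t * c powr \<nu>))"
proof -
  have dist: "distributed M lborel (\<tau> t) (\<lambda>s. ennreal (h s t))" and h0: "\<And>s. 0 \<le> h s t"
    using D t by (auto simp: marginal_density_def)
  have int: "integrable M (\<lambda>\<omega>. exp (- c * \<tau> t \<omega>))" "(\<integral>\<omega>. exp (- c * \<tau> t \<omega>) \<partial>M) = exp (- t * c powr \<nu>)"
    using S t c by (auto simp: stable_subordinator_def)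
  have "(\<integral>\<^sup>+\<omega>. indicator {0::real} (\<tau> t \<omega>) \<partial>M) = (\<integral>\<^sup>+s. ennreal (h s t) * indicator {0} s \<partial>lborel)"
    by (rule distributed_nn_integral[OF dist, symmetric]) simp
  also have "\<dots> = 0" by (intro nn_integral_null_set) (simp add: null_sets_def)
  finally have "AE \<omega> in M. indicator {0::real} (\<tau> t \<omega>) = (0::ennreal)"
    using distributed_measurable[OF dist] by (subst (asm) nn_integral_0_iff_AE) auto
  moreover have "AE \<omega> in M. 0 \<le> \<tau> t \<omega>" using stable_subordinator_nonneg[OF S] t by simp
  ultimately have pos: "AE \<omega> in M. \<tau> t \<omega> > 0"
  proof eventually_elim
    case (elim \<omega>)
    then show ?case by (cases "\<tau> t \<omega> = 0") auto
  qed
  have "(\<integral>\<^sup>+s. ennreal (h s t * exp (- c * s)) * indicator {0<..} s \<partial>lborel)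
      = (\<integral>\<^sup>+s. ennreal (h s t) * (ennreal (exp (- c * s)) * indicator {0<..} s) \<partial>lborel)"
    using h0 by (intro nn_integral_cong) (simp add: ennreal_mult mult.assoc)
  also have "\<dots> = (\<integral>\<^sup>+\<omega>. ennreal (exp (- c * \<tau> t \<omega>)) * indicator {0<..} (\<tau> t \<omega>) \<partial>M)"
    by (rule distributed_nn_integral[OF dist]) measurable
  also have "\<dots> = (\<integral>\<^sup>+\<omega>. ennreal (exp (- c * \<tau> t \<omega>)) \<partial>M)"
    by (rule nn_integral_cong_AE) (use pos in \<open>eventually_elim, simp\<close>)
  also have "\<dots> = ennreal (exp (- t * c powr \<nu>))"
    using int by (subst nn_integral_eq_integral) auto
  finally show ?thesis .
qed

text \<open>Differentiating the Laplace transform makes moments of every order below \<open>\<nu>\<close>,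
  of either sign, accessible by a single computation.\<close>

lemma laplace_derivative:
  fixes f :: "real \<Rightarrow> real"
  assumes f[measurable]: "f \<in> borel_measurable borel" and f0: "\<And>s. 0 \<le> f s"
    and L: "\<And>c. c > 0 \<Longrightarrow> (\<integral>\<^sup>+s. ennreal (f s * exp (- c * s)) * indicator {0<..} s \<partial>lborel) = ennreal (exp (- t * c powr \<nu>))"
    and c: "c > 0"
  shows "(\<integral>\<^sup>+s. ennreal (s * f s * exp (- c * s)) * indicator {0<..} s \<partial>lborel) = ennreal (t * \<nu> * c powr (\<nu> - 1) * exp (- t * c powr \<nu>))"
proof -
  let ?F = "\<lambda>c s. indicator {0<..} s * (f s * exp (- c * s)) :: real"
  have nn: "(\<integral>\<^sup>+s. ennreal (?F c s) \<partial>lborel) = ennreal (exp (- t * c powr \<nu>))" if "c > 0" for c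
    using L[OF that] f0 by (subst L[OF that, symmetric], intro nn_integral_cong) (simp add: indicator_def)
  have int: "integrable lborel (?F c)" if "c > 0" for c
    using nn[OF that] f0 by (intro integrableI_bounded) (auto simp: abs_mult)
  have val: "(\<integral>s. ?F c s \<partial>lborel) = exp (- t * c powr \<nu>)" if "c > 0" for c
    using nn[OF that] f0 by (subst integral_eq_nn_integral) auto
  \<comment> \<open>The factor s is paid for by lowering the rate from at least c/2 to c/4. The
    dominating function is then a multiple of the Laplace integrand at c/4, whose integral is known
    to be finite.\<close>
  have bnd: "s * exp (- x * s) \<le> (4 / c) * exp (- (c/4) * s)" if "s \<ge> 0" "x \<ge> c / 2" for s x :: real
  proof -
    have "(c/4) * s \<le> exp ((c/4) * s)" using exp_ge_add_one_self[of "(c/4) * s"] by linarith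
    then have "s \<le> (4/c) * exp ((c/4) * s)" using c by (simp add: field_simps)
    moreover have "exp (- x * s) \<le> exp (- (c/2) * s)" using mult_right_mono[OF that(2,1)] by simp
    ultimately have "s * exp (- x * s) \<le> ((4/c) * exp ((c/4) * s)) * exp (- (c/2) * s)"
      using that c by (intro mult_mono) auto
    also have "\<dots> = (4/c) * exp ((c/4) * s + (- (c/2) * s))" by (simp only: exp_add mult.assoc)
    also have "(c/4) * s + (- (c/2) * s) = - (c/4) * s" by simp
    finally show ?thesis .
  qed
  have D: "((\<lambda>c. \<integral>s. ?F c s \<partial>lborel) has_real_derivative (\<integral>s. - s * ?F c s \<partial>lborel)) (at c)"
  proof (rule has_field_derivative_lebesgue_integral[where r = "c/2" and F' = "\<lambda>c s. - s * ?F c s" and g = "\<lambda>s. (4/c) * ?F (c/4) s"])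
    have near: "x \<ge> c / 2" "x > 0" if "x \<in> ball c (c/2)" for x
      using that c by (auto simp: dist_real_def abs_if split: if_splits)
    show "integrable lborel (?F x)" if "x \<in> ball c (c/2)" for x
      by (rule int) (rule near[OF that])
    show "integrable lborel (\<lambda>s. (4/c) * ?F (c/4) s)" using c by (intro integrable_mult_right int) auto
    show "AE s in lborel. \<forall>x\<in>ball c (c/2). ((\<lambda>x. ?F x s) has_field_derivative - s * ?F x s) (at x)"
      by (intro AE_I2 ballI) (auto intro!: derivative_eq_intros)
    show "AE s in lborel. \<forall>x\<in>ball c (c/2). norm (- s * ?F x s) \<le> (4/c) * ?F (c/4) s"
    proof (intro AE_I2 ballI)
      fix s x assume x: "x \<in> ball c (c/2)"
      show "norm (- s * ?F x s) \<le> (4/c) * ?F (c/4) s"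
      proof (cases "s > 0")
        case True
        then show ?thesis using mult_left_mono[OF bnd[of s x] f0[of s]] near(1)[OF x] f0[of s]
          by (simp add: abs_mult mult_ac)
      qed simp
    qed
  qed (use c in auto)
  have "((\<lambda>c. \<integral>s. ?F c s \<partial>lborel) has_real_derivative - (t * \<nu> * c powr (\<nu> - 1) * exp (- t * c powr \<nu>))) (at c)"
  proof -
    have "((\<lambda>c. exp (- t * c powr \<nu>)) has_real_derivative - (t * \<nu> * c powr (\<nu> - 1) * exp (- t * c powr \<nu>))) (at c)"
      using c by (auto intro!: derivative_eq_intros)
    moreover have "eventually (\<lambda>c. (\<integral>s. ?F c s \<partial>lborel) = exp (- t * c powr \<nu>)) (nhds c)"
    proof -
      have "eventually (\<lambda>c. c \<in> {0<..}) (nhds c)" using c by (intro eventually_nhds_in_open) auto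
      then show ?thesis by (rule eventually_mono) (rule val, simp)
    qed
    ultimately show ?thesis by (subst DERIV_cong_ev[OF refl _ refl])
  qed
  from DERIV_unique[OF D this]
  have eq: "(\<integral>s. s * ?F c s \<partial>lborel) = t * \<nu> * c powr (\<nu> - 1) * exp (- t * c powr \<nu>)" by simp
  have "integrable lborel (\<lambda>s. s * ?F c s)"
  proof (rule Bochner_Integration.integrable_bound[OF int[of "c/4", THEN integrable_mult_right, of "4/c"]])
    show "AE s in lborel. norm (s * ?F c s) \<le> norm ((4/c) * ?F (c/4) s)"
    proof (intro AE_I2)
      fix s
      show "norm (s * ?F c s) \<le> norm ((4/c) * ?F (c/4) s)"
        using mult_left_mono[OF bnd[of s c] f0[of s]] c f0[of s]
        by (cases "s > 0") (simp_all add: abs_mult mult_ac)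
    qed
  qed (use c in auto)
  then have "(\<integral>\<^sup>+s. ennreal (s * ?F c s) \<partial>lborel) = ennreal (\<integral>s. s * ?F c s \<partial>lborel)"
    using f0 by (intro nn_integral_eq_integral AE_I2) (auto simp: indicator_def)
  also have "(\<integral>\<^sup>+s. ennreal (s * ?F c s) \<partial>lborel) = (\<integral>\<^sup>+s. ennreal (s * f s * exp (- c * s)) * indicator {0<..} s \<partial>lborel)"
    by (intro nn_integral_cong) (simp add: indicator_def mult_ac)
  finally show ?thesis by (simp only: eq)
qed

text \<open>One double integral in s = exp u and c = exp w is evaluated in both orders: over w first
  it yields Gamma (1 - p) times the moment, over u first the differentiated Laplace transform and
  then Gamma (1 - p/\<nu>). Everything is nonnegative and stays in \<open>ennreal\<close>, so
  finiteness of the moment is part of the result.\<close>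

lemma mellin_of_laplace:
  fixes f :: "real \<Rightarrow> real"
  assumes f[measurable]: "f \<in> borel_measurable borel" and f0: "\<And>s. 0 \<le> f s"
    and L: "\<And>c. c > 0 \<Longrightarrow> (\<integral>\<^sup>+s. ennreal (f s * exp (- c * s)) * indicator {0<..} s \<partial>lborel) = ennreal (exp (- t * c powr \<nu>))"
    and t: "t > 0" and \<nu>: "0 < \<nu>" "\<nu> < 1" and p: "p < \<nu>"
  shows "(\<integral>\<^sup>+u. ennreal (exp u * f (exp u) * exp (p * u)) \<partial>lborel) = ennreal (t powr (p / \<nu>) * (Gamma (1 - p / \<nu>) / Gamma (1 - p)))"
proof -
  let ?X = "\<integral>\<^sup>+u. ennreal (exp u * f (exp u) * exp (p * u)) \<partial>lborel"
  let ?G = "\<lambda>u w. ennreal (exp u * f (exp u) * exp (p * u) * exp ((1 - p) * (w + u) - exp (w + u)))"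
  have G: "(\<integral>\<^sup>+w. ennreal (exp ((1 - p) * (w + u) - exp (w + u))) \<partial>lborel) = ennreal (Gamma (1 - p))" for u
    using nn_integral_real_affine[of "\<lambda>v. ennreal (exp ((1 - p) * v - exp v))" 1 u] p \<nu>
    by (simp add: nn_integral_Gamma_exp add.commute)
  have "?X * ennreal (Gamma (1 - p)) = (\<integral>\<^sup>+u. ennreal (exp u * f (exp u) * exp (p * u)) * ennreal (Gamma (1 - p)) \<partial>lborel)"
    by (rule nn_integral_multc[symmetric]) measurable
  also have "\<dots> = (\<integral>\<^sup>+u. (\<integral>\<^sup>+w. ?G u w \<partial>lborel) \<partial>lborel)"
  proof (intro nn_integral_cong)
    fix u :: real
    have "(\<integral>\<^sup>+w. ?G u w \<partial>lborel) = (\<integral>\<^sup>+w. ennreal (exp u * f (exp u) * exp (p * u)) * ennreal (exp ((1 - p) * (w + u) - exp (w + u))) \<partial>lborel)"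
      using f0 by (intro nn_integral_cong) (simp add: ennreal_mult)
    also have "\<dots> = ennreal (exp u * f (exp u) * exp (p * u)) * (\<integral>\<^sup>+w. ennreal (exp ((1 - p) * (w + u) - exp (w + u))) \<partial>lborel)"
      by (rule nn_integral_cmult) measurable
    finally show "ennreal (exp u * f (exp u) * exp (p * u)) * ennreal (Gamma (1 - p)) = (\<integral>\<^sup>+w. ?G u w \<partial>lborel)"
      by (simp only: G)
  qed
  also have "\<dots> = (\<integral>\<^sup>+w. (\<integral>\<^sup>+u. ?G u w \<partial>lborel) \<partial>lborel)"
    by (rule lborel_pair.Fubini') measurable
  also have "\<dots> = (\<integral>\<^sup>+w. ennreal (exp ((1 - p) * w)) * ennreal (t * \<nu> * exp w powr (\<nu> - 1) * exp (- t * exp w powr \<nu>)) \<partial>lborel)"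
  proof (intro nn_integral_cong)
    fix w :: real
    have "(\<integral>\<^sup>+u. ?G u w \<partial>lborel) = (\<integral>\<^sup>+u. ennreal (exp ((1 - p) * w)) * (ennreal (exp u * f (exp u) * exp (- exp w * exp u)) * ennreal (exp u)) \<partial>lborel)"
    proof (intro nn_integral_cong)
      fix u
      have "exp u * f (exp u) * exp (p * u) * exp ((1 - p) * (w + u) - exp (w + u)) =
        exp ((1 - p) * w) * ((exp u * f (exp u) * exp (- exp w * exp u)) * exp u)"
      proof -
        have "exp (p * u) * exp ((1 - p) * (w + u) - exp (w + u)) = exp (p * u + ((1 - p) * (w + u) - exp (w + u)))"
          by (simp only: exp_add)
        also have "p * u + ((1 - p) * (w + u) - exp (w + u)) = (1 - p) * w + (- exp w * exp u + u)"
          by (simp add: algebra_simps exp_add)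
        also have "exp \<dots> = exp ((1 - p) * w) * (exp (- exp w * exp u) * exp u)" by (simp only: exp_add)
        finally show ?thesis by (simp add: mult_ac)
      qed
      then show "?G u w = ennreal (exp ((1 - p) * w)) * (ennreal (exp u * f (exp u) * exp (- exp w * exp u)) * ennreal (exp u))"
        using f0[of "exp u"] by (simp only: ennreal_mult[symmetric] exp_ge_zero mult_nonneg_nonneg)
    qed
    also have "\<dots> = ennreal (exp ((1 - p) * w)) * (\<integral>\<^sup>+u. ennreal (exp u * f (exp u) * exp (- exp w * exp u)) * ennreal (exp u) \<partial>lborel)"
      by (rule nn_integral_cmult) measurable
    also have "(\<integral>\<^sup>+u. ennreal (exp u * f (exp u) * exp (- exp w * exp u)) * ennreal (exp u) \<partial>lborel) =
        (\<integral>\<^sup>+s. ennreal (s * f s * exp (- exp w * s)) * indicator {0<..} s \<partial>lborel)"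
      by (rule nn_integral_exp_substitution[symmetric]) measurable
    also have "\<dots> = ennreal (t * \<nu> * exp w powr (\<nu> - 1) * exp (- t * exp w powr \<nu>))"
      by (rule laplace_derivative[OF f f0 L]) auto
    finally show "(\<integral>\<^sup>+u. ?G u w \<partial>lborel) = ennreal (exp ((1 - p) * w)) * ennreal (t * \<nu> * exp w powr (\<nu> - 1) * exp (- t * exp w powr \<nu>))" .
  qed
  also have "\<dots> = (\<integral>\<^sup>+w. ennreal (\<nu> * t * exp ((\<nu> - p) * w - t * exp (\<nu> * w))) \<partial>lborel)"
    using t \<nu> by (intro nn_integral_cong) (simp add: powr_def mult_ac flip: ennreal_mult exp_add, simp add: algebra_simps exp_diff exp_minus divide_inverse flip: exp_add)
  \<comment> \<open>The substitution w = (v - ln t)/\<nu> turns t exp (\<nu> w) into exp v and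
    produces the scaling factor t powr (p/\<nu>).\<close>
  also have "\<dots> = ennreal \<bar>1/\<nu>\<bar> * (\<integral>\<^sup>+v. ennreal (\<nu> * t * exp ((\<nu> - p) * (- ln t / \<nu> + 1/\<nu> * v) - t * exp (\<nu> * (- ln t / \<nu> + 1/\<nu> * v)))) \<partial>lborel)"
    using \<nu> by (intro nn_integral_real_affine) auto
  also have "\<dots> = ennreal (1/\<nu>) * (\<integral>\<^sup>+v. ennreal (\<nu> * t powr (p / \<nu>)) * ennreal (exp ((1 - p / \<nu>) * v - exp v)) \<partial>lborel)"
  proof -
    have "\<nu> * t * exp ((\<nu> - p) * (- ln t / \<nu> + 1/\<nu> * v) - t * exp (\<nu> * (- ln t / \<nu> + 1/\<nu> * v))) =
        (\<nu> * t powr (p / \<nu>)) * exp ((1 - p / \<nu>) * v - exp v)" for v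
    proof -
      have 1: "\<nu> * (- ln t / \<nu> + 1/\<nu> * v) = v - ln t" using \<nu> by (simp add: field_simps)
      have 2: "t * exp (v - ln t) = exp v" using t by (simp add: exp_diff)
      have 3: "(\<nu> - p) * (- ln t / \<nu> + 1/\<nu> * v) = - ln t + p / \<nu> * ln t + (1 - p / \<nu>) * v" using \<nu> by (simp add: field_simps)
      show ?thesis unfolding 1 2 3 exp_diff exp_add using t by (simp add: exp_minus powr_def)
    qed
    then have "ennreal (\<nu> * t * exp ((\<nu> - p) * (- ln t / \<nu> + 1/\<nu> * v) - t * exp (\<nu> * (- ln t / \<nu> + 1/\<nu> * v)))) =
        ennreal (\<nu> * t powr (p / \<nu>)) * ennreal (exp ((1 - p / \<nu>) * v - exp v))" for v
      using \<nu> by (simp only: ennreal_mult[symmetric]) (simp add: ennreal_mult)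
    moreover have "\<bar>1 / \<nu>\<bar> = 1 / \<nu>" using \<nu> by simp
    ultimately show ?thesis by (simp only:)
  qed
  also have "\<dots> = ennreal (1/\<nu>) * (ennreal (\<nu> * t powr (p / \<nu>)) * ennreal (Gamma (1 - p / \<nu>)))"
    using p \<nu> by (subst nn_integral_cmult) (auto simp: nn_integral_Gamma_exp)
  also have "\<dots> = ennreal (t powr (p / \<nu>) * Gamma (1 - p / \<nu>))"
    using \<nu> p by (simp add: Gamma_real_pos less_imp_le flip: ennreal_mult)
  finally have *: "?X * ennreal (Gamma (1 - p)) = ennreal (t powr (p / \<nu>) * Gamma (1 - p / \<nu>))" .
  have Gp: "Gamma (1 - p) > 0" using p \<nu> by (intro Gamma_real_pos) auto
  have "?X = ?X * ennreal (Gamma (1 - p)) * ennreal (1 / Gamma (1 - p))"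
    using Gp by (simp add: mult.assoc flip: ennreal_mult)
  also have "\<dots> = ennreal (t powr (p / \<nu>) * (Gamma (1 - p / \<nu>) / Gamma (1 - p)))"
    unfolding * using Gp p \<nu> by (simp add: Gamma_real_pos less_imp_le flip: ennreal_mult)
  finally show ?thesis .
qed

section \<open>Integrals of exponentials along a vertical line\<close>

lemma borel_measurable_Gamma_complex[measurable]: "(Gamma :: complex \<Rightarrow> complex) \<in> borel_measurable borel"
proof -
  have "continuous_on UNIV (rGamma :: complex \<Rightarrow> complex)"
    using holomorphic_rGamma holomorphic_on_imp_continuous_on by blast
  then have [measurable]: "(rGamma :: complex \<Rightarrow> complex) \<in> borel_measurable borel"
    by (rule borel_measurable_continuous_onI)
  have "(\<lambda>z::complex. inverse (rGamma z)) \<in> borel_measurable borel" by measurable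
  then show ?thesis by (simp add: Gamma_def[abs_def])
qed

text \<open>A superposition of exponentials with amplitudes A and rates w. In all uses the rates
  share one real part, which fixes the growth in x; a derivative multiplies the amplitude by the
  rate. The real part is taken inside so that the ordinary real derivative is available.\<close>

definition exp_integral :: "(real \<Rightarrow> complex) \<Rightarrow> (real \<Rightarrow> complex) \<Rightarrow> real \<Rightarrow> real" where
  "exp_integral A w x = (\<integral>y. Re (A y * exp (w y * of_real x)) \<partial>lborel)"

lemma exp_integral_integrable:
  assumes A: "integrable lborel A" and w[measurable]: "w \<in> borel_measurable borel" and c: "\<And>y. Re (w y) = c"
  shows "integrable lborel (\<lambda>y. A y * exp (w y * of_real x))"
proof -
  have [measurable]: "A \<in> borel_measurable borel" using A by auto
  show ?thesis
    by (rule Bochner_Integration.integrable_bound[OF integrable_mult_left[OF integrable_norm[OF A], of "exp (c * x)"]])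
       (measurable, simp add: norm_mult c)
qed

lemma exp_integral_bound:
  assumes A: "integrable lborel A" and w: "w \<in> borel_measurable borel" and c: "\<And>y. Re (w y) = c"
  shows "\<bar>exp_integral A w x\<bar> \<le> (\<integral>y. cmod (A y) \<partial>lborel) * exp (c * x)"
proof -
  have "\<bar>exp_integral A w x\<bar> \<le> (\<integral>y. cmod (A y) * exp (c * x) \<partial>lborel)"
    unfolding exp_integral_def real_norm_def[symmetric]
  proof (rule Bochner_Integration.integral_norm_bound_integral)
    show "norm (Re (A y * exp (w y * of_real x))) \<le> cmod (A y) * exp (c * x)" for y
      using abs_Re_le_cmod[of "A y * exp (w y * of_real x)"] by (simp only: real_norm_def norm_mult norm_exp_eq_Re) (simp add: c)
  qed (use A in \<open>auto intro!: integrable_mult_left integrable_norm integrable_Re exp_integral_integrable[OF A w c] simp del: times_complex.sel\<close>)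
  also have "\<dots> = (\<integral>y. cmod (A y) \<partial>lborel) * exp (c * x)" by simp
  finally show ?thesis .
qed

lemma exp_integral_has_derivative:
  assumes A: "integrable lborel A" and Aw: "integrable lborel (\<lambda>y. A y * w y)"
    and w[measurable]: "w \<in> borel_measurable borel" and c: "\<And>y. Re (w y) = c"
  shows "(exp_integral A w has_real_derivative exp_integral (\<lambda>y. A y * w y) w x) (at x)"
  unfolding exp_integral_def[abs_def]
proof (rule has_field_derivative_lebesgue_integral[where r = 1 and F' = "\<lambda>x y. Re (A y * w y * exp (w y * of_real x))"
    and g = "\<lambda>y. cmod (A y * w y) * exp (\<bar>c\<bar> * (\<bar>x\<bar> + 1))"])
  have [measurable]: "A \<in> borel_measurable borel" using A by auto
  show "integrable lborel (\<lambda>y. Re (A y * exp (w y * of_real x)))" for x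
    by (intro integrable_Re exp_integral_integrable[OF A w c])
  show "integrable lborel (\<lambda>y. cmod (A y * w y) * exp (\<bar>c\<bar> * (\<bar>x\<bar> + 1)))"
    using Aw by (intro integrable_mult_left integrable_norm)
  show "(\<lambda>y. Re (A y * w y * exp (w y * of_real x))) \<in> borel_measurable lborel" by measurable
  show "AE y in lborel. \<forall>x\<in>ball x 1. ((\<lambda>x. Re (A y * exp (w y * of_real x))) has_real_derivative Re (A y * w y * exp (w y * of_real x))) (at x)"
  proof (intro AE_I2 ballI)
    fix y x
    have "((\<lambda>z. A y * exp (w y * z)) has_field_derivative A y * w y * exp (w y * of_real x)) (at (of_real x))"
      by (auto intro!: derivative_eq_intros simp: mult_ac)
    from bounded_linear.has_vector_derivative[OF bounded_linear_Re has_vector_derivative_real_field[OF this]]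
    show "((\<lambda>x. Re (A y * exp (w y * of_real x))) has_real_derivative Re (A y * w y * exp (w y * of_real x))) (at x)"
      by (simp only: has_real_derivative_iff_has_vector_derivative)
  qed
  show "AE y in lborel. \<forall>z\<in>ball x 1. norm (Re (A y * w y * exp (w y * of_real z))) \<le> cmod (A y * w y) * exp (\<bar>c\<bar> * (\<bar>x\<bar> + 1))"
  proof (intro AE_I2 ballI)
    fix y z assume z: "z \<in> ball x 1"
    have "c * z \<le> \<bar>c\<bar> * \<bar>z\<bar>" by (metis abs_ge_self abs_mult)
    also have "\<dots> \<le> \<bar>c\<bar> * (\<bar>x\<bar> + 1)" using z by (intro mult_left_mono) (auto simp: dist_real_def)
    finally have "exp (c * z) \<le> exp (\<bar>c\<bar> * (\<bar>x\<bar> + 1))" by simp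
    then have "cmod (A y * w y) * exp (c * z) \<le> cmod (A y * w y) * exp (\<bar>c\<bar> * (\<bar>x\<bar> + 1))"
      by (intro mult_left_mono) auto
    moreover have "norm (Re (A y * w y * exp (w y * of_real z))) \<le> cmod (A y * w y * exp (w y * of_real z))"
      unfolding real_norm_def by (rule abs_Re_le_cmod)
    moreover have "cmod (A y * w y * exp (w y * of_real z)) = cmod (A y * w y) * exp (c * z)"
      by (simp only: norm_mult norm_exp_eq_Re) (simp add: c)
    ultimately show "norm (Re (A y * w y * exp (w y * of_real z))) \<le> cmod (A y * w y) * exp (\<bar>c\<bar> * (\<bar>x\<bar> + 1))"
      by linarith
  qed
qed simp

text \<open>The stable density is \<open>h s t = stable_profile \<nu> (ln t / \<nu> - ln s) / s\<close>: its Mellin transform is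
  inverted along \<open>Re z = \<nu> / 2\<close>, where the quotient of Gamma functions decays exponentially. Working to the right of the
  imaginary axis makes the profile decay at \<open>-\<infinity>\<close>, i.e. as \<open>s \<longrightarrow> \<infinity>\<close>.\<close>

definition stable_ratio :: "real \<Rightarrow> complex \<Rightarrow> complex" where
  "stable_ratio \<nu> z = Gamma (1 - z / of_real \<nu>) / Gamma (1 - z)"

definition stable_profile :: "real \<Rightarrow> real \<Rightarrow> real" where
  "stable_profile \<nu> x = exp_integral (\<lambda>y. stable_ratio \<nu> (Complex (\<nu>/2) y)) (Complex (\<nu>/2)) x / (2 * pi)"

lemma borel_measurable_stable_ratio[measurable]: "stable_ratio \<nu> \<in> borel_measurable borel"
  unfolding stable_ratio_def[abs_def] by measurable

text \<open>Decay faster than every power absorbs the factor z^n that n derivatives of the profile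
  bring down.\<close>

lemma stable_ratio_integrable:
  assumes \<nu>: "0 < \<nu>" "\<nu> < 1"
  shows "integrable lborel (\<lambda>y. stable_ratio \<nu> (Complex (\<nu>/2) y) * Complex (\<nu>/2) y ^ n)"
proof -
  obtain C where C: "\<And>y. (1 + \<bar>y\<bar>) ^ (n + 2) * cmod (stable_ratio \<nu> (Complex (\<nu>/2) y)) \<le> C"
    using Gamma_ratio_vertical_decay[OF \<nu>, of "n + 2"] unfolding stable_ratio_def by blast
  show ?thesis
  proof (rule integrable_poly_decay)
    show "(\<lambda>y. stable_ratio \<nu> (Complex (\<nu>/2) y) * Complex (\<nu>/2) y ^ n) \<in> borel_measurable borel" by measurable
    fix y
    have "cmod (Complex (\<nu>/2) y) \<le> 1 + \<bar>y\<bar>"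
      using cmod_le[of "Complex (\<nu>/2) y"] \<nu> by simp
    then have "cmod (Complex (\<nu>/2) y) ^ n \<le> (1 + \<bar>y\<bar>) ^ n" by (intro power_mono) auto
    then have "(1 + \<bar>y\<bar>) ^ 2 * (cmod (stable_ratio \<nu> (Complex (\<nu>/2) y)) * cmod (Complex (\<nu>/2) y) ^ n)
        \<le> (1 + \<bar>y\<bar>) ^ 2 * (cmod (stable_ratio \<nu> (Complex (\<nu>/2) y)) * (1 + \<bar>y\<bar>) ^ n)"
      by (intro mult_left_mono) auto
    also have "\<dots> \<le> C" using C[of y] by (simp add: power_add power2_eq_square mult_ac)
    finally show "(1 + \<bar>y\<bar>) ^ 2 * cmod (stable_ratio \<nu> (Complex (\<nu>/2) y) * Complex (\<nu>/2) y ^ n) \<le> C"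
      by (simp add: norm_mult norm_power)
  qed
qed

lemma stable_mellin:
  fixes f :: "real \<Rightarrow> real"
  assumes f[measurable]: "f \<in> borel_measurable borel" and f0: "\<And>s. 0 \<le> f s"
    and L: "\<And>c. c > 0 \<Longrightarrow> (\<integral>\<^sup>+s. ennreal (f s * exp (- c * s)) * indicator {0<..} s \<partial>lborel) = ennreal (exp (- t * c powr \<nu>))"
    and t: "t > 0" and \<nu>: "0 < \<nu>" "\<nu> < 1" and z: "Re z < \<nu>"
  shows "integrable lborel (\<lambda>u. complex_of_real (exp u * f (exp u)) * exp (z * complex_of_real u))"
    and "mellin (\<lambda>s. s * f s) z = stable_ratio \<nu> z * exp (z * of_real (ln t / \<nu>))"
proof -
  let ?m = "\<lambda>z::complex. Gamma (1 - z / of_real \<nu>) * rGamma (1 - z) * exp (z * of_real (ln t / \<nu>))"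
  have "1 - w / of_real \<nu> \<notin> \<int>\<^sub>\<le>\<^sub>0" if "Re w < \<nu>" for w
  proof
    assume "1 - w / of_real \<nu> \<in> \<int>\<^sub>\<le>\<^sub>0"
    then obtain n where n: "1 - w / of_real \<nu> = of_int n" "n \<le> 0" by (auto elim!: nonpos_Ints_cases)
    from arg_cong[OF n(1), of Re] have "1 - Re w / \<nu> \<le> 0" using n(2) by simp
    then show False using that \<nu> by (simp add: field_simps)
  qed
  \<comment> \<open>The Mellin lemmas work in a strip with two edges; the left edge Re z - 1 is
    merely some point to the left of z.\<close>
  then have hol: "?m holomorphic_on {w. Re z - 1 < Re w \<and> Re w < \<nu>}"
    using \<nu> by (intro holomorphic_intros) auto
  have M: "(\<integral>\<^sup>+u. ennreal (exp u * f (exp u) * exp (p * u)) \<partial>lborel) = ennreal (t powr (p / \<nu>) * (Gamma (1 - p / \<nu>) / Gamma (1 - p)))" if "p < \<nu>" for p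
    by (rule mellin_of_laplace[OF f f0 L t \<nu> that])
  have M0: "0 \<le> t powr (p / \<nu>) * (Gamma (1 - p / \<nu>) / Gamma (1 - p))" if "p < \<nu>" for p
    using that \<nu> by (auto intro!: mult_nonneg_nonneg divide_nonneg_nonneg less_imp_le[OF Gamma_real_pos] simp: field_simps)
  have mM: "?m (of_real p) = of_real (t powr (p / \<nu>) * (Gamma (1 - p / \<nu>) / Gamma (1 - p)))" for p
  proof -
    have "exp (complex_of_real p * of_real (ln t / \<nu>)) = of_real (t powr (p / \<nu>))"
      using t by (simp add: powr_def flip: exp_of_real)
    then show ?thesis
      using Gamma_complex_of_real[of "1 - p / \<nu>"] rGamma_complex_of_real[of "1 - p"]
      by (simp add: Gamma_def divide_inverse)
  qed
  show "integrable lborel (\<lambda>u. complex_of_real (exp u * f (exp u)) * exp (z * complex_of_real u))"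
    by (rule mellin_integrable_of_real[where f = "\<lambda>s. s * f s", OF _ _ _ _ hol M M0 mM]) (use z f0 in auto)
  have "mellin (\<lambda>s. s * f s) z = ?m z"
    by (rule mellin_eq_of_real[where f = "\<lambda>s. s * f s", OF _ _ _ _ hol M M0 mM]) (use z f0 in auto)
  then show "mellin (\<lambda>s. s * f s) z = stable_ratio \<nu> z * exp (z * of_real (ln t / \<nu>))"
    by (simp add: stable_ratio_def Gamma_def divide_inverse)
qed

text \<open>This holds for every u, since continuity of f makes the inversion formula pointwise. The
  dependence on ln t/\<nu> - u alone is the self-similarity of the stable process: one profile
  describes all times.\<close>

lemma stable_density_eq_profile:
  fixes f :: "real \<Rightarrow> real"
  assumes f[measurable]: "f \<in> borel_measurable borel" and f0: "\<And>s. 0 \<le> f s"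
    and cont: "continuous_on {0<..} f"
    and L: "\<And>c. c > 0 \<Longrightarrow> (\<integral>\<^sup>+s. ennreal (f s * exp (- c * s)) * indicator {0<..} s \<partial>lborel) = ennreal (exp (- t * c powr \<nu>))"
    and t: "t > 0" and \<nu>: "0 < \<nu>" "\<nu> < 1"
  shows "exp u * f (exp u) = stable_profile \<nu> (ln t / \<nu> - u)"
proof -
  let ?z = "Complex (\<nu>/2)"
  have z: "Re (?z y) < \<nu>" for y using \<nu> by simp
  have m1: "integrable lborel (\<lambda>u. complex_of_real (exp u * f (exp u)) * exp (z * complex_of_real u))"
    and m2: "mellin (\<lambda>s. s * f s) z = stable_ratio \<nu> z * exp (z * of_real (ln t / \<nu>))" if "Re z < \<nu>" for z
    by (rule stable_mellin[OF f f0 L t \<nu> that]; assumption)+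
  have K: "integrable lborel (\<lambda>y. stable_ratio \<nu> (?z y))"
    using stable_ratio_integrable[OF \<nu>, of 0] by simp
  have "complex_of_real (exp u * f (exp u)) = 1 / (2 * pi) * (\<integral>y. mellin (\<lambda>s. s * f s) (?z y) * exp (- ?z y * of_real u) \<partial>lborel)"
  proof (rule mellin_inversion)
    show "continuous_on {0<..} (\<lambda>s. s * f s)" by (intro continuous_intros cont)
    show "integrable lborel (\<lambda>u. exp u * f (exp u) * exp (\<nu> / 2 * u))"
    proof -
      have "integrable lborel (\<lambda>u. Re (complex_of_real (exp u * f (exp u)) * exp (of_real (\<nu>/2) * complex_of_real u)))"
        by (intro integrable_Re m1) (use \<nu> in simp)
      then show ?thesis by (simp only: of_real_mult[symmetric] exp_of_real Re_complex_of_real)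
    qed
    show "integrable lborel (\<lambda>y. mellin (\<lambda>s. s * f s) (?z y))"
      unfolding m2[OF z] by (rule exp_integral_integrable[OF K, of _ "\<nu>/2"]) auto
  qed (use f0 in auto)
  also have "(\<integral>y. mellin (\<lambda>s. s * f s) (?z y) * exp (- ?z y * of_real u) \<partial>lborel) =
      (\<integral>y. stable_ratio \<nu> (?z y) * exp (?z y * of_real (ln t / \<nu> - u)) \<partial>lborel)" (is "_ = ?I")
    unfolding m2[OF z]
    by (intro Bochner_Integration.integral_cong refl) (simp add: algebra_simps flip: exp_add)
  finally have "exp u * f (exp u) = Re (complex_of_real (1 / (2 * pi)) * ?I)"
    by (metis Re_complex_of_real)
  also have "\<dots> = 1 / (2 * pi) * Re ?I"
    by (simp only: Re_complex_of_real Im_complex_of_real times_complex.sel mult_zero_left diff_zero)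
  also have "Re ?I = (\<integral>y. Re (stable_ratio \<nu> (?z y) * exp (?z y * of_real (ln t / \<nu> - u))) \<partial>lborel)"
    by (rule integral_Re[symmetric], rule exp_integral_integrable[OF K, of _ "\<nu>/2"]) auto
  finally show ?thesis by (simp add: stable_profile_def exp_integral_def)
qed

lemma stable_profile_derivative:
  assumes \<nu>: "0 < \<nu>" "\<nu> < 1"
  obtains W' C where
    "\<And>x. (stable_profile \<nu> has_real_derivative W' x) (at x)" "continuous_on UNIV W'"
    "\<And>x. \<bar>stable_profile \<nu> x\<bar> \<le> C * exp (\<nu>/2 * x)" "\<And>x. \<bar>W' x\<bar> \<le> C * exp (\<nu>/2 * x)"
proof -
  let ?z = "Complex (\<nu>/2)"
  let ?A = "\<lambda>n y. stable_ratio \<nu> (?z y) * ?z y ^ n"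
  let ?E = "\<lambda>n. exp_integral (?A n) ?z"
  have int: "integrable lborel (?A n)" for n by (rule stable_ratio_integrable[OF \<nu>])
  have E: "(?E n has_real_derivative ?E (Suc n) x) (at x)" for n x
    using exp_integral_has_derivative[of "?A n" ?z "\<nu>/2" x] int[of n] int[of "Suc n"] by (simp add: mult_ac)
  have B: "\<bar>?E n x\<bar> \<le> (\<integral>y. cmod (?A n y) \<partial>lborel) * exp (\<nu>/2 * x)" for n x
    by (rule exp_integral_bound[OF int]) simp_all
  let ?C = "\<lambda>n. \<integral>y. cmod (?A n y) \<partial>lborel"
  have B': "\<bar>?E n x / (2 * pi)\<bar> \<le> max (?C 0) (?C 1) * exp (\<nu>/2 * x)" if "n = 0 \<or> n = 1" for n x
  proof -
    have "\<bar>?E n x / (2 * pi)\<bar> \<le> \<bar>?E n x\<bar> / 1"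
      unfolding abs_divide using pi_ge_two by (intro frac_le) auto
    also have "\<dots> \<le> ?C n * exp (\<nu>/2 * x)" using B[of n x] by simp
    also have "\<dots> \<le> max (?C 0) (?C 1) * exp (\<nu>/2 * x)" using that by (intro mult_right_mono) auto
    finally show ?thesis .
  qed
  have W: "stable_profile \<nu> = (\<lambda>x. ?E 0 x / (2 * pi))" by (simp add: stable_profile_def[abs_def])
  show ?thesis
  proof
    show "(stable_profile \<nu> has_real_derivative ?E 1 x / (2 * pi)) (at x)" for x
      unfolding W using E[of 0 x] by (intro DERIV_cdivide) simp
    show "continuous_on UNIV (\<lambda>x. ?E 1 x / (2 * pi))"
      by (intro continuous_at_imp_continuous_on ballI DERIV_isCont[OF DERIV_cdivide[OF E]])
    show "\<bar>stable_profile \<nu> x\<bar> \<le> max (?C 0) (?C 1) * exp (\<nu>/2 * x)" for x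
      unfolding W using B'[of 0 x] by simp
    show "\<bar>?E 1 x / (2 * pi)\<bar> \<le> max (?C 0) (?C 1) * exp (\<nu>/2 * x)" for x
      using B'[of 1 x] by simp
  qed
qed

text \<open>By self-similarity, with u = ln s, the derivative of \<open>h s x\<close> in x is up to
  the factor -1/(\<nu> x) a derivative in u of the profile at ln x/\<nu> - u. The integral over s >
  t is therefore a boundary value at u = ln t.\<close>

lemma inverse_density_eq_profile:
  assumes \<nu>: "0 < \<nu>" "\<nu> < 1"
    and h: "\<And>s y. s > 0 \<Longrightarrow> y > 0 \<Longrightarrow> h s y = stable_profile \<nu> (ln y / \<nu> - ln s) / s"
    and x: "x > 0" and t: "t > 0"
  shows "inverse_density h x t = stable_profile \<nu> (ln x / \<nu> - ln t) / (\<nu> * x)"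
proof -
  obtain W' C where
    D: "\<And>x. (stable_profile \<nu> has_real_derivative W' x) (at x)" and cont: "continuous_on UNIV W'"
    and B: "\<And>x. \<bar>stable_profile \<nu> x\<bar> \<le> C * exp (\<nu>/2 * x)" and B': "\<And>x. \<bar>W' x\<bar> \<le> C * exp (\<nu>/2 * x)"
    using stable_profile_derivative[OF \<nu>] by blast
  have [measurable]: "W' \<in> borel_measurable borel" by (rule borel_measurable_continuous_onI[OF cont])
  define c where "c = ln x / \<nu>"
  have dh: "deriv (\<lambda>y. h s y) x = W' (c - ln s) / (\<nu> * x) / s" if "s > 0" for s
  proof (rule DERIV_imp_deriv)
    have "((\<lambda>y. stable_profile \<nu> (ln y / \<nu> - ln s) / s) has_real_derivative W' (c - ln s) * (inverse x / \<nu>) / s) (at x)"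
      unfolding c_def using x \<nu> that by (auto intro!: derivative_eq_intros DERIV_chain2[OF D] simp: divide_inverse mult_ac)
    moreover have "eventually (\<lambda>y. h s y = stable_profile \<nu> (ln y / \<nu> - ln s) / s) (nhds x)"
    proof -
      have "eventually (\<lambda>y. y \<in> {0<..}) (nhds x)" using x by (intro eventually_nhds_in_open) auto
      then show ?thesis by (rule eventually_mono) (rule h, use that in auto)
    qed
    ultimately have "((\<lambda>y. h s y) has_real_derivative W' (c - ln s) * (inverse x / \<nu>) / s) (at x)"
      by (subst DERIV_cong_ev[OF refl _ refl])
    then show "((\<lambda>y. h s y) has_real_derivative W' (c - ln s) / (\<nu> * x) / s) (at x)"
      by (simp add: divide_inverse mult_ac)
  qed
  let ?g = "\<lambda>u. W' (c - u) / (\<nu> * x)"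
  have "inverse_density h x t = (LBINT s:{t<..}. W' (c - ln s) / (\<nu> * x) / s)"
    unfolding inverse_density_def by (rule set_lebesgue_integral_cong) (use t dh in auto)
  also have "\<dots> = (LBINT s:{0<..}. indicator {t<..} s * (W' (c - ln s) / (\<nu> * x) / s))"
    unfolding set_lebesgue_integral_def using t
    by (intro Bochner_Integration.integral_cong refl) (auto simp: indicator_def)
  also have "\<dots> = (\<integral>u. exp u *\<^sub>R (indicator {t<..} (exp u) * (W' (c - ln (exp u)) / (\<nu> * x) / exp u)) \<partial>lborel)"
    by (rule set_integral_exp_substitution) measurable
  also have "\<dots> = (LBINT u:{ln t<..}. ?g u)"
    unfolding set_lebesgue_integral_def
  proof (intro Bochner_Integration.integral_cong refl)
    fix u :: real
    have "t < exp u \<longleftrightarrow> ln t < u" using t by (metis exp_less_cancel_iff exp_ln)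
    then show "exp u *\<^sub>R (indicator {t<..} (exp u) * (W' (c - ln (exp u)) / (\<nu> * x) / exp u)) = indicator {ln t<..} u *\<^sub>R ?g u"
      by (simp add: indicator_def)
  qed
  also have "\<dots> = (LBINT u=ereal (ln t)..\<infinity>. ?g u)"
    by (simp add: interval_lebesgue_integral_def einterval_def greaterThan_def)
  \<comment> \<open>The boundary value at infinity vanishes by the bound exp (\<nu>/2 * x) on the
    profile; the same bound on its derivative makes the integrand absolutely integrable.\<close>
  also have "\<dots> = 0 - (- (stable_profile \<nu> (c - ln t) / (\<nu> * x)))"
  proof (rule interval_integral_FTC_integrable[where F = "\<lambda>u. - (stable_profile \<nu> (c - u) / (\<nu> * x))"])
    have DF: "((\<lambda>u. - (stable_profile \<nu> (c - u) / (\<nu> * x))) has_real_derivative ?g u) (at u)" for u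
      using x \<nu> by (auto intro!: derivative_eq_intros DERIV_chain2[OF D])
    then show "((\<lambda>u. - (stable_profile \<nu> (c - u) / (\<nu> * x))) has_vector_derivative ?g u) (at u)" for u
      by (simp add: has_real_derivative_iff_has_vector_derivative)
    show "isCont ?g u" for u
    proof -
      have "isCont W' v" for v using cont by (simp add: continuous_on_eq_continuous_at)
      then have "isCont (\<lambda>u. W' (c - u)) u"
        by (intro isCont_o2[where g = W' and f = "\<lambda>u. c - u"] continuous_intros)
      moreover have "\<nu> * x \<noteq> 0" using x \<nu> by simp
      ultimately show ?thesis by (intro continuous_divide continuous_const)
    qed
    show "(((\<lambda>u. - (stable_profile \<nu> (c - u) / (\<nu> * x))) \<circ> real_of_ereal) \<longlongrightarrow> - (stable_profile \<nu> (c - ln t) / (\<nu> * x))) (at_right (ereal (ln t)))"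
      unfolding ereal_tendsto_simps using DERIV_isCont[OF DF, of "ln t"]
      by (auto simp: isCont_def intro: tendsto_within_subset filterlim_at_split[THEN iffD1, THEN conjunct2])
    have lim: "((\<lambda>u. C * exp (\<nu>/2 * (c - u)) / (\<nu> * x)) \<longlongrightarrow> 0) at_top"
    proof -
      have "((\<lambda>u. exp (\<nu>/2 * (c - u))) \<longlongrightarrow> 0) at_top" using \<nu> by real_asymp
      from tendsto_divide[OF tendsto_mult[OF tendsto_const this] tendsto_const, of "\<nu> * x" C] \<nu> x
      show ?thesis by simp
    qed
    have "((\<lambda>u. - (stable_profile \<nu> (c - u) / (\<nu> * x))) \<longlongrightarrow> 0) at_top"
    proof (rule Lim_null_comparison[OF _ lim], intro always_eventually allI)
      fix u
      show "norm (- (stable_profile \<nu> (c - u) / (\<nu> * x))) \<le> C * exp (\<nu>/2 * (c - u)) / (\<nu> * x)"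
        using divide_right_mono[OF B[of "c - u"], of "\<nu> * x"] x \<nu> by (simp add: abs_mult)
    qed
    then show "(((\<lambda>u. - (stable_profile \<nu> (c - u) / (\<nu> * x))) \<circ> real_of_ereal) \<longlongrightarrow> 0) (at_left \<infinity>)"
      unfolding ereal_tendsto_simps .
    have "integrable lborel (\<lambda>u. indicator {0<..} (- ln t + 1 * u) * exp (- ((- ln t + 1 * u) * (\<nu>/2))))"
      using integrable_I0i_exp_mscale[of "\<nu>/2"] \<nu>
      by (intro lborel_integrable_real_affine) (simp_all add: set_integrable_def)
    then have dom: "integrable lborel (\<lambda>u. C / (\<nu> * x) * exp (\<nu>/2 * (c - ln t)) * (indicator {0<..} (- ln t + 1 * u) * exp (- ((- ln t + 1 * u) * (\<nu>/2)))))"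
      by (rule integrable_mult_right)
    have "integrable lborel (\<lambda>u. indicator {ln t<..} u *\<^sub>R ?g u)"
    proof (rule Bochner_Integration.integrable_bound[OF dom])
      show "AE u in lborel. norm (indicator {ln t<..} u *\<^sub>R ?g u) \<le> norm (C / (\<nu> * x) * exp (\<nu>/2 * (c - ln t)) * (indicator {0<..} (- ln t + 1 * u) * exp (- ((- ln t + 1 * u) * (\<nu>/2)))))"
      proof (intro AE_I2)
        fix u
        have "exp (\<nu>/2 * (c - u)) = exp (\<nu>/2 * (c - ln t)) * exp (- ((- ln t + 1 * u) * (\<nu>/2)))"
          by (simp add: algebra_simps add_divide_distrib diff_divide_distrib flip: exp_add)
        then have "norm (?g u) \<le> C / (\<nu> * x) * exp (\<nu>/2 * (c - ln t)) * exp (- ((- ln t + 1 * u) * (\<nu>/2)))"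
          using divide_right_mono[OF B'[of "c - u"], of "\<nu> * x"] x \<nu> by (simp add: abs_mult mult_ac)
        then have "norm (indicator {ln t<..} u *\<^sub>R ?g u) \<le> C / (\<nu> * x) * exp (\<nu>/2 * (c - ln t)) * (indicator {0<..} (- ln t + 1 * u) * exp (- ((- ln t + 1 * u) * (\<nu>/2))))"
          by (cases "ln t < u") (simp_all add: indicator_def)
        then show "norm (indicator {ln t<..} u *\<^sub>R ?g u) \<le> norm (C / (\<nu> * x) * exp (\<nu>/2 * (c - ln t)) * (indicator {0<..} (- ln t + 1 * u) * exp (- ((- ln t + 1 * u) * (\<nu>/2)))))"
          unfolding real_norm_def[of "C / _ * _ * _"] by (rule order_trans[OF _ abs_ge_self])
      qed
    qed measurable
    then show "set_integrable lborel (einterval (ereal (ln t)) \<infinity>) ?g"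
      by (simp add: set_integrable_def einterval_def greaterThan_def)
  qed simp
  finally show ?thesis by (simp add: c_def)
qed

section \<open>Mixtures of the Gamma kernel\<close>

text \<open>Here \<open>stable_profile \<nu> (ln s / \<nu> - ln t) / \<nu>\<close> is \<open>s * inverse_density h s t\<close>.\<close>

lemma stable_profile_mellin:
  fixes f :: "real \<Rightarrow> real"
  assumes f[measurable]: "f \<in> borel_measurable borel" and f0: "\<And>s. 0 \<le> f s"
    and cont: "continuous_on {0<..} f"
    and L: "\<And>c. c > 0 \<Longrightarrow> (\<integral>\<^sup>+s. ennreal (f s * exp (- c * s)) * indicator {0<..} s \<partial>lborel) = ennreal (exp (- (c powr \<nu>)))"
    and \<nu>: "0 < \<nu>" "\<nu> < 1" and t: "t > 0" and p: "p > -1"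
  shows "(\<integral>\<^sup>+u. ennreal (stable_profile \<nu> (u / \<nu> - ln t) / \<nu> * exp (p * u)) \<partial>lborel)
    = ennreal (t powr (\<nu> * p) * (Gamma (1 + p) / Gamma (1 + \<nu> * p)))"
proof -
  have L': "(\<integral>\<^sup>+s. ennreal (f s * exp (- c * s)) * indicator {0<..} s \<partial>lborel) = ennreal (exp (- 1 * c powr \<nu>))" if "c > 0" for c
    using L[OF that] by simp
  have W: "exp (- v) * f (exp (- v)) = stable_profile \<nu> v" for v
    using stable_density_eq_profile[OF f f0 cont L' _ \<nu>, of "- v"] by simp
  have W0: "0 \<le> stable_profile \<nu> v" for v unfolding W[symmetric] using f0 by simp
  have [measurable]: "stable_profile \<nu> \<in> borel_measurable borel"
    unfolding W[symmetric, abs_def] by measurable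
  let ?t = "t powr (\<nu> * p)"
  \<comment> \<open>The substitution u = \<nu> ln t - \<nu> v turns the moment of order p into t
    powr (\<nu> p) times the moment of order -\<nu> p of the stable law at time 1. The condition p >
    -1 becomes -\<nu> p < \<nu>.\<close>
  have "(\<integral>\<^sup>+u. ennreal (stable_profile \<nu> (u / \<nu> - ln t) / \<nu> * exp (p * u)) \<partial>lborel) =
      ennreal \<bar>- \<nu>\<bar> * (\<integral>\<^sup>+v. ennreal (stable_profile \<nu> ((\<nu> * ln t + - \<nu> * v) / \<nu> - ln t) / \<nu> * exp (p * (\<nu> * ln t + - \<nu> * v))) \<partial>lborel)"
    by (rule nn_integral_real_affine) (use \<nu> in auto)
  also have "\<dots> = ennreal \<nu> * (\<integral>\<^sup>+v. ennreal (?t / \<nu>) * ennreal (exp v * f (exp v) * exp ((- \<nu> * p) * v)) \<partial>lborel)"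
  proof -
    have "stable_profile \<nu> ((\<nu> * ln t + - \<nu> * v) / \<nu> - ln t) / \<nu> * exp (p * (\<nu> * ln t + - \<nu> * v)) =
        (?t / \<nu>) * (exp v * f (exp v) * exp ((- \<nu> * p) * v))" for v
    proof -
      have 1: "(\<nu> * ln t + - \<nu> * v) / \<nu> - ln t = - v" using \<nu> by (simp add: field_simps)
      have 2: "p * (\<nu> * ln t + - \<nu> * v) = \<nu> * p * ln t + (- \<nu> * p) * v" by (simp add: algebra_simps)
      show ?thesis unfolding 1 2 exp_add W[of "- v", symmetric] using t by (simp add: powr_def)
    qed
    note eq = this
    have "ennreal (stable_profile \<nu> ((\<nu> * ln t + - \<nu> * v) / \<nu> - ln t) / \<nu> * exp (p * (\<nu> * ln t + - \<nu> * v))) =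
        ennreal (?t / \<nu>) * ennreal (exp v * f (exp v) * exp ((- \<nu> * p) * v))" for v
      unfolding eq using \<nu> f0 by (intro ennreal_mult) auto
    then show ?thesis using \<nu> by (simp only: abs_minus_cancel abs_of_pos)
  qed
  also have "\<dots> = ennreal \<nu> * (ennreal (?t / \<nu>) * (\<integral>\<^sup>+v. ennreal (exp v * f (exp v) * exp ((- \<nu> * p) * v)) \<partial>lborel))"
    by (subst nn_integral_cmult) auto
  also have "(\<integral>\<^sup>+v. ennreal (exp v * f (exp v) * exp ((- \<nu> * p) * v)) \<partial>lborel) =
      ennreal (1 powr ((- \<nu> * p) / \<nu>) * (Gamma (1 - (- \<nu> * p) / \<nu>) / Gamma (1 - (- \<nu> * p))))"
  proof (rule mellin_of_laplace[OF f f0 L' _ \<nu>])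
    have "\<nu> * (-1) < \<nu> * p" using \<nu> p by (intro mult_strict_left_mono) auto
    then show "- \<nu> * p < \<nu>" by simp
  qed auto
  also have "ennreal \<nu> * (ennreal (?t / \<nu>) * ennreal (1 powr ((- \<nu> * p) / \<nu>) * (Gamma (1 - (- \<nu> * p) / \<nu>) / Gamma (1 - (- \<nu> * p))))) =
      ennreal (?t * (Gamma (1 + p) / Gamma (1 + \<nu> * p)))"
  proof -
    have "0 < 1 + p" using p by simp
    moreover have "0 < 1 + \<nu> * p"
    proof -
      have "\<nu> * (-1) < \<nu> * p" using \<nu> p by (intro mult_strict_left_mono) auto
      then show ?thesis using \<nu> by simp
    qed
    ultimately have "0 \<le> Gamma (1 + p) / Gamma (1 + \<nu> * p)" by (intro divide_nonneg_nonneg less_imp_le[OF Gamma_real_pos])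
    then have "ennreal \<nu> * (ennreal (?t / \<nu>) * ennreal (Gamma (1 + p) / Gamma (1 + \<nu> * p))) =
        ennreal (\<nu> * (?t / \<nu> * (Gamma (1 + p) / Gamma (1 + \<nu> * p))))"
      using \<nu> by (simp only: ennreal_mult[symmetric] less_imp_le divide_nonneg_pos powr_ge_zero mult_nonneg_nonneg)
    then show ?thesis using \<nu> by simp
  qed
  finally show ?thesis .
qed

text \<open>For Re z > -1 this is the z-th moment of the inverse process at time t. At \<nu> = 1 it
  reduces to the complex power t^z, the moment of the point mass at t, so one formula covers the
  degenerate case as well.\<close>

definition inverse_stable_mellin :: "real \<Rightarrow> real \<Rightarrow> complex \<Rightarrow> complex" where
  "inverse_stable_mellin \<nu> t z = exp (z * of_real (\<nu> * ln t)) * Gamma (1 + z) / Gamma (1 + of_real \<nu> * z)"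

text \<open>The real moments determine the transform. The left edge a is a parameter because two
  functions will be inserted: the stable profile with a = -1 and the iterated Bessel kernel with a =
  0.\<close>

lemma
  fixes F :: "real \<Rightarrow> real"
  assumes F[measurable]: "F \<in> borel_measurable borel" and F0: "\<And>s. s > 0 \<Longrightarrow> 0 \<le> F s"
    and ab: "- 1 \<le> a" "a < Re z" and \<nu>: "0 < \<nu>" "\<nu> < 1" and t: "t > 0"
    and M: "\<And>p. a < p \<Longrightarrow> (\<integral>\<^sup>+u. ennreal (F (exp u) * exp (p * u)) \<partial>lborel)
      = ennreal (t powr (\<nu> * p) * (Gamma (1 + p) / Gamma (1 + \<nu> * p)))"
  shows mellin_inverse_stable_integrable:
      "integrable lborel (\<lambda>u. complex_of_real (F (exp u)) * exp (z * complex_of_real u))"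
    and mellin_inverse_stable: "mellin F z = inverse_stable_mellin \<nu> t z"
proof -
  let ?m = "\<lambda>z::complex. exp (z * of_real (\<nu> * ln t)) * Gamma (1 + z) * rGamma (1 + of_real \<nu> * z)"
  have "1 + w \<notin> \<int>\<^sub>\<le>\<^sub>0" if "a < Re w" for w
  proof
    assume "1 + w \<in> \<int>\<^sub>\<le>\<^sub>0"
    then obtain n where n: "1 + w = of_int n" "n \<le> 0" by (auto elim!: nonpos_Ints_cases)
    from arg_cong[OF n(1), of Re] show False using n(2) ab that by simp
  qed
  then have hol: "?m holomorphic_on {w. a < Re w \<and> Re w < Re z + 1}"
    by (intro holomorphic_intros) auto
  have M0: "0 \<le> t powr (\<nu> * p) * (Gamma (1 + p) / Gamma (1 + \<nu> * p))" if p: "a < p" for p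
  proof -
    have "\<nu> * (-1) < \<nu> * p" using \<nu> p ab by (intro mult_strict_left_mono) auto
    then show ?thesis using p ab \<nu>
      by (intro mult_nonneg_nonneg divide_nonneg_nonneg less_imp_le[OF Gamma_real_pos]) auto
  qed
  have mM: "?m (of_real p) = of_real (t powr (\<nu> * p) * (Gamma (1 + p) / Gamma (1 + \<nu> * p)))" for p
  proof -
    have "exp (complex_of_real p * of_real (\<nu> * ln t)) = of_real (t powr (\<nu> * p))"
      using t by (simp add: powr_def mult_ac flip: exp_of_real)
    then show ?thesis
      using Gamma_complex_of_real[of "1 + p"] rGamma_complex_of_real[of "1 + \<nu> * p"]
      by (simp add: Gamma_def divide_inverse)
  qed
  show "integrable lborel (\<lambda>u. complex_of_real (F (exp u)) * exp (z * complex_of_real u))"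
    by (rule mellin_integrable_of_real[OF F F0 _ _ hol M M0 mM]) (use ab in auto)
  have "mellin F z = ?m z"
    by (rule mellin_eq_of_real[OF F F0 _ _ hol M M0 mM]) (use ab in auto)
  then show "mellin F z = inverse_stable_mellin \<nu> t z"
    by (simp add: inverse_stable_mellin_def Gamma_def divide_inverse)
qed

lemma mellin_integrable_imp_real:
  fixes g :: "real \<Rightarrow> real"
  assumes "integrable lborel (\<lambda>u. complex_of_real (g (exp u)) * exp (of_real \<theta> * complex_of_real u))"
  shows "integrable lborel (\<lambda>u. g (exp u) * exp (\<theta> * u))"
proof -
  from assms have "integrable lborel (\<lambda>u. Re (complex_of_real (g (exp u)) * exp (of_real \<theta> * complex_of_real u)))"
    by (rule integrable_Re)
  then show ?thesis by (simp only: of_real_mult[symmetric] exp_of_real Re_complex_of_real)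
qed

lemma
  assumes \<theta>: "\<theta> > - \<mu>"
  shows mellin_Gamma_Complex: "mellin (\<lambda>s. s powr \<mu> * exp (- s)) (Complex \<theta> y) = Gamma (of_real \<mu> + Complex \<theta> y)"
    and Gamma_kernel_integrable: "integrable lborel (\<lambda>u. exp u powr \<mu> * exp (- exp u) * exp (\<theta> * u))"
    and mellin_Gamma_line_integrable: "integrable lborel (\<lambda>y. mellin (\<lambda>s. s powr \<mu> * exp (- s)) (Complex \<theta> y))"
proof -
  show G: "mellin (\<lambda>s. s powr \<mu> * exp (- s)) (Complex \<theta> y) = Gamma (of_real \<mu> + Complex \<theta> y)" for y
    using mellin_Gamma[of \<mu> "Complex \<theta> y"] \<theta> by (simp add: add.commute)
  show "integrable lborel (\<lambda>u. exp u powr \<mu> * exp (- exp u) * exp (\<theta> * u))"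
    using mellin_integrable_imp_real[OF mellin_Gamma_integrable[of \<mu> "of_real \<theta>"]] \<theta> by simp
  obtain C where C: "\<And>y. (1 + \<bar>y\<bar>) ^ 2 * cmod (Gamma (Complex (\<mu> + \<theta>) y)) \<le> C"
    using Gamma_vertical_decay[of "\<mu> + \<theta>" 2] \<theta> by auto
  have "Complex (\<mu> + \<theta>) y = of_real \<mu> + Complex \<theta> y" for y by (simp add: complex_eq_iff)
  with C have "(1 + \<bar>y\<bar>) ^ 2 * cmod (Gamma (of_real \<mu> + Complex \<theta> y)) \<le> C" for y by metis
  then show "integrable lborel (\<lambda>y. mellin (\<lambda>s. s powr \<mu> * exp (- s)) (Complex \<theta> y))"
    unfolding G by (intro integrable_poly_decay) auto
qed

text \<open>This is what \<nu> = 1 requires: mixing with a point mass leaves the kernel itself, and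
  no convolution occurs.\<close>

lemma Gamma_kernel_inversion:
  assumes \<theta>: "\<theta> > - \<mu>"
  shows "complex_of_real (exp v powr \<mu> * exp (- exp v)) = 1 / (2 * pi) *
      (\<integral>y. mellin (\<lambda>s. s powr \<mu> * exp (- s)) (Complex \<theta> y) * exp (- Complex \<theta> y * of_real v) \<partial>lborel)"
  by (rule mellin_inversion[where f = "\<lambda>s. s powr \<mu> * exp (- s)"])
     (auto intro!: continuous_intros Gamma_kernel_integrable mellin_Gamma_line_integrable \<theta>)

lemma gamma_mixture_mellin_barnes:
  fixes F :: "real \<Rightarrow> real"
  assumes \<theta>: "\<theta> > - \<mu>" and F: "F \<in> borel_measurable borel"
    and int: "integrable lborel (\<lambda>u. complex_of_real (F (exp u)) * exp (of_real \<theta> * complex_of_real u))"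
  shows "complex_of_real (\<integral>u. exp (c - u) powr \<mu> * exp (- exp (c - u)) * F (exp u) \<partial>lborel) =
    1 / (2 * pi) * (\<integral>y. Gamma (of_real \<mu> + Complex \<theta> y) * mellin F (Complex \<theta> y) * exp (- Complex \<theta> y * of_real c) \<partial>lborel)"
  unfolding mellin_Gamma_Complex[OF \<theta>, symmetric]
  by (rule mellin_convolution_inversion[where f = "\<lambda>s. s powr \<mu> * exp (- s)", OF _ _ _ _ F mellin_integrable_imp_real[OF int]])
     (auto intro!: continuous_intros Gamma_kernel_integrable mellin_Gamma_line_integrable \<theta>)

section \<open>Mellin--Barnes integrals and the differential operators\<close>

text \<open>A class of amplitudes stable under the polynomial factors that derivatives produce, so
  that no orders of decay have to be tracked.\<close>

definition rapid :: "(real \<Rightarrow> complex) \<Rightarrow> bool" where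
  "rapid A \<longleftrightarrow> A \<in> borel_measurable borel \<and> (\<forall>n. \<exists>C. \<forall>y. (1 + \<bar>y\<bar>) ^ n * cmod (A y) \<le> C)"

lemma rapid_measurable: "rapid A \<Longrightarrow> A \<in> borel_measurable borel"
  by (simp add: rapid_def)

lemma rapid_integrable: "rapid A \<Longrightarrow> integrable lborel A"
  unfolding rapid_def using integrable_poly_decay by blast

lemma rapid_mult:
  assumes A: "rapid A" and p[measurable]: "p \<in> borel_measurable borel"
    and p_le: "\<And>y. cmod (p y) \<le> D * (1 + \<bar>y\<bar>) ^ k"
  shows "rapid (\<lambda>y. A y * p y)"
  unfolding rapid_def
proof (intro conjI allI)
  have [measurable]: "A \<in> borel_measurable borel" using A by (rule rapid_measurable)
  show "(\<lambda>y. A y * p y) \<in> borel_measurable borel" by measurable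
  fix n
  obtain C where C: "\<And>y. (1 + \<bar>y\<bar>) ^ (n + k) * cmod (A y) \<le> C" using A unfolding rapid_def by blast
  have D: "D \<ge> 0" using order_trans[OF norm_ge_zero p_le[of 0]] by simp
  have "(1 + \<bar>y\<bar>) ^ n * cmod (A y * p y) \<le> D * C" for y
  proof -
    have "(1 + \<bar>y\<bar>) ^ n * cmod (A y * p y) = ((1 + \<bar>y\<bar>) ^ n * cmod (A y)) * cmod (p y)"
      by (simp add: norm_mult mult_ac)
    also have "\<dots> \<le> ((1 + \<bar>y\<bar>) ^ n * cmod (A y)) * (D * (1 + \<bar>y\<bar>) ^ k)"
      by (intro mult_left_mono p_le) auto
    also have "\<dots> = D * ((1 + \<bar>y\<bar>) ^ (n + k) * cmod (A y))" by (simp add: power_add mult_ac)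
    also have "\<dots> \<le> D * C" by (intro mult_left_mono C D)
    finally show ?thesis .
  qed
  then show "\<exists>C. \<forall>y. (1 + \<bar>y\<bar>) ^ n * cmod (A y * p y) \<le> C" by blast
qed

lemma rapid_mult_bounded:
  assumes "rapid A" "p \<in> borel_measurable borel" "\<And>y. cmod (p y) \<le> D"
  shows "rapid (\<lambda>y. A y * p y)"
  using rapid_mult[of A p D 0] assms by simp

lemma rapid_mult_affine:
  assumes "rapid A"
  shows "rapid (\<lambda>y. A y * Complex c (b * y))"
proof (rule rapid_mult[OF assms, of _ "\<bar>c\<bar> + \<bar>b\<bar>" 1])
  fix y
  have "cmod (Complex c (b * y)) \<le> \<bar>c\<bar> + \<bar>b\<bar> * \<bar>y\<bar>"
    using cmod_le[of "Complex c (b * y)"] by (simp add: abs_mult)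
  also have "\<dots> \<le> (\<bar>c\<bar> + \<bar>b\<bar>) * (1 + \<bar>y\<bar>) ^ 1" by (simp add: algebra_simps)
  finally show "cmod (Complex c (b * y)) \<le> (\<bar>c\<bar> + \<bar>b\<bar>) * (1 + \<bar>y\<bar>) ^ 1" .
qed simp

lemma rapid_Gamma:
  assumes "\<sigma> > 0"
  shows "rapid (\<lambda>y. Gamma (Complex \<sigma> y))"
  unfolding rapid_def using Gamma_vertical_decay[OF assms] by simp

text \<open>Real part of the integral of \<open>A y * x powr (c + \<i> * b * y)\<close> over \<open>y\<close>.\<close>

definition mb_integral :: "(real \<Rightarrow> complex) \<Rightarrow> real \<Rightarrow> real \<Rightarrow> real \<Rightarrow> real" where
  "mb_integral A b c x = (\<integral>y. Re (A y * exp (Complex c (b * y) * of_real (ln x))) \<partial>lborel)"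

lemma mb_integral_integrable:
  assumes A: "rapid A"
  shows "integrable lborel (\<lambda>y. A y * exp (Complex c (b * y) * of_real u))"
  by (rule exp_integral_integrable[OF rapid_integrable[OF A], of _ c]) auto

lemma mb_integral_powr_mult:
  assumes "x > 0"
  shows "x powr a * mb_integral A b c x = mb_integral A b (a + c) x"
proof -
  have "x powr a * mb_integral A b c x = (\<integral>y. x powr a * Re (A y * exp (Complex c (b * y) * of_real (ln x))) \<partial>lborel)"
    unfolding mb_integral_def by (rule integral_mult_right_zero[symmetric])
  also have "\<dots> = mb_integral A b (a + c) x"
    unfolding mb_integral_def
  proof (intro Bochner_Integration.integral_cong refl)
    fix y
    have "Complex (a + c) (b * y) * of_real (ln x) = Complex c (b * y) * of_real (ln x) + of_real (a * ln x)"
      by (simp add: complex_eq_iff algebra_simps)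
    moreover have "exp (complex_of_real (a * ln x)) = of_real (x powr a)"
      using assms by (simp add: powr_def exp_of_real del: of_real_mult)
    ultimately have "A y * exp (Complex (a + c) (b * y) * of_real (ln x)) = of_real (x powr a) * (A y * exp (Complex c (b * y) * of_real (ln x)))"
      by (simp only: exp_add mult_ac)
    then show "x powr a * Re (A y * exp (Complex c (b * y) * of_real (ln x))) = Re (A y * exp (Complex (a + c) (b * y) * of_real (ln x)))"
      by (simp only: Re_complex_of_real Im_complex_of_real times_complex.sel mult_zero_left diff_zero)
  qed
  finally show ?thesis .
qed

lemma mb_integral_has_derivative:
  assumes A: "rapid A" and x: "x > 0"
  shows "(mb_integral A b c has_real_derivative mb_integral (\<lambda>y. A y * Complex c (b * y)) b (c - 1) x) (at x)"
proof -
  have eq: "mb_integral A b c = (\<lambda>x. exp_integral A (\<lambda>y. Complex c (b * y)) (ln x))" for A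
    by (simp add: mb_integral_def[abs_def] exp_integral_def)
  let ?A' = "\<lambda>y. A y * Complex c (b * y)"
  have "(exp_integral A (\<lambda>y. Complex c (b * y)) has_real_derivative exp_integral ?A' (\<lambda>y. Complex c (b * y)) (ln x)) (at (ln x))"
    by (rule exp_integral_has_derivative[OF rapid_integrable[OF A] rapid_integrable[OF rapid_mult_affine[OF A]]]) auto
  from DERIV_chain2[OF this DERIV_ln[OF x]]
  have "(mb_integral A b c has_real_derivative mb_integral ?A' b c x * inverse x) (at x)"
    by (simp add: eq)
  also have "mb_integral ?A' b c x * inverse x = x powr (- 1) * mb_integral ?A' b c x"
    using x by (simp add: powr_minus)
  also have "\<dots> = mb_integral ?A' b (- 1 + c) x" by (rule mb_integral_powr_mult[OF x])
  finally show ?thesis by simp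
qed

lemma mb_integral_diff:
  assumes "rapid A" "rapid A'"
  shows "mb_integral A b c x - r * mb_integral A' b c x = mb_integral (\<lambda>y. A y - of_real r * A' y) b c x"
proof -
  have "mb_integral A b c x - r * mb_integral A' b c x =
      (\<integral>y. Re (A y * exp (Complex c (b * y) * of_real (ln x))) - r * Re (A' y * exp (Complex c (b * y) * of_real (ln x))) \<partial>lborel)"
    unfolding mb_integral_def
    by (subst Bochner_Integration.integral_diff)
       (intro integrable_Re integrable_mult_right mb_integral_integrable assms | simp)+
  also have "\<dots> = mb_integral (\<lambda>y. A y - of_real r * A' y) b c x"
    unfolding mb_integral_def
    by (intro Bochner_Integration.integral_cong refl) (simp add: algebra_simps)
  finally show ?thesis .
qed

lemma mb_integral_cmult: "mb_integral (\<lambda>y. of_real r * A y) b c x = r * mb_integral A b c x"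
  unfolding mb_integral_def integral_mult_right_zero[symmetric]
  by (intro Bochner_Integration.integral_cong refl) (simp add: algebra_simps)

text \<open>The operator multiplies the power of x with exponent -1 - \<i>\<gamma>y by (1 +
  \<i>y)(\<mu> + \<i>y) and lowers the exponent by \<gamma>: both terms of \<open>G_op\<close> share
  the factor w1 = -\<gamma>(1 + \<i>y), and w0 - (\<gamma>\<mu> - 1) = -\<gamma>(\<mu> + \<i>y).
  These two factors are the ones that move Gamma (1 + \<eta>) and Gamma (\<mu> + \<eta>) from Re
  \<eta> = 0 to Re \<eta> = 1.\<close>

lemma G_op_mb_integral:
  assumes A: "rapid A" and \<gamma>: "\<gamma> > 0"
    and f: "\<And>x. x > 0 \<Longrightarrow> f x = k * mb_integral A (- \<gamma>) (- 1) x"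
  shows "G_applicable \<gamma> f"
    and "x > 0 \<Longrightarrow> G_op \<gamma> \<mu> f x = k * mb_integral (\<lambda>y. A y * (Complex 1 y * Complex \<mu> y)) (- \<gamma>) (- \<gamma> - 1) x"
proof -
  let ?b = "- \<gamma>"
  define w0 where "w0 y = Complex (- 1) (?b * y)" for y
  define w1 where "w1 y = Complex (- \<gamma>) (?b * y)" for y
  have pos: "eventually (\<lambda>y. y \<in> {0<..}) (nhds x)" if "x > 0" for x :: real
    using that by (intro eventually_nhds_in_open) auto
  have A0: "rapid (\<lambda>y. A y * w0 y)" unfolding w0_def by (rule rapid_mult_affine[OF A])
  have A01: "rapid (\<lambda>y. A y * w0 y * w1 y)" unfolding w1_def by (rule rapid_mult_affine[OF A0])
  have A1: "rapid (\<lambda>y. A y * w1 y)" unfolding w1_def by (rule rapid_mult_affine[OF A])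
  have D0: "(f has_real_derivative k * mb_integral (\<lambda>y. A y * w0 y) ?b (- 2) x) (at x)" if x: "x > 0" for x
  proof -
    have "eventually (\<lambda>y. f y = k * mb_integral A ?b (- 1) y) (nhds x)"
      using pos[OF x] by (rule eventually_mono) (simp add: f)
    moreover have "((\<lambda>x. k * mb_integral A ?b (- 1) x) has_real_derivative k * mb_integral (\<lambda>y. A y * w0 y) ?b (- 2) x) (at x)"
      using DERIV_cmult[OF mb_integral_has_derivative[OF A x, of ?b "- 1"], of k] by (simp add: w0_def)
    ultimately show ?thesis by (subst DERIV_cong_ev[OF refl _ refl])
  qed
  have D1: "((\<lambda>y. y powr (2 - \<gamma>) * deriv f y) has_real_derivative k * mb_integral (\<lambda>y. A y * w0 y * w1 y) ?b (- \<gamma> - 1) x) (at x)" if x: "x > 0" for x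
  proof -
    have "eventually (\<lambda>y. y powr (2 - \<gamma>) * deriv f y = k * mb_integral (\<lambda>y. A y * w0 y) ?b (- \<gamma>) y) (nhds x)"
      using pos[OF x]
    proof (rule eventually_mono)
      fix y :: real assume "y \<in> {0<..}"
      then show "y powr (2 - \<gamma>) * deriv f y = k * mb_integral (\<lambda>y. A y * w0 y) ?b (- \<gamma>) y"
        using mb_integral_powr_mult[of y "2 - \<gamma>" "\<lambda>y. A y * w0 y" ?b "- 2"] DERIV_imp_deriv[OF D0[of y]]
        by simp
    qed
    moreover have "((\<lambda>x. k * mb_integral (\<lambda>y. A y * w0 y) ?b (- \<gamma>) x) has_real_derivative k * mb_integral (\<lambda>y. A y * w0 y * w1 y) ?b (- \<gamma> - 1) x) (at x)"
      using DERIV_cmult[OF mb_integral_has_derivative[OF A0 x, of ?b "- \<gamma>"], of k] by (simp add: w1_def)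
    ultimately show ?thesis by (subst DERIV_cong_ev[OF refl _ refl])
  qed
  have D2: "((\<lambda>y. y powr (1 - \<gamma>) * f y) has_real_derivative k * mb_integral (\<lambda>y. A y * w1 y) ?b (- \<gamma> - 1) x) (at x)" if x: "x > 0" for x
  proof -
    have "eventually (\<lambda>y. y powr (1 - \<gamma>) * f y = k * mb_integral A ?b (- \<gamma>) y) (nhds x)"
      using pos[OF x]
    proof (rule eventually_mono)
      fix y :: real assume "y \<in> {0<..}"
      then show "y powr (1 - \<gamma>) * f y = k * mb_integral A ?b (- \<gamma>) y"
        using mb_integral_powr_mult[of y "1 - \<gamma>" A ?b "- 1"] f[of y] by simp
    qed
    moreover have "((\<lambda>x. k * mb_integral A ?b (- \<gamma>) x) has_real_derivative k * mb_integral (\<lambda>y. A y * w1 y) ?b (- \<gamma> - 1) x) (at x)"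
      using DERIV_cmult[OF mb_integral_has_derivative[OF A x, of ?b "- \<gamma>"], of k] by (simp add: w1_def)
    ultimately show ?thesis by (subst DERIV_cong_ev[OF refl _ refl])
  qed
  show "G_applicable \<gamma> f"
    unfolding G_applicable_def
    using D0 D1 D2 by (auto simp: differentiable_def has_field_derivative_def)
  assume x: "x > 0"
  have "G_op \<gamma> \<mu> f x = k / \<gamma>\<^sup>2 * (mb_integral (\<lambda>y. A y * w0 y * w1 y) ?b (- \<gamma> - 1) x - (\<gamma> * \<mu> - 1) * mb_integral (\<lambda>y. A y * w1 y) ?b (- \<gamma> - 1) x)"
    unfolding G_op_def DERIV_imp_deriv[OF D1[OF x]] DERIV_imp_deriv[OF D2[OF x]] by (simp add: algebra_simps)
  also have "\<dots> = k / \<gamma>\<^sup>2 * mb_integral (\<lambda>y. A y * w0 y * w1 y - of_real (\<gamma> * \<mu> - 1) * (A y * w1 y)) ?b (- \<gamma> - 1) x"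
    by (simp only: mb_integral_diff[OF A01 A1])
  also have "(\<lambda>y. A y * w0 y * w1 y - of_real (\<gamma> * \<mu> - 1) * (A y * w1 y)) = (\<lambda>y. of_real (\<gamma>\<^sup>2) * (A y * (Complex 1 y * Complex \<mu> y)))"
  proof
    fix y
    have "w0 y - of_real (\<gamma> * \<mu> - 1) = - of_real \<gamma> * Complex \<mu> y" "w1 y = - of_real \<gamma> * Complex 1 y"
      by (simp_all add: w0_def w1_def complex_eq_iff)
    then have "w1 y * (w0 y - of_real (\<gamma> * \<mu> - 1)) = of_real (\<gamma>\<^sup>2) * (Complex 1 y * Complex \<mu> y)"
      by (simp add: power2_eq_square)
    moreover have "A y * w0 y * w1 y - of_real (\<gamma> * \<mu> - 1) * (A y * w1 y) = A y * (w1 y * (w0 y - of_real (\<gamma> * \<mu> - 1)))"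
      by (simp add: algebra_simps)
    ultimately show "A y * w0 y * w1 y - of_real (\<gamma> * \<mu> - 1) * (A y * w1 y) = of_real (\<gamma>\<^sup>2) * (A y * (Complex 1 y * Complex \<mu> y))"
      by (simp only: mult_ac)
  qed
  also have "k / \<gamma>\<^sup>2 * mb_integral (\<lambda>y. of_real (\<gamma>\<^sup>2) * (A y * (Complex 1 y * Complex \<mu> y))) ?b (- \<gamma> - 1) x =
      k * mb_integral (\<lambda>y. A y * (Complex 1 y * Complex \<mu> y)) ?b (- \<gamma> - 1) x"
    using \<gamma> by (simp only: mb_integral_cmult) simp
  finally show "G_op \<gamma> \<mu> f x = k * mb_integral (\<lambda>y. A y * (Complex 1 y * Complex \<mu> y)) ?b (- \<gamma> - 1) x" .
qed

text \<open>With s = t exp v the fractional integral of s^w is t^(w + 1 - \<nu>) times a Beta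
  integral at 1 + w, and c > -1 makes it converge at s = 0. Fubini moves this inside the integral
  over y.\<close>

lemma RL_integral_mb_integral:
  assumes A: "rapid A" and \<nu>: "0 < \<nu>" "\<nu> < 1" and c: "c > - 1" and t: "t > 0"
    and f: "\<And>s. s > 0 \<Longrightarrow> f s = k * mb_integral A b c s"
  shows "set_integrable lborel {0<..<t} (\<lambda>s. (t - s) powr (- \<nu>) * f s)"
    and "RL_integral \<nu> f t = k * mb_integral (\<lambda>y. A y * (Gamma (1 + Complex c (b * y)) * Gamma (of_real (1 - \<nu>)) / Gamma (1 + Complex c (b * y) + of_real (1 - \<nu>)))) b (c + (1 - \<nu>)) t"
proof -
  let ?w = "\<lambda>y. Complex c (b * y)"
  let ?\<beta> = "\<lambda>s::real. if s < 1 then (1 - s) powr ((1 - \<nu>) - 1) else 0"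
  have [measurable]: "A \<in> borel_measurable borel" using A by (rule rapid_measurable)
  note Beta = mellin_Beta_integrable[where b = "1 - \<nu>"] mellin_Beta[where b = "1 - \<nu>"]
  let ?H = "\<lambda>v y. (of_real (?\<beta> (exp v)) * exp ((1 + ?w y) * of_real v)) * (A y * exp (?w y * of_real (ln t)))"
  have normH: "norm (?H v y) = (?\<beta> (exp v) * exp ((1 + c) * v)) * (cmod (A y) * exp (c * ln t))" for v y
    by (simp add: norm_mult)
  have measH: "case_prod ?H \<in> borel_measurable (lborel \<Otimes>\<^sub>M lborel)" by measurable
  have int\<beta>: "integrable lborel (\<lambda>v. ?\<beta> (exp v) * exp ((1 + c) * v))"
  proof -
    have "integrable lborel (\<lambda>v. Re (of_real (?\<beta> (exp v)) * exp (of_real (1 + c) * complex_of_real v)))"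
      by (intro integrable_Re Beta) (use c \<nu> in auto)
    then show ?thesis by (simp only: of_real_mult[symmetric] exp_of_real Re_complex_of_real)
  qed
  have intA: "integrable lborel (\<lambda>y. cmod (A y) * exp (c * ln t))"
    by (intro integrable_mult_left integrable_norm rapid_integrable A)
  have intHy: "integrable lborel (?H v)" for v
  proof (rule Bochner_Integration.integrable_bound[OF integrable_mult_right[OF intA, of "?\<beta> (exp v) * exp ((1 + c) * v)"]])
    show "AE y in lborel. norm (?H v y) \<le> norm ((?\<beta> (exp v) * exp ((1 + c) * v)) * (cmod (A y) * exp (c * ln t)))"
      unfolding normH by simp
  qed measurable
  have intH: "integrable (lborel \<Otimes>\<^sub>M lborel) (case_prod ?H)"
  proof (rule lborel_pair.Fubini_integrable[OF measH])
    show "integrable lborel (\<lambda>v. \<integral>y. norm (case_prod ?H (v, y)) \<partial>lborel)"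
      unfolding split normH using int\<beta> by simp
  qed (use intHy in simp)
  let ?g = "\<lambda>s. (t - s) powr (- \<nu>) * f s"
  \<comment> \<open>On s > 0 this is the integrand cut off at t; being written through the
    representation of f, it is measurable on the whole line.\<close>
  let ?g' = "\<lambda>s. indicator {..<t} s * ((t - s) powr (- \<nu>) * (k * mb_integral A b c s))"
  have [measurable]: "mb_integral A b c \<in> borel_measurable borel"
    unfolding mb_integral_def[abs_def] by measurable
  have g_eq: "indicator {0<..<t} s *\<^sub>R ?g s = indicator {0<..} s *\<^sub>R ?g' s" for s
    by (auto simp: indicator_def f)
  \<comment> \<open>At s = t exp v the condition s < t reads exp v < 1; beyond it both sides
    vanish.\<close>
  have gu: "exp (ln t + v) *\<^sub>R ?g' (exp (ln t + v)) = k * t powr (1 - \<nu>) * Re (\<integral>y. ?H v y \<partial>lborel)" for v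
  proof (cases "exp v < 1")
    case True
    have e: "exp (ln t + v) = t * exp v" using t by (simp add: exp_add)
    have lt: "t * exp v < t" using True t by simp
    have "t - t * exp v = t * (1 - exp v)" by (simp add: algebra_simps)
    then have p: "(t - t * exp v) powr (- \<nu>) = t powr (- \<nu>) * (1 - exp v) powr (- \<nu>)"
      using t True by (simp add: powr_mult)
    have ln: "ln (t * exp v) = ln t + v" using t by (simp add: ln_mult)
    have "Re (\<integral>y. ?H v y \<partial>lborel) = (\<integral>y. Re (?H v y) \<partial>lborel)"
      by (rule integral_Re[OF intHy, symmetric])
    also have "\<dots> = (\<integral>y. (1 - exp v) powr (- \<nu>) * exp v * Re (A y * exp (?w y * of_real (ln (t * exp v)))) \<partial>lborel)"
    proof (intro Bochner_Integration.integral_cong refl)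
      fix y
      have "exp ((1 + ?w y) * of_real v) * exp (?w y * of_real (ln t)) = of_real (exp v) * exp (?w y * of_real (ln t + v))"
        by (simp add: algebra_simps flip: exp_of_real exp_add)
      then have "?H v y = of_real ((1 - exp v) powr (- \<nu>) * exp v) * (A y * exp (?w y * of_real (ln (t * exp v))))"
        using True by (simp add: ln mult_ac)
      then show "Re (?H v y) = (1 - exp v) powr (- \<nu>) * exp v * Re (A y * exp (?w y * of_real (ln (t * exp v))))"
        by (simp only: Re_complex_of_real Im_complex_of_real times_complex.sel mult_zero_left diff_zero)
    qed
    also have "\<dots> = (1 - exp v) powr (- \<nu>) * exp v * mb_integral A b c (t * exp v)"
      unfolding mb_integral_def by (rule integral_mult_right_zero)
    finally have R: "Re (\<integral>y. ?H v y \<partial>lborel) = (1 - exp v) powr (- \<nu>) * exp v * mb_integral A b c (t * exp v)" .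
    have "t powr (1 - \<nu>) = t * t powr (- \<nu>)" using t powr_add[of t 1 "- \<nu>"] by simp
    then show ?thesis unfolding e R using lt by (simp add: p)
  next
    case False
    then have "\<not> exp (ln t + v) < t" using t by (simp add: exp_add)
    then show ?thesis using False by simp
  qed
  have "integrable lborel (\<lambda>v. k * t powr (1 - \<nu>) * Re (\<integral>y. ?H v y \<partial>lborel))"
    using lborel_pair.integrable_fst'[OF intH] by (intro integrable_mult_right integrable_Re) simp
  then have int: "integrable lborel (\<lambda>u. exp u *\<^sub>R ?g' (exp u))"
    using lborel_integrable_real_affine_iff[of 1 "\<lambda>u. exp u *\<^sub>R ?g' (exp u)" "ln t"]
    by (simp only: mult_1_left gu)
  have meas: "?g' \<in> borel_measurable borel" by measurable
  have "set_integrable lborel {0<..} ?g'"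
    using int set_integrable_exp_substitution[OF meas] by blast
  then show "set_integrable lborel {0<..<t} ?g"
    unfolding set_integrable_def g_eq .
  have "RL_integral \<nu> f t = (LBINT s:{0<..}. ?g' s)"
    unfolding RL_integral_def set_lebesgue_integral_def g_eq ..
  also have "\<dots> = (\<integral>u. exp u *\<^sub>R ?g' (exp u) \<partial>lborel)" by (rule set_integral_exp_substitution[OF meas])
  also have "\<dots> = (\<integral>v. exp (ln t + 1 * v) *\<^sub>R ?g' (exp (ln t + 1 * v)) \<partial>lborel)"
    by (subst lborel_integral_real_affine[of 1 _ "ln t"]) simp_all
  also have "\<dots> = (\<integral>v. k * t powr (1 - \<nu>) * Re (\<integral>y. ?H v y \<partial>lborel) \<partial>lborel)"
    by (simp only: gu mult_1_left)
  also have "\<dots> = k * t powr (1 - \<nu>) * (\<integral>v. Re (\<integral>y. ?H v y \<partial>lborel) \<partial>lborel)"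
    by (rule integral_mult_right_zero)
  also have "(\<integral>v. Re (\<integral>y. ?H v y \<partial>lborel) \<partial>lborel) = Re (\<integral>v. (\<integral>y. ?H v y \<partial>lborel) \<partial>lborel)"
    using lborel_pair.integrable_fst'[OF intH] by (intro integral_Re) simp
  also have "(\<integral>v. (\<integral>y. ?H v y \<partial>lborel) \<partial>lborel) = (\<integral>y. (\<integral>v. ?H v y \<partial>lborel) \<partial>lborel)"
    by (rule lborel_pair.Fubini_integral[OF intH, symmetric])
  also have "\<dots> = (\<integral>y. A y * (Gamma (1 + ?w y) * Gamma (of_real (1 - \<nu>)) / Gamma (1 + ?w y + of_real (1 - \<nu>))) * exp (?w y * of_real (ln t)) \<partial>lborel)" (is "_ = integral\<^sup>L lborel ?B")
  proof (intro Bochner_Integration.integral_cong refl)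
    fix y
    have "(\<integral>v. ?H v y \<partial>lborel) = mellin ?\<beta> (1 + ?w y) * (A y * exp (?w y * of_real (ln t)))"
      unfolding mellin_def by (rule integral_mult_left_zero)
    also have "mellin ?\<beta> (1 + ?w y) = Gamma (1 + ?w y) * Gamma (of_real (1 - \<nu>)) / Gamma (1 + ?w y + of_real (1 - \<nu>))"
      by (rule Beta) (use c \<nu> in auto)
    finally show "(\<integral>v. ?H v y \<partial>lborel) = ?B y" by (simp add: mult_ac)
  qed
  also have "Re (integral\<^sup>L lborel ?B) = (\<integral>y. Re (?B y) \<partial>lborel)"
  proof (rule integral_Re[symmetric])
    have "integrable lborel (\<lambda>y. \<integral>v. ?H v y \<partial>lborel)"
      using lborel_pair.integrable_snd[OF intH] by simp
    also have "(\<lambda>y. \<integral>v. ?H v y \<partial>lborel) = ?B"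
    proof
      fix y
      have "(\<integral>v. ?H v y \<partial>lborel) = mellin ?\<beta> (1 + ?w y) * (A y * exp (?w y * of_real (ln t)))"
        unfolding mellin_def by (rule integral_mult_left_zero)
      also have "mellin ?\<beta> (1 + ?w y) = Gamma (1 + ?w y) * Gamma (of_real (1 - \<nu>)) / Gamma (1 + ?w y + of_real (1 - \<nu>))"
        by (rule Beta) (use c \<nu> in auto)
      finally show "(\<integral>v. ?H v y \<partial>lborel) = ?B y" by (simp add: mult_ac)
    qed
    finally show "integrable lborel ?B" .
  qed
  also have "k * t powr (1 - \<nu>) * (\<integral>y. Re (?B y) \<partial>lborel) =
     k * mb_integral (\<lambda>y. A y * (Gamma (1 + ?w y) * Gamma (of_real (1 - \<nu>)) / Gamma (1 + ?w y + of_real (1 - \<nu>)))) b (c + (1 - \<nu>)) t"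
    using mb_integral_powr_mult[OF t, of "1 - \<nu>" "\<lambda>y. A y * (Gamma (1 + ?w y) * Gamma (of_real (1 - \<nu>)) / Gamma (1 + ?w y + of_real (1 - \<nu>)))" b c]
    unfolding mb_integral_def by (simp only: mult.assoc add.commute[of c "1 - \<nu>"])
  finally show "RL_integral \<nu> f t = k * mb_integral (\<lambda>y. A y * (Gamma (1 + ?w y) * Gamma (of_real (1 - \<nu>)) / Gamma (1 + ?w y + of_real (1 - \<nu>)))) b (c + (1 - \<nu>)) t" .
qed

lemma inverse_stable_mellin_at_1:
  assumes "t > 0"
  shows "inverse_stable_mellin \<nu> t z = inverse_stable_mellin \<nu> 1 z * exp (z * of_real (\<nu> * ln t))"
  by (simp add: inverse_stable_mellin_def)

lemma Gamma_plus1_right_half: "Re z > 0 \<Longrightarrow> Gamma (z + 1 :: complex) = z * Gamma z"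
  by (rule Gamma_plus1) (auto elim!: nonpos_Ints_cases)

lemma Gamma_nonzero_right_half: "Re z > 0 \<Longrightarrow> Gamma (z :: complex) \<noteq> 0"
  by (subst Gamma_eq_zero_iff) (auto elim!: nonpos_Ints_cases)

text \<open>The hypotheses \<open>rep\<close> and \<open>bounded\<close> cover \<open>\<nu> < 1\<close> and the degenerate case \<open>\<nu> = 1\<close> uniformly.\<close>

lemma mellin_barnes_solution:
  fixes u :: "real \<Rightarrow> real \<Rightarrow> real" and \<gamma> \<mu> \<nu> :: real
  assumes \<gamma>: "\<gamma> > 0" and \<mu>: "\<mu> > 0" and \<nu>: "0 < \<nu>" "\<nu> \<le> 1"
    and rep: "\<And>\<theta> x t. \<theta> > - min 1 \<mu> \<Longrightarrow> x > 0 \<Longrightarrow> t > 0 \<Longrightarrow>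
      complex_of_real (u x t) = of_real (\<gamma> / (x * Gamma \<mu>)) * (complex_of_real (1 / (2 * pi)) *
        (\<integral>y. Gamma (of_real \<mu> + Complex \<theta> y) * inverse_stable_mellin \<nu> t (Complex \<theta> y) * exp (- Complex \<theta> y * of_real (\<gamma> * ln x)) \<partial>lborel))"
    and bounded: "\<And>\<theta>. \<theta> > -1 \<Longrightarrow> \<exists>C. \<forall>y. cmod (inverse_stable_mellin \<nu> 1 (Complex \<theta> y)) \<le> C"
  shows "solves_fractional_equation \<gamma> \<mu> \<nu> u"
proof -
  let ?r = "inverse_stable_mellin \<nu> 1"
  define k where "k = \<gamma> / (2 * pi * Gamma \<mu>)"
  define B where "B \<theta> y = Gamma (of_real \<mu> + Complex \<theta> y) * ?r (Complex \<theta> y)" for \<theta> y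
  have [measurable]: "?r \<in> borel_measurable borel"
    unfolding inverse_stable_mellin_def[abs_def] by measurable
  have rapid_B: "rapid (B \<theta>)" if "\<theta> > - min 1 \<mu>" for \<theta>
  proof -
    have "\<theta> > -1" using that by linarith
    then obtain C where C: "\<And>y. cmod (?r (Complex \<theta> y)) \<le> C"
      using bounded by blast
    have "of_real \<mu> + Complex \<theta> y = Complex (\<mu> + \<theta>) y" for y by (simp add: complex_eq_iff)
    then have "rapid (\<lambda>y. Gamma (of_real \<mu> + Complex \<theta> y))" using rapid_Gamma[of "\<mu> + \<theta>"] that by simp
    then show ?thesis unfolding B_def[abs_def] by (rule rapid_mult_bounded[OF _ _ C]) measurable
  qed
  \<comment> \<open>One integrand read in two ways: A \<theta> t is the amplitude of a superposition
    of powers of x, and A' \<theta> x that of a superposition of powers of t.\<close>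
  define A where "A \<theta> t y = B \<theta> y * exp (Complex \<theta> y * of_real (\<nu> * ln t))" for \<theta> t y
  define A' where "A' \<theta> x y = B \<theta> y * exp (Complex (- \<gamma> * \<theta> - 1) (- \<gamma> * y) * of_real (ln x))" for \<theta> x y
  have rapid_A: "rapid (A \<theta> t)" if "\<theta> > - min 1 \<mu>" for \<theta> t
    unfolding A_def[abs_def]
    by (rule rapid_mult_bounded[OF rapid_B[OF that], of _ "exp (\<theta> * (\<nu> * ln t))"]) auto
  have rapid_A': "rapid (A' \<theta> x)" if "\<theta> > - min 1 \<mu>" for \<theta> x
    unfolding A'_def[abs_def]
    by (rule rapid_mult_bounded[OF rapid_B[OF that], of _ "exp ((- \<gamma> * \<theta> - 1) * ln x)"]) auto
  have ux: "u x t = k * mb_integral (A \<theta> t) (- \<gamma>) (- \<gamma> * \<theta> - 1) x"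
    if \<theta>: "\<theta> > - min 1 \<mu>" and x: "x > 0" and t: "t > 0" for \<theta> x t
  proof -
    have *: "Gamma (of_real \<mu> + Complex \<theta> y) * inverse_stable_mellin \<nu> t (Complex \<theta> y) * exp (- Complex \<theta> y * of_real (\<gamma> * ln x)) =
        A \<theta> t y * exp (Complex (- \<gamma> * \<theta>) (- \<gamma> * y) * of_real (ln x))" for y
    proof -
      have "- Complex \<theta> y * of_real (\<gamma> * ln x) = Complex (- \<gamma> * \<theta>) (- \<gamma> * y) * of_real (ln x)"
        by (simp add: complex_eq_iff)
      then show ?thesis unfolding A_def B_def inverse_stable_mellin_at_1[OF t] by (simp only: mult.assoc)
    qed
    let ?I = "\<integral>y. A \<theta> t y * exp (Complex (- \<gamma> * \<theta>) (- \<gamma> * y) * of_real (ln x)) \<partial>lborel"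
    have "complex_of_real (u x t) = of_real (\<gamma> / (x * Gamma \<mu>) * (1 / (2 * pi))) * ?I"
      using rep[OF \<theta> x t] unfolding * by (simp only: of_real_mult mult.assoc)
    then have "u x t = Re (of_real (\<gamma> / (x * Gamma \<mu>) * (1 / (2 * pi))) * ?I)" by (metis Re_complex_of_real)
    also have "\<dots> = \<gamma> / (x * Gamma \<mu>) * (1 / (2 * pi)) * Re ?I"
      by (simp only: Re_complex_of_real Im_complex_of_real times_complex.sel mult_zero_left diff_zero)
    also have "Re ?I = mb_integral (A \<theta> t) (- \<gamma>) (- \<gamma> * \<theta>) x"
      unfolding mb_integral_def by (intro integral_Re[symmetric] mb_integral_integrable rapid_A \<theta>)
    also have "\<gamma> / (x * Gamma \<mu>) * (1 / (2 * pi)) * mb_integral (A \<theta> t) (- \<gamma>) (- \<gamma> * \<theta>) x =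
        k * (x powr (- 1) * mb_integral (A \<theta> t) (- \<gamma>) (- \<gamma> * \<theta>) x)"
      using x by (simp add: k_def powr_minus_divide)
    also have "x powr (- 1) * mb_integral (A \<theta> t) (- \<gamma>) (- \<gamma> * \<theta>) x = mb_integral (A \<theta> t) (- \<gamma>) (- \<gamma> * \<theta> - 1) x"
    proof -
      have "- 1 + - \<gamma> * \<theta> = - \<gamma> * \<theta> - 1" by simp
      then show ?thesis using mb_integral_powr_mult[OF x, of "- 1" "A \<theta> t" "- \<gamma>" "- \<gamma> * \<theta>"] by (simp only:)
    qed
    finally show ?thesis .
  qed
  have ut: "u x t = k * mb_integral (A' \<theta> x) \<nu> (\<nu> * \<theta>) t"
    if \<theta>: "\<theta> > - min 1 \<mu>" and x: "x > 0" and t: "t > 0" for \<theta> x t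
  proof -
    have "Complex \<theta> y * of_real (\<nu> * ln t) = Complex (\<nu> * \<theta>) (\<nu> * y) * of_real (ln t)" for y
      by (simp add: complex_eq_iff)
    then have "A \<theta> t y * exp (Complex (- \<gamma> * \<theta> - 1) (- \<gamma> * y) * of_real (ln x)) =
        A' \<theta> x y * exp (Complex (\<nu> * \<theta>) (\<nu> * y) * of_real (ln t))" for y
      unfolding A_def A'_def by (simp only: mult_ac)
    then show ?thesis unfolding ux[OF \<theta> x t] mb_integral_def by simp
  qed
  have \<theta>0: "(0::real) > - min 1 \<mu>" and \<theta>1: "(1::real) > - min 1 \<mu>" using \<mu> by auto
  have uG: "u x t = k * mb_integral (A 0 t) (- \<gamma>) (- 1) x" if "x > 0" "t > 0" for x t
    using ux[OF \<theta>0 that] by simp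
  have uR: "u x t = k * mb_integral (A' 1 x) \<nu> \<nu> t" if "x > 0" "t > 0" for x t
    using ut[OF \<theta>1 that] by simp
  have G_app: "G_applicable \<gamma> (\<lambda>x. u x t)" if "t > 0" for t
    by (rule G_op_mb_integral[OF rapid_A[OF \<theta>0] \<gamma> uG]) (use that in auto)
  have G_val: "G_op \<gamma> \<mu> (\<lambda>x. u x t) x = k * mb_integral (\<lambda>y. A 0 t y * (Complex 1 y * Complex \<mu> y)) (- \<gamma>) (- \<gamma> - 1) x"
    if "x > 0" "t > 0" for x t
    by (rule G_op_mb_integral[OF rapid_A[OF \<theta>0] \<gamma> uG]) (use that in auto)
  have shift1: "Gamma (of_real \<mu> + Complex 1 y) = Complex \<mu> y * Gamma (of_real \<mu> + Complex 0 y)" for y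
  proof -
    have "of_real \<mu> + Complex 1 y = Complex \<mu> y + 1" "of_real \<mu> + Complex 0 y = Complex \<mu> y"
      by (simp_all add: complex_eq_iff)
    then show ?thesis using Gamma_plus1_right_half[of "Complex \<mu> y"] \<mu> by simp
  qed
  have shift2: "Gamma (1 + Complex 1 y) = Complex 1 y * Gamma (1 + Complex 0 y)" for y
  proof -
    have "1 + Complex 0 y = Complex 1 y" by (simp add: complex_eq_iff)
    then show ?thesis using Gamma_plus1_right_half[of "Complex 1 y"] by (simp add: add.commute[of 1 "Complex 1 y"])
  qed
  let ?E = "\<lambda>x t y. exp (Complex (- \<gamma> - 1) (- \<gamma> * y) * of_real (ln x)) * exp (Complex 0 (\<nu> * y) * of_real (ln t))"
  let ?D = "\<lambda>x t y. B 0 y * (Complex 1 y * Complex \<mu> y) * ?E x t y"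
  have G_eq: "G_op \<gamma> \<mu> (\<lambda>x. u x t) x = k * (\<integral>y. Re (?D x t y) \<partial>lborel)" if "x > 0" "t > 0" for x t
  proof -
    have "A 0 t y * (Complex 1 y * Complex \<mu> y) * exp (Complex (- \<gamma> - 1) (- \<gamma> * y) * of_real (ln x)) = ?D x t y" for y
    proof -
      have "Complex 0 y * of_real (\<nu> * ln t) = Complex 0 (\<nu> * y) * of_real (ln t)" by (simp add: complex_eq_iff)
      then show ?thesis unfolding A_def by (simp only: mult_ac)
    qed
    then show ?thesis unfolding G_val[OF that] mb_integral_def by (simp only:)
  qed
  show ?thesis
  proof (cases "\<nu> = 1")
    case True
    \<comment> \<open>At \<nu> = 1 the quotient cancels, because Gamma (1 + z) does not vanish here.
      The t-derivative then supplies the factor 1 + \<i>y itself.\<close>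
    have r1: "?r (Complex \<theta> y) = 1" if "\<theta> \<ge> 0" for \<theta> y
      using Gamma_nonzero_right_half[of "1 + Complex \<theta> y"] that by (simp add: inverse_stable_mellin_def True)
    have D: "((\<lambda>t. u x t) has_real_derivative k * (\<integral>y. Re (?D x t y) \<partial>lborel)) (at t)" if x: "x > 0" and t: "t > 0" for x t
    proof -
      have "eventually (\<lambda>t. t \<in> {0<..}) (nhds t)" using t by (intro eventually_nhds_in_open) auto
      then have "eventually (\<lambda>t. u x t = k * mb_integral (A' 1 x) \<nu> \<nu> t) (nhds t)"
        by (rule eventually_mono) (use uR x in auto)
      moreover have "((\<lambda>t. k * mb_integral (A' 1 x) \<nu> \<nu> t) has_real_derivative
          k * mb_integral (\<lambda>y. A' 1 x y * Complex \<nu> (\<nu> * y)) \<nu> (\<nu> - 1) t) (at t)"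
        by (intro DERIV_cmult mb_integral_has_derivative rapid_A' \<theta>1 t)
      moreover have "A' 1 x y * Complex \<nu> (\<nu> * y) * exp (Complex (\<nu> - 1) (\<nu> * y) * of_real (ln t)) = ?D x t y" for y
        unfolding A'_def B_def shift1 r1[OF zero_le_one] r1[OF order_refl] using True by simp
      ultimately show ?thesis
        unfolding mb_integral_def by (subst DERIV_cong_ev[OF refl _ refl]) auto
    qed
    show ?thesis
      unfolding solves_fractional_equation_def RL_applicable_def RL_deriv_def
    proof (intro conjI allI impI)
      fix x t :: real assume xt: "0 < x" "0 < t"
      show "(if \<nu> = 1 then deriv (u x) t else 1 / Gamma (1 - \<nu>) * deriv (RL_integral \<nu> (u x)) t) = G_op \<gamma> \<mu> (\<lambda>y. u y t) x"
        using DERIV_imp_deriv[OF D[OF xt]] G_eq[OF xt] True by simp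
    next
      fix x :: real assume x: "0 < x"
      show "if \<nu> = 1 then \<forall>t>0. u x differentiable at t else
          \<forall>t>0. set_integrable lborel {0<..<t} (\<lambda>s. (t - s) powr - \<nu> * u x s) \<and> RL_integral \<nu> (u x) differentiable at t"
        using D[OF x] True by (auto simp: differentiable_def has_field_derivative_def)
    qed (use G_app in auto)
  next
    case False
    then have \<nu>1: "\<nu> < 1" using \<nu> by simp
    define A2 where "A2 x y = A' 1 x y * (Gamma (1 + Complex \<nu> (\<nu> * y)) * Gamma (of_real (1 - \<nu>)) / Gamma (1 + Complex \<nu> (\<nu> * y) + of_real (1 - \<nu>)))" for x y
    have RL: "set_integrable lborel {0<..<t} (\<lambda>s. (t - s) powr (- \<nu>) * u x s)"
      "RL_integral \<nu> (u x) t = k * mb_integral (A2 x) \<nu> (\<nu> + (1 - \<nu>)) t" if x: "x > 0" and t: "t > 0" for x t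
      unfolding A2_def[abs_def]
      by (rule RL_integral_mb_integral[OF rapid_A'[OF \<theta>1] \<nu>(1) \<nu>1 _ t uR[OF x]]; use \<nu> in simp)+
    have rapid_A2: "rapid (A2 x)" for x
      unfolding A2_def[abs_def]
    proof (rule rapid_mult_bounded[OF rapid_A'[OF \<theta>1]])
      fix y
      let ?\<beta> = "\<lambda>s::real. if s < 1 then (1 - s) powr ((1 - \<nu>) - 1) else 0"
      \<comment> \<open>The factor produced by fractional integration is the Beta transform of a
        nonnegative function, hence bounded along the line by its value at the real point.\<close>
      have "Gamma (1 + Complex \<nu> (\<nu> * y)) * Gamma (of_real (1 - \<nu>)) / Gamma (1 + Complex \<nu> (\<nu> * y) + of_real (1 - \<nu>)) = mellin ?\<beta> (1 + Complex \<nu> (\<nu> * y))"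
        by (rule mellin_Beta[symmetric]) (use \<nu> \<nu>1 in auto)
      then show "cmod (Gamma (1 + Complex \<nu> (\<nu> * y)) * Gamma (of_real (1 - \<nu>)) / Gamma (1 + Complex \<nu> (\<nu> * y) + of_real (1 - \<nu>))) \<le> cmod (mellin ?\<beta> (of_real (1 + \<nu>)))"
        using norm_mellin_le[of ?\<beta> "1 + Complex \<nu> (\<nu> * y)"] by simp
    qed measurable
    have D: "(RL_integral \<nu> (u x) has_real_derivative Gamma (1 - \<nu>) * (k * (\<integral>y. Re (?D x t y) \<partial>lborel))) (at t)" if x: "x > 0" and t: "t > 0" for x t
    proof -
      have "eventually (\<lambda>t. t \<in> {0<..}) (nhds t)" using t by (intro eventually_nhds_in_open) auto
      then have "eventually (\<lambda>t. RL_integral \<nu> (u x) t = k * mb_integral (A2 x) \<nu> (\<nu> + (1 - \<nu>)) t) (nhds t)"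
        by (rule eventually_mono) (use RL(2)[OF x] in auto)
      moreover have "((\<lambda>t. k * mb_integral (A2 x) \<nu> (\<nu> + (1 - \<nu>)) t) has_real_derivative
          k * mb_integral (\<lambda>y. A2 x y * Complex (\<nu> + (1 - \<nu>)) (\<nu> * y)) \<nu> (\<nu> + (1 - \<nu>) - 1) t) (at t)"
        by (intro DERIV_cmult mb_integral_has_derivative rapid_A2 t)
      moreover have "mb_integral (\<lambda>y. A2 x y * Complex (\<nu> + (1 - \<nu>)) (\<nu> * y)) \<nu> (\<nu> + (1 - \<nu>) - 1) t
          = Gamma (1 - \<nu>) * (\<integral>y. Re (?D x t y) \<partial>lborel)"
      proof -
        have "A2 x y * Complex (\<nu> + (1 - \<nu>)) (\<nu> * y) * exp (Complex (\<nu> + (1 - \<nu>) - 1) (\<nu> * y) * of_real (ln t)) =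
            of_real (Gamma (1 - \<nu>)) * ?D x t y" for y
        proof -
          have w: "1 + Complex \<nu> (\<nu> * y) + of_real (1 - \<nu>) = Complex 1 (\<nu> * y) + 1" by (simp add: complex_eq_iff)
          have n1: "Gamma (1 + Complex \<nu> (\<nu> * y)) \<noteq> 0" by (rule Gamma_nonzero_right_half) (use \<nu> in simp)
          have n2: "Complex 1 (\<nu> * y) \<noteq> 0" by (simp add: complex_eq_iff)
          have n3: "Gamma (Complex 1 (\<nu> * y)) \<noteq> 0" by (rule Gamma_nonzero_right_half) simp
          have e1: "of_real \<nu> * Complex 1 y = Complex \<nu> (\<nu> * y)" "1 + of_real \<nu> * Complex 0 y = Complex 1 (\<nu> * y)"
            by (simp_all add: complex_eq_iff)
          have r: "?r (Complex 1 y) = Complex 1 y * Gamma (1 + Complex 0 y) / Gamma (1 + Complex \<nu> (\<nu> * y))"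
            "?r (Complex 0 y) = Gamma (1 + Complex 0 y) / Gamma (Complex 1 (\<nu> * y))"
            unfolding inverse_stable_mellin_def shift2 e1 by simp_all
          have c: "\<nu> + (1 - \<nu>) = 1" "\<nu> + (1 - \<nu>) - 1 = 0" "- \<gamma> * 1 - 1 = - \<gamma> - 1" by simp_all
          have G2: "Gamma (Complex 1 (\<nu> * y) + 1) = Complex 1 (\<nu> * y) * Gamma (Complex 1 (\<nu> * y))"
            by (rule Gamma_plus1_right_half) simp
          show ?thesis
            unfolding A2_def A'_def B_def w G2 r shift1 c Gamma_complex_of_real using n1 n2 n3 by (simp add: mult_ac)
        qed
        then have "mb_integral (\<lambda>y. A2 x y * Complex (\<nu> + (1 - \<nu>)) (\<nu> * y)) \<nu> (\<nu> + (1 - \<nu>) - 1) t =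
            (\<integral>y. Re (of_real (Gamma (1 - \<nu>)) * ?D x t y) \<partial>lborel)"
          unfolding mb_integral_def by (simp only:)
        also have "\<dots> = (\<integral>y. Gamma (1 - \<nu>) * Re (?D x t y) \<partial>lborel)"
          by (intro Bochner_Integration.integral_cong refl)
             (simp only: Re_complex_of_real Im_complex_of_real times_complex.sel(1)[of "of_real _"] mult_zero_left diff_zero)
        also have "\<dots> = Gamma (1 - \<nu>) * (\<integral>y. Re (?D x t y) \<partial>lborel)" by (rule integral_mult_right_zero)
        finally show ?thesis .
      qed
      ultimately show ?thesis
        by (subst DERIV_cong_ev[OF refl _ refl]) (auto simp only: mult.left_commute)
    qed
    have G\<nu>: "Gamma (1 - \<nu>) > 0" using \<nu>1 by (intro Gamma_real_pos) simp
    show ?thesis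
      unfolding solves_fractional_equation_def RL_applicable_def RL_deriv_def
    proof (intro conjI allI impI)
      fix x t :: real assume xt: "0 < x" "0 < t"
      show "(if \<nu> = 1 then deriv (u x) t else 1 / Gamma (1 - \<nu>) * deriv (RL_integral \<nu> (u x)) t) = G_op \<gamma> \<mu> (\<lambda>y. u y t) x"
        unfolding DERIV_imp_deriv[OF D[OF xt]] G_eq[OF xt] using False G\<nu> by simp
    next
      fix x :: real assume x: "0 < x"
      have "RL_integral \<nu> (u x) differentiable at t" if "t > 0" for t
        using D[OF x that] by (auto simp: differentiable_def has_field_derivative_def)
      then show "if \<nu> = 1 then \<forall>t>0. u x differentiable at t else
          \<forall>t>0. set_integrable lborel {0<..<t} (\<lambda>s. (t - s) powr - \<nu> * u x s) \<and> RL_integral \<nu> (u x) differentiable at t"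
        using RL(1)[OF x] False by simp
    qed (use G_app in auto)
  qed
qed

section \<open>Identification with the Fox H function\<close>

lemma of_real_powr_eq_exp: "r > 0 \<Longrightarrow> complex_of_real r powr w = exp (w * of_real (ln r))"
  by (simp add: powr_def Ln_of_real)

text \<open>The entry (\<mu>, 0) contributes the constant 1/Gamma \<mu>, and the power of the
  quotient x^\<gamma>/t^\<nu> splits into a power of t, part of
  \<open>inverse_stable_mellin\<close>, and one of x.\<close>

lemma mellin_barnes_eq_fox_H:
  assumes x: "x > 0" and t: "t > 0"
  shows "of_real (\<gamma> / (x * Gamma \<mu>)) * (complex_of_real (1 / (2 * pi)) *
        (\<integral>y. Gamma (of_real \<mu> + Complex \<theta> y) * inverse_stable_mellin \<nu> t (Complex \<theta> y) * exp (- Complex \<theta> y * of_real (\<gamma> * ln x)) \<partial>lborel))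
    = of_real (\<gamma> / x) * fox_H 2 0 [(1, \<nu>), (\<mu>, 0)] [(1, 1), (\<mu>, 1)] \<theta> (x powr \<gamma> / t powr \<nu>)"
proof -
  let ?z = "x powr \<gamma> / t powr \<nu>"
  have z: "?z > 0" "ln ?z = \<gamma> * ln x - \<nu> * ln t" using x t by (simp_all add: ln_div ln_powr)
  have "fox_kernel 2 0 [(1, \<nu>), (\<mu>, 0)] [(1, 1), (\<mu>, 1)] (Complex \<theta> y) * of_real ?z powr (- Complex \<theta> y) =
      of_real (1 / Gamma \<mu>) * (Gamma (of_real \<mu> + Complex \<theta> y) * inverse_stable_mellin \<nu> t (Complex \<theta> y) * exp (- Complex \<theta> y * of_real (\<gamma> * ln x)))" for y
  proof -
    have "complex_of_real ?z powr (- Complex \<theta> y) = exp (- Complex \<theta> y * of_real (ln ?z))"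
      by (rule of_real_powr_eq_exp[OF z(1)])
    also have "- Complex \<theta> y * of_real (ln ?z) = Complex \<theta> y * of_real (\<nu> * ln t) + - Complex \<theta> y * of_real (\<gamma> * ln x)"
      unfolding z(2) by (simp add: algebra_simps)
    finally have p: "complex_of_real ?z powr (- Complex \<theta> y) = exp (Complex \<theta> y * of_real (\<nu> * ln t)) * exp (- Complex \<theta> y * of_real (\<gamma> * ln x))"
      by (simp only: exp_add)
    have "fox_kernel 2 0 [(1, \<nu>), (\<mu>, 0)] [(1, 1), (\<mu>, 1)] (Complex \<theta> y) =
        of_real (1 / Gamma \<mu>) * (Gamma (of_real \<mu> + Complex \<theta> y) * Gamma (1 + Complex \<theta> y) / Gamma (1 + of_real \<nu> * Complex \<theta> y))"
      by (simp add: fox_kernel_def numeral_2_eq_2 Gamma_complex_of_real mult_ac)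
    then show ?thesis unfolding p inverse_stable_mellin_def by (simp add: mult_ac)
  qed
  then have "fox_H 2 0 [(1, \<nu>), (\<mu>, 0)] [(1, 1), (\<mu>, 1)] \<theta> ?z = 1 / (2 * of_real pi) *
      (\<integral>y. of_real (1 / Gamma \<mu>) * (Gamma (of_real \<mu> + Complex \<theta> y) * inverse_stable_mellin \<nu> t (Complex \<theta> y) * exp (- Complex \<theta> y * of_real (\<gamma> * ln x))) \<partial>lborel)"
    unfolding fox_H_def by (simp only:)
  also have "(\<integral>y. of_real (1 / Gamma \<mu>) * (Gamma (of_real \<mu> + Complex \<theta> y) * inverse_stable_mellin \<nu> t (Complex \<theta> y) * exp (- Complex \<theta> y * of_real (\<gamma> * ln x))) \<partial>lborel) =
      of_real (1 / Gamma \<mu>) * (\<integral>y. Gamma (of_real \<mu> + Complex \<theta> y) * inverse_stable_mellin \<nu> t (Complex \<theta> y) * exp (- Complex \<theta> y * of_real (\<gamma> * ln x)) \<partial>lborel)"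
    by (rule integral_mult_right_zero)
  finally show ?thesis by (simp add: mult_ac)
qed

text \<open>In logarithmic coordinates the kernel is a function of \<gamma> ln x - u alone; this
  makes the mixture over s = exp u a convolution.\<close>

lemma g_tilde_exp:
  assumes "\<gamma> > 0" "x > 0"
  shows "g_tilde \<gamma> \<mu> x (exp u) = \<gamma> / (x * Gamma \<mu>) * (exp (\<gamma> * ln x - u) powr \<mu> * exp (- exp (\<gamma> * ln x - u)))"
proof -
  have "x powr (\<gamma> * \<mu> - 1) = exp (\<gamma> * \<mu> * ln x) / x"
    using assms by (simp add: powr_def left_diff_distrib exp_diff)
  moreover have "(exp u powr (1 / \<gamma>)) powr (\<gamma> * \<mu>) = exp (u * \<mu>)" "(exp u powr (1 / \<gamma>)) powr \<gamma> = exp u"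
    using assms by (simp_all add: powr_def)
  moreover have "x powr \<gamma> = exp (\<gamma> * ln x)" using assms by (simp add: powr_def)
  moreover have "exp (\<gamma> * ln x - u) powr \<mu> = exp (\<gamma> * \<mu> * ln x) / exp (u * \<mu>)"
    by (simp add: powr_def algebra_simps flip: exp_diff)
  moreover have "exp (\<gamma> * ln x - u) = exp (\<gamma> * ln x) / exp u" by (rule exp_diff)
  ultimately show ?thesis
    unfolding g_tilde_def g_density_def by (simp only:) (simp add: mult_ac)
qed

section \<open>Iterated Bessel kernels\<close>

lemma Bessel_K_nonneg: "0 \<le> Bessel_K a x"
  unfolding Bessel_K_def set_lebesgue_integral_def
  by (intro integral_nonneg_AE AE_I2) (auto simp: indicator_def cosh_real_nonneg)

lemma borel_measurable_Bessel_K[measurable]: "Bessel_K a \<in> borel_measurable borel"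
  unfolding Bessel_K_def[abs_def] set_lebesgue_integral_def cosh_def by measurable

text \<open>Write the two Gamma functions as integrals in c and d and put d = c + 2w, c = u/2 - w.
  Then exp c + exp d = 2 exp (u/2) cosh w, the linear terms become p u + a w, and the Jacobians 2
  and 1/2 cancel.\<close>

lemma Gamma_Gamma_nn_integral:
  fixes a p :: real
  assumes "\<bar>a\<bar> / 2 < p"
  shows "(\<integral>\<^sup>+u. (\<integral>\<^sup>+w. ennreal (exp (p * u) * exp (a * w - 2 * exp (u / 2) * cosh w)) \<partial>lborel) \<partial>lborel) = ennreal (Gamma (p - a / 2) * Gamma (p + a / 2))"
proof -
  have pm: "p - a / 2 > 0" "p + a / 2 > 0" using assms by (auto simp: abs_if split: if_splits)
  let ?e = "\<lambda>q v. exp (q * v - exp v) :: real"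
  let ?H = "\<lambda>c w. ennreal (?e (p - a / 2) c * ?e (p + a / 2) (c + 2 * w))"
  have "ennreal (Gamma (p - a / 2) * Gamma (p + a / 2)) = (\<integral>\<^sup>+c. ennreal (?e (p - a / 2) c) * ennreal (Gamma (p + a / 2)) \<partial>lborel)"
    using pm by (subst nn_integral_multc) (simp_all add: nn_integral_Gamma_exp ennreal_mult Gamma_real_pos less_imp_le)
  also have "\<dots> = (\<integral>\<^sup>+c. ennreal 2 * (\<integral>\<^sup>+w. ?H c w \<partial>lborel) \<partial>lborel)"
  proof (intro nn_integral_cong)
    fix c :: real
    have "ennreal (Gamma (p + a / 2)) = ennreal \<bar>2\<bar> * (\<integral>\<^sup>+w. ennreal (?e (p + a / 2) (c + 2 * w)) \<partial>lborel)"
      unfolding nn_integral_Gamma_exp[OF pm(2), symmetric] by (rule nn_integral_real_affine) auto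
    then have "ennreal (?e (p - a / 2) c) * ennreal (Gamma (p + a / 2)) =
        ennreal 2 * (ennreal (?e (p - a / 2) c) * (\<integral>\<^sup>+w. ennreal (?e (p + a / 2) (c + 2 * w)) \<partial>lborel))"
      by (simp add: mult_ac)
    also have "ennreal (?e (p - a / 2) c) * (\<integral>\<^sup>+w. ennreal (?e (p + a / 2) (c + 2 * w)) \<partial>lborel) = (\<integral>\<^sup>+w. ?H c w \<partial>lborel)"
      by (subst nn_integral_cmult[symmetric]) (auto simp: ennreal_mult)
    finally show "ennreal (?e (p - a / 2) c) * ennreal (Gamma (p + a / 2)) = ennreal 2 * (\<integral>\<^sup>+w. ?H c w \<partial>lborel)" .
  qed
  also have "\<dots> = ennreal 2 * (\<integral>\<^sup>+c. (\<integral>\<^sup>+w. ?H c w \<partial>lborel) \<partial>lborel)"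
    by (rule nn_integral_cmult) measurable
  also have "(\<integral>\<^sup>+c. (\<integral>\<^sup>+w. ?H c w \<partial>lborel) \<partial>lborel) = (\<integral>\<^sup>+w. (\<integral>\<^sup>+c. ?H c w \<partial>lborel) \<partial>lborel)"
    by (rule lborel_pair.Fubini') measurable
  also have "ennreal 2 * \<dots> = (\<integral>\<^sup>+w. ennreal 2 * (\<integral>\<^sup>+c. ?H c w \<partial>lborel) \<partial>lborel)"
    by (rule nn_integral_cmult[symmetric]) measurable
  also have "\<dots> = (\<integral>\<^sup>+w. (\<integral>\<^sup>+u. ennreal (exp (p * u) * exp (a * w - 2 * exp (u / 2) * cosh w)) \<partial>lborel) \<partial>lborel)"
  proof (intro nn_integral_cong)
    fix w :: real
    have "(\<integral>\<^sup>+c. ?H c w \<partial>lborel) = ennreal \<bar>1/2\<bar> * (\<integral>\<^sup>+u. ?H (- w + 1/2 * u) w \<partial>lborel)"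
      by (rule nn_integral_real_affine) auto
    also have "(\<lambda>u. ?H (- w + 1/2 * u) w) = (\<lambda>u. ennreal (exp (p * u) * exp (a * w - 2 * exp (u / 2) * cosh w)))"
    proof
      fix u
      have "exp (- w + u / 2) + exp (w + u / 2) = 2 * exp (u / 2) * cosh w"
        by (simp add: cosh_def algebra_simps flip: exp_add)
      then have "((p - a / 2) * (- w + 1/2 * u) - exp (- w + 1/2 * u)) + ((p + a / 2) * (- w + 1/2 * u + 2 * w) - exp (- w + 1/2 * u + 2 * w)) =
          p * u + (a * w - 2 * exp (u / 2) * cosh w)"
        by (simp add: algebra_simps)
      then show "?H (- w + 1/2 * u) w = ennreal (exp (p * u) * exp (a * w - 2 * exp (u / 2) * cosh w))"
        by (simp only: exp_add[symmetric])
    qed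
    finally have "ennreal 2 * (\<integral>\<^sup>+c. ?H c w \<partial>lborel) =
        (ennreal 2 * ennreal \<bar>1/2\<bar>) * (\<integral>\<^sup>+u. ennreal (exp (p * u) * exp (a * w - 2 * exp (u / 2) * cosh w)) \<partial>lborel)"
      by (simp only: mult.assoc)
    also have "ennreal 2 * ennreal \<bar>1/2\<bar> = 1" by (subst ennreal_mult[symmetric]) auto
    finally show "ennreal 2 * (\<integral>\<^sup>+c. ?H c w \<partial>lborel) = (\<integral>\<^sup>+u. ennreal (exp (p * u) * exp (a * w - 2 * exp (u / 2) * cosh w)) \<partial>lborel)"
      by simp
  qed
  also have "\<dots> = (\<integral>\<^sup>+u. (\<integral>\<^sup>+w. ennreal (exp (p * u) * exp (a * w - 2 * exp (u / 2) * cosh w)) \<partial>lborel) \<partial>lborel)"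
    unfolding cosh_def by (rule lborel_pair.Fubini') measurable
  finally show ?thesis by simp
qed

text \<open>Against an even g only the even part of exp (a w) counts; this leads from the full line
  to the half-line in \<open>Bessel_K\<close>.\<close>

lemma nn_integral_symmetric_cosh:
  fixes g :: "real \<Rightarrow> real"
  assumes [measurable]: "g \<in> borel_measurable borel" and g0: "\<And>w. 0 \<le> g w" and even: "\<And>w. g (- w) = g w"
  shows "(\<integral>\<^sup>+w. ennreal (exp (a * w) * g w) \<partial>lborel) = ennreal 2 * (\<integral>\<^sup>+w. ennreal (cosh (a * w) * g w) * indicator {0<..} w \<partial>lborel)"
proof -
  let ?f = "\<lambda>w. ennreal (exp (a * w) * g w)"
  have "(\<integral>\<^sup>+w. ?f w \<partial>lborel) = (\<integral>\<^sup>+w. ?f w * indicator {0<..} w + ?f w * indicator {..<0} w \<partial>lborel)"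
  proof (rule nn_integral_cong_AE)
    have "AE w in lborel. w \<noteq> (0::real)" by (rule AE_lborel_singleton)
    then show "AE w in lborel. ?f w = ?f w * indicator {0<..} w + ?f w * indicator {..<0} w"
      by eventually_elim (auto simp: indicator_def)
  qed
  also have "\<dots> = (\<integral>\<^sup>+w. ?f w * indicator {0<..} w \<partial>lborel) + (\<integral>\<^sup>+w. ?f w * indicator {..<0} w \<partial>lborel)"
    by (rule nn_integral_add) measurable
  also have "(\<integral>\<^sup>+w. ?f w * indicator {..<0} w \<partial>lborel) = ennreal \<bar>-1\<bar> * (\<integral>\<^sup>+w. ?f (0 + -1 * w) * indicator {..<0} (0 + -1 * w) \<partial>lborel)"
    by (rule nn_integral_real_affine) auto
  also have "\<dots> = (\<integral>\<^sup>+w. ennreal (exp (- a * w) * g w) * indicator {0<..} w \<partial>lborel)"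
    by (simp add: even, intro nn_integral_cong) (simp add: indicator_def)
  also have "(\<integral>\<^sup>+w. ?f w * indicator {0<..} w \<partial>lborel) + (\<integral>\<^sup>+w. ennreal (exp (- a * w) * g w) * indicator {0<..} w \<partial>lborel) =
      (\<integral>\<^sup>+w. ?f w * indicator {0<..} w + ennreal (exp (- a * w) * g w) * indicator {0<..} w \<partial>lborel)"
    by (rule nn_integral_add[symmetric]) measurable
  also have "\<dots> = (\<integral>\<^sup>+w. ennreal 2 * (ennreal (cosh (a * w) * g w) * indicator {0<..} w) \<partial>lborel)"
  proof (intro nn_integral_cong)
    fix w
    have "exp (a * w) * g w + exp (- a * w) * g w = 2 * (cosh (a * w) * g w)"
      by (simp add: cosh_def algebra_simps)
    moreover have "ennreal (exp (a * w) * g w) + ennreal (exp (- a * w) * g w) = ennreal (exp (a * w) * g w + exp (- a * w) * g w)"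
      using g0[of w] by (intro ennreal_plus[symmetric]) auto
    moreover have "ennreal (2 * (cosh (a * w) * g w)) = ennreal 2 * ennreal (cosh (a * w) * g w)"
      using g0[of w] by (intro ennreal_mult) (auto simp: cosh_real_nonneg)
    ultimately have "ennreal (exp (a * w) * g w) + ennreal (exp (- a * w) * g w) = ennreal 2 * ennreal (cosh (a * w) * g w)"
      by (simp only:)
    then show "?f w * indicator {0<..} w + ennreal (exp (- a * w) * g w) * indicator {0<..} w = ennreal 2 * (ennreal (cosh (a * w) * g w) * indicator {0<..} w)"
      by (simp add: indicator_def)
  qed
  also have "\<dots> = ennreal 2 * (\<integral>\<^sup>+w. ennreal (cosh (a * w) * g w) * indicator {0<..} w \<partial>lborel)"
    unfolding cosh_def by (rule nn_integral_cmult) measurable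
  finally show ?thesis .
qed

text \<open>\<open>B\<close> is the defining integral of \<open>Bessel_K\<close> with values in
  \<open>ennreal\<close>; for it the claim is the product formula for two Gamma functions. The
  remaining work is to return to the real-valued integral.\<close>

lemma Bessel_K_mellin:
  fixes a p :: real
  assumes "\<bar>a\<bar> / 2 < p"
  shows "(\<integral>\<^sup>+u. ennreal (Bessel_K a (2 * exp (u / 2)) * exp (p * u)) \<partial>lborel) = ennreal (Gamma (p - a / 2) * Gamma (p + a / 2) / 2)"
proof -
  define B where "B x = (\<integral>\<^sup>+w. ennreal (cosh (a * w) * exp (- x * cosh w)) * indicator {0<..} w \<partial>lborel)" for x :: real
  have [measurable]: "B \<in> borel_measurable borel" unfolding B_def[abs_def] cosh_def by measurable
  let ?G = "Gamma (p - a / 2) * Gamma (p + a / 2)"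
  have "p - a / 2 > 0" "p + a / 2 > 0" using assms by (auto simp: abs_if split: if_splits)
  then have G0: "?G \<ge> 0" by (intro mult_nonneg_nonneg less_imp_le[OF Gamma_real_pos])
  have "ennreal ?G = (\<integral>\<^sup>+u. (\<integral>\<^sup>+w. ennreal (exp (p * u) * exp (a * w - 2 * exp (u / 2) * cosh w)) \<partial>lborel) \<partial>lborel)"
    by (rule Gamma_Gamma_nn_integral[OF assms, symmetric])
  also have "\<dots> = (\<integral>\<^sup>+u. ennreal (exp (p * u)) * (ennreal 2 * B (2 * exp (u / 2))) \<partial>lborel)"
  proof (rule nn_integral_cong)
    fix u :: real
    have "(\<integral>\<^sup>+w. ennreal (exp (p * u) * exp (a * w - 2 * exp (u / 2) * cosh w)) \<partial>lborel) =
        (\<integral>\<^sup>+w. ennreal (exp (p * u)) * ennreal (exp (a * w) * exp (- (2 * exp (u / 2)) * cosh w)) \<partial>lborel)"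
    proof (rule nn_integral_cong)
      fix w
      have "a * w - 2 * exp (u / 2) * cosh w = a * w + - (2 * exp (u / 2)) * cosh w" by simp
      then have "exp (a * w - 2 * exp (u / 2) * cosh w) = exp (a * w) * exp (- (2 * exp (u / 2)) * cosh w)"
        by (simp only: exp_add)
      then show "ennreal (exp (p * u) * exp (a * w - 2 * exp (u / 2) * cosh w)) =
          ennreal (exp (p * u)) * ennreal (exp (a * w) * exp (- (2 * exp (u / 2)) * cosh w))"
        by (simp only: ennreal_mult exp_ge_zero mult_nonneg_nonneg)
    qed
    also have "\<dots> = ennreal (exp (p * u)) * (\<integral>\<^sup>+w. ennreal (exp (a * w) * exp (- (2 * exp (u / 2)) * cosh w)) \<partial>lborel)"
      unfolding cosh_def by (rule nn_integral_cmult) measurable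
    also have "(\<integral>\<^sup>+w. ennreal (exp (a * w) * exp (- (2 * exp (u / 2)) * cosh w)) \<partial>lborel) = ennreal 2 * B (2 * exp (u / 2))"
      unfolding B_def by (rule nn_integral_symmetric_cosh) (simp_all add: cosh_def)
    finally show "(\<integral>\<^sup>+w. ennreal (exp (p * u) * exp (a * w - 2 * exp (u / 2) * cosh w)) \<partial>lborel) =
        ennreal (exp (p * u)) * (ennreal 2 * B (2 * exp (u / 2)))" .
  qed
  also have "\<dots> = ennreal 2 * (\<integral>\<^sup>+u. ennreal (exp (p * u)) * B (2 * exp (u / 2)) \<partial>lborel)"
    by (subst nn_integral_cmult[symmetric]) (auto simp: mult_ac)
  finally have eq: "ennreal ?G = ennreal 2 * (\<integral>\<^sup>+u. ennreal (exp (p * u)) * B (2 * exp (u / 2)) \<partial>lborel)" .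
  have "(\<integral>\<^sup>+u. ennreal (exp (p * u)) * B (2 * exp (u / 2)) \<partial>lborel) = (ennreal (1/2) * ennreal 2) * (\<integral>\<^sup>+u. ennreal (exp (p * u)) * B (2 * exp (u / 2)) \<partial>lborel)"
  proof -
    have "ennreal (1/2) * ennreal 2 = 1" by (subst ennreal_mult[symmetric]) auto
    then show ?thesis by (simp only: mult_1_left)
  qed
  also have "\<dots> = ennreal (1/2) * ennreal ?G" unfolding eq by (simp only: mult.assoc)
  also have "\<dots> = ennreal (?G / 2)" using G0 by (subst ennreal_mult[symmetric]) auto
  finally have val: "(\<integral>\<^sup>+u. ennreal (exp (p * u)) * B (2 * exp (u / 2)) \<partial>lborel) = ennreal (?G / 2)" .
  \<comment> \<open>Finiteness of the outer integral makes \<open>B\<close> finite for almost every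
    u, and there it agrees with \<open>Bessel_K\<close>. This suffices under the outer integral, so
    convergence at individual arguments needs no estimate.\<close>
  then have "AE u in lborel. ennreal (exp (p * u)) * B (2 * exp (u / 2)) \<noteq> \<infinity>"
    by (intro nn_integral_noteq_infinite) auto
  then have "AE u in lborel. ennreal (Bessel_K a (2 * exp (u / 2)) * exp (p * u)) = ennreal (exp (p * u)) * B (2 * exp (u / 2))"
  proof eventually_elim
    case (elim u)
    let ?x = "2 * exp (u / 2)"
    have "B ?x \<noteq> \<infinity>"
    proof
      assume "B ?x = \<infinity>"
      with elim show False by (simp add: ennreal_mult_top)
    qed
    moreover have "(\<lambda>w. indicator {0<..} w * (exp (- ?x * cosh w) * cosh (a * w))) \<in> borel_measurable lborel"
      unfolding cosh_def by measurable
    then have "Bessel_K a ?x = enn2real (\<integral>\<^sup>+w. ennreal (indicator {0<..} w * (exp (- ?x * cosh w) * cosh (a * w))) \<partial>lborel)"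
      unfolding Bessel_K_def set_lebesgue_integral_def real_scaleR_def
      by (rule integral_eq_nn_integral) (simp add: indicator_def cosh_real_nonneg)
    moreover have "(\<integral>\<^sup>+w. ennreal (indicator {0<..} w * (exp (- ?x * cosh w) * cosh (a * w))) \<partial>lborel) = B ?x"
      unfolding B_def by (intro nn_integral_cong) (simp add: indicator_def mult.commute)
    ultimately have "ennreal (Bessel_K a ?x) = B ?x" by (simp add: less_top)
    then show ?case by (simp add: ennreal_mult Bessel_K_nonneg mult.commute)
  qed
  then have "(\<integral>\<^sup>+u. ennreal (Bessel_K a (2 * exp (u / 2)) * exp (p * u)) \<partial>lborel) = (\<integral>\<^sup>+u. ennreal (exp (p * u)) * B (2 * exp (u / 2)) \<partial>lborel)"
    by (rule nn_integral_cong_AE)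
  then show ?thesis by (simp only: val)
qed

text \<open>The parameter \<open>q\<close> is the exponent in \<open>\<integral> Q_kernel \<nu> s r * s powr (q - 1) ds = Q_moment \<nu> q * r powr q\<close>;
  iterating shifts it by one at each step, which produces the factors of the multiplication formula.\<close>

definition Q_moment :: "real \<Rightarrow> real \<Rightarrow> real" where
  "Q_moment \<nu> q = \<nu> / 2 * (Gamma (\<nu> * q - (1 - \<nu>) / 4) * Gamma (\<nu> * q + (1 - \<nu>) / 4))"

lemma Q_kernel_nonneg: "0 \<le> Q_kernel \<nu> x t"
  by (simp add: Q_kernel_def Bessel_K_nonneg)

lemma Q_moment_nonneg:
  assumes "0 < \<nu>" "\<nu> < 1" "(1 - \<nu>) / 4 < \<nu> * q"
  shows "0 \<le> Q_moment \<nu> q"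
proof -
  have a: "0 < \<nu> * q - (1 - \<nu>) / 4" using assms(3) by simp
  have d: "0 < (1 - \<nu>) / 4" using assms(2) by simp
  have b: "0 < \<nu> * q + (1 - \<nu>) / 4" by (rule add_pos_pos[OF less_trans[OF d assms(3)] d])
  have "0 \<le> \<nu> / 2" using assms(1) by simp
  then show ?thesis unfolding Q_moment_def
    by (rule mult_nonneg_nonneg) (intro mult_nonneg_nonneg less_imp_le[OF Gamma_real_pos] a b)
qed

text \<open>The substitution s = r exp (\<nu> v) turns the argument of the Bessel function into 2
  exp (v/2); hence the factors \<nu> and r powr q, and \<nu> q as the exponent of the Bessel
  transform.\<close>

lemma Q_kernel_mellin:
  assumes \<nu>: "0 < \<nu>" "\<nu> < 1" and q: "(1 - \<nu>) / 4 < \<nu> * q" and r: "r > 0"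
  shows "(\<integral>\<^sup>+u. ennreal (Q_kernel \<nu> (exp u) r * exp (q * u)) \<partial>lborel) = ennreal (Q_moment \<nu> q * r powr q)"
proof -
  let ?a = "(1 - \<nu>) / 2"
  have "(\<integral>\<^sup>+u. ennreal (Q_kernel \<nu> (exp u) r * exp (q * u)) \<partial>lborel) =
      ennreal \<bar>\<nu>\<bar> * (\<integral>\<^sup>+v. ennreal (Q_kernel \<nu> (exp (ln r + \<nu> * v)) r * exp (q * (ln r + \<nu> * v))) \<partial>lborel)"
    by (rule nn_integral_real_affine) (use \<nu> in \<open>auto simp: Q_kernel_def\<close>)
  also have "(\<lambda>v. ennreal (Q_kernel \<nu> (exp (ln r + \<nu> * v)) r * exp (q * (ln r + \<nu> * v)))) =
      (\<lambda>v. ennreal (r powr q) * ennreal (Bessel_K ?a (2 * exp (v / 2)) * exp ((\<nu> * q) * v)))"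
  proof
    fix v
    have "exp (ln r + \<nu> * v) / r = exp (\<nu> * v)" using r by (simp add: exp_add)
    then have "(exp (ln r + \<nu> * v) / r) powr (1 / \<nu>) = exp v" using \<nu> by (simp add: powr_def)
    moreover have "sqrt (exp v) = exp (v / 2)"
      by (rule real_sqrt_unique) (simp_all add: power2_eq_square flip: exp_add)
    ultimately have "Q_kernel \<nu> (exp (ln r + \<nu> * v)) r = Bessel_K ?a (2 * exp (v / 2))" by (simp add: Q_kernel_def)
    moreover have "exp (q * (ln r + \<nu> * v)) = r powr q * exp ((\<nu> * q) * v)"
      using r by (simp add: powr_def distrib_left exp_add mult_ac)
    ultimately have "Q_kernel \<nu> (exp (ln r + \<nu> * v)) r * exp (q * (ln r + \<nu> * v)) = r powr q * (Bessel_K ?a (2 * exp (v / 2)) * exp ((\<nu> * q) * v))"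
      by simp
    then show "ennreal (Q_kernel \<nu> (exp (ln r + \<nu> * v)) r * exp (q * (ln r + \<nu> * v))) =
        ennreal (r powr q) * ennreal (Bessel_K ?a (2 * exp (v / 2)) * exp ((\<nu> * q) * v))"
      by (simp add: ennreal_mult Bessel_K_nonneg)
  qed
  also have "(\<integral>\<^sup>+v. ennreal (r powr q) * ennreal (Bessel_K ?a (2 * exp (v / 2)) * exp ((\<nu> * q) * v)) \<partial>lborel) =
      ennreal (r powr q) * ennreal (Gamma (\<nu> * q - ?a / 2) * Gamma (\<nu> * q + ?a / 2) / 2)"
    using \<nu> q by (subst nn_integral_cmult) (auto simp: Bessel_K_mellin)
  also have "ennreal \<bar>\<nu>\<bar> * \<dots> = ennreal (\<nu> * (r powr q * (Gamma (\<nu> * q - ?a / 2) * Gamma (\<nu> * q + ?a / 2) / 2)))"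
  proof -
    have "0 \<le> Gamma (\<nu> * q - ?a / 2) * Gamma (\<nu> * q + ?a / 2) / 2"
      using Q_moment_nonneg[OF \<nu> q] \<nu> by (simp add: Q_moment_def zero_le_mult_iff)
    then show ?thesis using \<nu> by (simp only: ennreal_mult powr_ge_zero mult_nonneg_nonneg less_imp_le abs_of_pos)
  qed
  also have "\<nu> * (r powr q * (Gamma (\<nu> * q - ?a / 2) * Gamma (\<nu> * q + ?a / 2) / 2)) = Q_moment \<nu> q * r powr q"
    by (simp add: Q_moment_def)
  finally show ?thesis .
qed

lemma borel_measurable_Q_kernel_pair:
  "(\<lambda>(s, s'). Q_kernel \<nu> s s') \<in> borel_measurable (borel \<Otimes>\<^sub>M borel)"
  unfolding Q_kernel_def by measurable

text \<open>Integrating out s first leaves a multiple of s'^q, and ds' = s' dv in logarithmic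
  coordinates adds one power, so the inner iterate is met at q + 1. Measurability and sign are part
  of the induction because Tonelli requires them for the inner iterate.\<close>

lemma iterated_Q_mellin:
  assumes \<nu>: "0 < \<nu>" "\<nu> < 1" and r: "r > 0"
  shows "(\<lambda>s. iterated_Q k \<nu> s r) \<in> borel_measurable borel"
    and "0 \<le> iterated_Q k \<nu> s r"
    and "(1 - \<nu>) / 4 < \<nu> * q \<Longrightarrow>
      (\<integral>\<^sup>+u. ennreal (iterated_Q k \<nu> (exp u) r * exp (q * u)) \<partial>lborel) = ennreal ((\<Prod>j\<le>k. Q_moment \<nu> (q + real j)) * r powr (q + real k))"
proof (induction k arbitrary: s q)
  case 0
  { case 1 show ?case by (simp add: Q_kernel_def) }
  { case 2 show ?case by (simp add: Q_kernel_nonneg) }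
  { case 3 then show ?case using Q_kernel_mellin[OF \<nu> _ r] by simp }
next
  case (Suc k)
  let ?I = "\<lambda>s. iterated_Q k \<nu> s r"
  have I[measurable]: "?I \<in> borel_measurable borel" by (rule Suc.IH(1))
  have I0: "0 \<le> ?I s" for s by (rule Suc.IH(2))
  have Q[measurable]: "(\<lambda>(s, s'). Q_kernel \<nu> s s') \<in> borel_measurable (borel \<Otimes>\<^sub>M borel)"
    by (rule borel_measurable_Q_kernel_pair)
  have [measurable]: "(\<lambda>s'. Q_kernel \<nu> s s') \<in> borel_measurable borel" for s
    unfolding Q_kernel_def by measurable
  { case 1
    have "(\<lambda>s. \<integral>s'. indicator {0<..} s' *\<^sub>R (Q_kernel \<nu> s s' * ?I s') \<partial>lborel) \<in> borel_measurable borel"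
      unfolding Q_kernel_def by measurable
    then show ?case by (simp add: set_lebesgue_integral_def) }
  { case 2 show ?case
      by (simp add: set_lebesgue_integral_def) (intro integral_nonneg_AE AE_I2, simp add: indicator_def Q_kernel_nonneg I0) }
  { case (3 q)
    note q = 3
    have q1: "(1 - \<nu>) / 4 < \<nu> * (q + 1)" using q \<nu> by (simp add: distrib_left)
    let ?J = "\<lambda>u v. ennreal (Q_kernel \<nu> (exp u) (exp v) * ?I (exp v)) * ennreal (exp v)"
    let ?V = "(\<Prod>j\<le>Suc k. Q_moment \<nu> (q + real j)) * r powr (q + real (Suc k))"
    have "(\<integral>\<^sup>+u. ennreal (exp (q * u)) * (\<integral>\<^sup>+v. ?J u v \<partial>lborel) \<partial>lborel) =
        (\<integral>\<^sup>+u. (\<integral>\<^sup>+v. ennreal (exp (q * u)) * ?J u v \<partial>lborel) \<partial>lborel)"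
      by (intro nn_integral_cong nn_integral_cmult[symmetric]) measurable
    also have "\<dots> = (\<integral>\<^sup>+v. (\<integral>\<^sup>+u. ennreal (exp (q * u)) * ?J u v \<partial>lborel) \<partial>lborel)"
      unfolding Q_kernel_def by (rule lborel_pair.Fubini') measurable
    also have "\<dots> = (\<integral>\<^sup>+v. ennreal (Q_moment \<nu> q) * ennreal (?I (exp v) * exp ((q + 1) * v)) \<partial>lborel)"
    proof (intro nn_integral_cong)
      fix v :: real
      have "(\<integral>\<^sup>+u. ennreal (exp (q * u)) * ?J u v \<partial>lborel) =
          (\<integral>\<^sup>+u. ennreal (?I (exp v) * exp v) * ennreal (Q_kernel \<nu> (exp u) (exp v) * exp (q * u)) \<partial>lborel)"
        by (intro nn_integral_cong) (simp add: ennreal_mult Q_kernel_nonneg I0 mult_ac)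
      also have "\<dots> = ennreal (?I (exp v) * exp v) * (\<integral>\<^sup>+u. ennreal (Q_kernel \<nu> (exp u) (exp v) * exp (q * u)) \<partial>lborel)"
        unfolding Q_kernel_def by (rule nn_integral_cmult) measurable
      also have "(\<integral>\<^sup>+u. ennreal (Q_kernel \<nu> (exp u) (exp v) * exp (q * u)) \<partial>lborel) = ennreal (Q_moment \<nu> q * exp v powr q)"
        by (rule Q_kernel_mellin[OF \<nu> q]) simp
      also have "ennreal (?I (exp v) * exp v) * ennreal (Q_moment \<nu> q * exp v powr q) = ennreal (Q_moment \<nu> q) * ennreal (?I (exp v) * exp ((q + 1) * v))"
      proof -
        have "(?I (exp v) * exp v) * (Q_moment \<nu> q * exp v powr q) = Q_moment \<nu> q * (?I (exp v) * exp ((q + 1) * v))"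
          by (simp add: powr_def algebra_simps flip: exp_add)
        moreover have "0 \<le> Q_moment \<nu> q" by (rule Q_moment_nonneg[OF \<nu> q])
        ultimately show ?thesis by (simp add: I0 flip: ennreal_mult)
      qed
      finally show "(\<integral>\<^sup>+u. ennreal (exp (q * u)) * ?J u v \<partial>lborel) = ennreal (Q_moment \<nu> q) * ennreal (?I (exp v) * exp ((q + 1) * v))" .
    qed
    also have "\<dots> = ennreal (Q_moment \<nu> q) * ennreal ((\<Prod>j\<le>k. Q_moment \<nu> (q + 1 + real j)) * r powr (q + 1 + real k))"
      by (subst nn_integral_cmult) (auto simp: Suc.IH(3)[OF q1])
    also have "\<dots> = ennreal ?V"
    proof -
      have "(\<Prod>j\<le>Suc k. Q_moment \<nu> (q + real j)) = Q_moment \<nu> q * (\<Prod>j\<le>k. Q_moment \<nu> (q + 1 + real j))"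
        by (subst prod.atMost_Suc_shift) (simp add: add_ac)
      moreover have "0 \<le> (\<Prod>j\<le>k. Q_moment \<nu> (q + 1 + real j))"
      proof (intro prod_nonneg ballI Q_moment_nonneg \<nu>)
        fix j
        have "\<nu> * (q + 1) \<le> \<nu> * (q + 1 + real j)" using \<nu> by (intro mult_left_mono) auto
        then show "(1 - \<nu>) / 4 < \<nu> * (q + 1 + real j)" using q1 by linarith
      qed
      ultimately show ?thesis by (simp add: Q_moment_nonneg[OF \<nu> q] add_ac mult.assoc flip: ennreal_mult)
    qed
    finally have val: "(\<integral>\<^sup>+u. ennreal (exp (q * u)) * (\<integral>\<^sup>+v. ?J u v \<partial>lborel) \<partial>lborel) = ennreal ?V" .
    have "(\<lambda>u. ennreal (exp (q * u)) * (\<integral>\<^sup>+v. ?J u v \<partial>lborel)) \<in> borel_measurable lborel"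
      unfolding Q_kernel_def by measurable
    \<comment> \<open>As for the Bessel function: a finite double integral makes the inner integral
      finite almost everywhere, and only there is it identified with the real-valued
      iterate.\<close>
    then have "AE u in lborel. ennreal (exp (q * u)) * (\<integral>\<^sup>+v. ?J u v \<partial>lborel) \<noteq> \<infinity>"
      by (rule nn_integral_noteq_infinite) (simp add: val)
    then have "AE u in lborel. ennreal (iterated_Q (Suc k) \<nu> (exp u) r * exp (q * u)) = ennreal (exp (q * u)) * (\<integral>\<^sup>+v. ?J u v \<partial>lborel)"
    proof eventually_elim
      case (elim u)
      then have fin: "(\<integral>\<^sup>+v. ?J u v \<partial>lborel) \<noteq> \<infinity>"
        by (auto simp: ennreal_mult_top)
      have "iterated_Q (Suc k) \<nu> (exp u) r = enn2real (\<integral>\<^sup>+s'. ennreal (indicator {0<..} s' *\<^sub>R (Q_kernel \<nu> (exp u) s' * ?I s')) \<partial>lborel)"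
        unfolding iterated_Q.simps set_lebesgue_integral_def
        by (rule integral_eq_nn_integral) (measurable, simp add: indicator_def Q_kernel_nonneg I0)
      also have "(\<integral>\<^sup>+s'. ennreal (indicator {0<..} s' *\<^sub>R (Q_kernel \<nu> (exp u) s' * ?I s')) \<partial>lborel) =
          (\<integral>\<^sup>+s'. ennreal (Q_kernel \<nu> (exp u) s' * ?I s') * indicator {0<..} s' \<partial>lborel)"
        by (intro nn_integral_cong) (simp add: indicator_def)
      also have "\<dots> = (\<integral>\<^sup>+v. ?J u v \<partial>lborel)"
        by (rule nn_integral_exp_substitution) measurable
      finally have "ennreal (iterated_Q (Suc k) \<nu> (exp u) r) = (\<integral>\<^sup>+v. ?J u v \<partial>lborel)"
        using fin by (simp add: less_top)
      moreover have "0 \<le> iterated_Q (Suc k) \<nu> (exp u) r"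
        by (simp add: set_lebesgue_integral_def) (intro integral_nonneg_AE AE_I2, simp add: indicator_def Q_kernel_nonneg I0)
      ultimately show ?case by (simp only: ennreal_mult exp_ge_zero mult.commute)
    qed
    then have "(\<integral>\<^sup>+u. ennreal (iterated_Q (Suc k) \<nu> (exp u) r * exp (q * u)) \<partial>lborel) = (\<integral>\<^sup>+u. ennreal (exp (q * u)) * (\<integral>\<^sup>+v. ?J u v \<partial>lborel) \<partial>lborel)"
      by (rule nn_integral_cong_AE)
    then show ?case by (simp only: val) }
qed

section \<open>The main result\<close>

text \<open>F enters through its real moments only and is absent from the right-hand side. Two
  mixing functions with the same moments therefore give the same mixture; this is how the Bessel
  representation is identified with u.\<close>

lemma mixture_mellin_barnes:
  fixes F :: "real \<Rightarrow> real"
  assumes \<nu>: "0 < \<nu>" "\<nu> < 1" and t: "t > 0" and \<theta>: "\<theta> > - \<mu>" "\<theta> > a" and a: "- 1 \<le> a"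
    and F[measurable]: "F \<in> borel_measurable borel" and F0: "\<And>s. s > 0 \<Longrightarrow> 0 \<le> F s"
    and M: "\<And>p. a < p \<Longrightarrow> (\<integral>\<^sup>+u. ennreal (F (exp u) * exp (p * u)) \<partial>lborel)
      = ennreal (t powr (\<nu> * p) * (Gamma (1 + p) / Gamma (1 + \<nu> * p)))"
  shows "complex_of_real (\<integral>u. exp (c - u) powr \<mu> * exp (- exp (c - u)) * F (exp u) \<partial>lborel) = complex_of_real (1 / (2 * pi)) *
        (\<integral>y. Gamma (of_real \<mu> + Complex \<theta> y) * inverse_stable_mellin \<nu> t (Complex \<theta> y) * exp (- Complex \<theta> y * of_real c) \<partial>lborel)"
proof -
  have m: "mellin F (Complex \<theta> y) = inverse_stable_mellin \<nu> t (Complex \<theta> y)" for y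
    by (rule mellin_inverse_stable[OF F F0 a _ \<nu> t M]) (use \<theta> in auto)
  have "integrable lborel (\<lambda>u. complex_of_real (F (exp u)) * exp (of_real \<theta> * complex_of_real u))"
    by (rule mellin_inverse_stable_integrable[OF F F0 a _ \<nu> t M]) (use \<theta> in auto)
  from gamma_mixture_mellin_barnes[OF \<theta>(1) F this, of c] show ?thesis
    unfolding m .
qed

lemma marginal_density_eq_profile:
  assumes S: "stable_subordinator M \<nu> \<tau>" and D: "marginal_density M \<tau> h" and \<nu>: "0 < \<nu>" "\<nu> < 1"
    and s: "s > 0" and y: "y > 0"
  shows "h s y = stable_profile \<nu> (ln y / \<nu> - ln s) / s"
proof -
  have dist: "distributed M lborel (\<tau> y) (\<lambda>s. ennreal (h s y))" and h0: "\<And>s. 0 \<le> h s y"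
    and cont: "continuous_on {0<..} (\<lambda>s. h s y)"
    using D y by (auto simp: marginal_density_def)
  have meas: "(\<lambda>s. h s y) \<in> borel_measurable borel"
    using distributed_real_measurable[OF _ dist] h0 by simp
  have "exp (ln s) * h (exp (ln s)) y = stable_profile \<nu> (ln y / \<nu> - ln s)"
    by (rule stable_density_eq_profile[OF meas h0 cont stable_density_laplace[OF S D y] y \<nu>])
  then show ?thesis using s by (simp add: field_simps)
qed

lemma profile_mixture:
  fixes \<nu> t :: real
  assumes S: "stable_subordinator M \<nu> \<tau>" and D: "marginal_density M \<tau> h" and \<nu>: "0 < \<nu>" "\<nu> < 1"
  defines "F \<equiv> \<lambda>t s. stable_profile \<nu> (ln s / \<nu> - ln t) / \<nu>"
  shows "F t \<in> borel_measurable borel" and "0 \<le> F t s"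
    and "t > 0 \<Longrightarrow> p > - 1 \<Longrightarrow> (\<integral>\<^sup>+u. ennreal (F t (exp u) * exp (p * u)) \<partial>lborel)
      = ennreal (t powr (\<nu> * p) * (Gamma (1 + p) / Gamma (1 + \<nu> * p)))"
proof -
  have dist: "distributed M lborel (\<tau> 1) (\<lambda>s. ennreal (h s 1))" and h0: "\<And>s. 0 \<le> h s 1"
    and cont: "continuous_on {0<..} (\<lambda>s. h s 1)"
    using D by (auto simp: marginal_density_def)
  have meas: "(\<lambda>s. h s 1) \<in> borel_measurable borel"
    using distributed_real_measurable[OF _ dist] h0 by simp
  have L: "(\<integral>\<^sup>+s. ennreal (h s 1 * exp (- c * s)) * indicator {0<..} s \<partial>lborel) = ennreal (exp (- (c powr \<nu>)))" if "c > 0" for c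
    using stable_density_laplace[OF S D, of 1 c] that by simp
  have "continuous_on UNIV (stable_profile \<nu>)"
    using stable_profile_derivative[OF \<nu>] by (metis DERIV_isCont continuous_at_imp_continuous_on)
  then have [measurable]: "stable_profile \<nu> \<in> borel_measurable borel" by (rule borel_measurable_continuous_onI)
  show "F t \<in> borel_measurable borel" unfolding F_def by measurable
  \<comment> \<open>The sign of the profile cannot be read off its oscillating integral; it is
    inherited from the density at time 1.\<close>
  have "stable_profile \<nu> v = exp (- v) * h (exp (- v)) 1" for v
    using marginal_density_eq_profile[OF S D \<nu>, of "exp (- v)" 1] by simp
  then show "0 \<le> F t s" unfolding F_def using h0 \<nu> by simp
  show "(\<integral>\<^sup>+u. ennreal (F t (exp u) * exp (p * u)) \<partial>lborel) = ennreal (t powr (\<nu> * p) * (Gamma (1 + p) / Gamma (1 + \<nu> * p)))"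
    if "t > 0" "p > - 1"
    using stable_profile_mellin[OF meas h0 cont L \<nu> that] by (simp add: F_def)
qed

lemma u_tilde_eq_mixture:
  assumes S: "stable_subordinator M \<nu> \<tau>" and D: "marginal_density M \<tau> h" and \<nu>: "0 < \<nu>" "\<nu> < 1"
    and \<gamma>: "\<gamma> > 0" and x: "x > 0" and t: "t > 0"
  shows "u_tilde \<gamma> \<mu> \<nu> h x t = \<gamma> / (x * Gamma \<mu>) * (\<integral>u. exp (\<gamma> * ln x - u) powr \<mu> * exp (- exp (\<gamma> * ln x - u)) *
    (stable_profile \<nu> (ln (exp u) / \<nu> - ln t) / \<nu>) \<partial>lborel)"
proof -
  let ?F = "\<lambda>s. stable_profile \<nu> (ln s / \<nu> - ln t) / \<nu>"
  have [measurable]: "?F \<in> borel_measurable borel" by (rule profile_mixture(1)[OF S D \<nu>])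
  have [measurable]: "g_tilde \<gamma> \<mu> x \<in> borel_measurable borel"
    unfolding g_tilde_def[abs_def] g_density_def by measurable
  have "u_tilde \<gamma> \<mu> \<nu> h x t = (LBINT s:{0<..}. g_tilde \<gamma> \<mu> x s * inverse_density h s t)"
    using \<nu> by (simp add: u_tilde_def)
  also have "\<dots> = (LBINT s:{0<..}. g_tilde \<gamma> \<mu> x s * (?F s / s))"
  proof (rule set_lebesgue_integral_cong)
    show "\<forall>s. s \<in> {0<..} \<longrightarrow> g_tilde \<gamma> \<mu> x s * inverse_density h s t = g_tilde \<gamma> \<mu> x s * (?F s / s)"
    proof (intro allI impI)
      fix s :: real assume "s \<in> {0<..}"
      then show "g_tilde \<gamma> \<mu> x s * inverse_density h s t = g_tilde \<gamma> \<mu> x s * (?F s / s)"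
        using inverse_density_eq_profile[OF \<nu> marginal_density_eq_profile[OF S D \<nu>], of s t] t by simp
    qed
  qed simp
  also have "\<dots> = (\<integral>u. exp u *\<^sub>R (g_tilde \<gamma> \<mu> x (exp u) * (?F (exp u) / exp u)) \<partial>lborel)"
    by (rule set_integral_exp_substitution) measurable
  also have "\<dots> = (\<integral>u. \<gamma> / (x * Gamma \<mu>) * (exp (\<gamma> * ln x - u) powr \<mu> * exp (- exp (\<gamma> * ln x - u)) * ?F (exp u)) \<partial>lborel)"
    by (intro Bochner_Integration.integral_cong refl) (simp add: g_tilde_exp[OF \<gamma> x])
  also have "\<dots> = \<gamma> / (x * Gamma \<mu>) * (\<integral>u. exp (\<gamma> * ln x - u) powr \<mu> * exp (- exp (\<gamma> * ln x - u)) * ?F (exp u) \<partial>lborel)"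
    by (rule integral_mult_right_zero)
  finally show ?thesis .
qed

lemma inverse_stable_mellin_one:
  assumes "Re z > - 1"
  shows "inverse_stable_mellin 1 t z = exp (z * of_real (ln t))"
  using Gamma_nonzero_right_half[of "1 + z"] assms by (simp add: inverse_stable_mellin_def)

lemma g_tilde_mellin_barnes:
  assumes \<gamma>: "\<gamma> > 0" and \<theta>: "\<theta> > - min 1 \<mu>" and x: "x > 0" and t: "t > 0"
  shows "complex_of_real (g_tilde \<gamma> \<mu> x t) = of_real (\<gamma> / (x * Gamma \<mu>)) * (complex_of_real (1 / (2 * pi)) *
        (\<integral>y. Gamma (of_real \<mu> + Complex \<theta> y) * inverse_stable_mellin 1 t (Complex \<theta> y) * exp (- Complex \<theta> y * of_real (\<gamma> * ln x)) \<partial>lborel))"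
proof -
  have \<theta>': "\<theta> > - \<mu>" "\<theta> > - 1" using \<theta> by auto
  have "complex_of_real (exp (\<gamma> * ln x - ln t) powr \<mu> * exp (- exp (\<gamma> * ln x - ln t))) = 1 / (2 * pi) *
      (\<integral>y. mellin (\<lambda>s. s powr \<mu> * exp (- s)) (Complex \<theta> y) * exp (- Complex \<theta> y * of_real (\<gamma> * ln x - ln t)) \<partial>lborel)"
    by (rule Gamma_kernel_inversion[OF \<theta>'(1)])
  also have "(\<integral>y. mellin (\<lambda>s. s powr \<mu> * exp (- s)) (Complex \<theta> y) * exp (- Complex \<theta> y * of_real (\<gamma> * ln x - ln t)) \<partial>lborel) =
      (\<integral>y. Gamma (of_real \<mu> + Complex \<theta> y) * inverse_stable_mellin 1 t (Complex \<theta> y) * exp (- Complex \<theta> y * of_real (\<gamma> * ln x)) \<partial>lborel)"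
  proof (intro Bochner_Integration.integral_cong refl)
    fix y
    have "inverse_stable_mellin 1 t (Complex \<theta> y) = exp (Complex \<theta> y * of_real (ln t))"
      by (rule inverse_stable_mellin_one) (use \<theta>' in simp)
    moreover have "- Complex \<theta> y * of_real (\<gamma> * ln x - ln t) = Complex \<theta> y * of_real (ln t) + - Complex \<theta> y * of_real (\<gamma> * ln x)"
      by (simp add: algebra_simps)
    moreover have "mellin (\<lambda>s. s powr \<mu> * exp (- s)) (Complex \<theta> y) = Gamma (of_real \<mu> + Complex \<theta> y)"
      using mellin_Gamma[of \<mu> "Complex \<theta> y"] \<theta>' by (simp add: add.commute)
    ultimately show "mellin (\<lambda>s. s powr \<mu> * exp (- s)) (Complex \<theta> y) * exp (- Complex \<theta> y * of_real (\<gamma> * ln x - ln t)) =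
        Gamma (of_real \<mu> + Complex \<theta> y) * inverse_stable_mellin 1 t (Complex \<theta> y) * exp (- Complex \<theta> y * of_real (\<gamma> * ln x))"
      by (simp only: exp_add mult.assoc)
  qed
  finally show ?thesis
    using g_tilde_exp[OF \<gamma> x, of \<mu> "ln t"] t by (simp only: exp_ln of_real_mult)
qed

lemma u_tilde_mellin_barnes:
  assumes \<gamma>: "\<gamma> > 0" and \<mu>: "\<mu> > 0" and \<nu>: "0 < \<nu>" "\<nu> \<le> 1"
    and S: "\<nu> < 1 \<Longrightarrow> stable_subordinator M \<nu> \<tau>" and D: "\<nu> < 1 \<Longrightarrow> marginal_density M \<tau> h"
    and \<theta>: "\<theta> > - min 1 \<mu>" and x: "x > 0" and t: "t > 0"
  shows "complex_of_real (u_tilde \<gamma> \<mu> \<nu> h x t) = of_real (\<gamma> / (x * Gamma \<mu>)) * (complex_of_real (1 / (2 * pi)) *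
        (\<integral>y. Gamma (of_real \<mu> + Complex \<theta> y) * inverse_stable_mellin \<nu> t (Complex \<theta> y) * exp (- Complex \<theta> y * of_real (\<gamma> * ln x)) \<partial>lborel))"
proof (cases "\<nu> = 1")
  case True
  then have "u_tilde \<gamma> \<mu> \<nu> h x t = g_tilde \<gamma> \<mu> x t" by (simp add: u_tilde_def)
  then show ?thesis using g_tilde_mellin_barnes[OF \<gamma> \<theta> x t] by (simp only: True)
next
  case False
  then have \<nu>1: "\<nu> < 1" using \<nu> by simp
  note SD = S[OF \<nu>1] D[OF \<nu>1] \<nu>(1) \<nu>1
  have \<theta>': "\<theta> > - \<mu>" "\<theta> > - 1" using \<theta> by auto
  show ?thesis
    unfolding u_tilde_eq_mixture[OF SD \<gamma> x t] of_real_mult[of "\<gamma> / (x * Gamma \<mu>)"]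
    by (subst mixture_mellin_barnes[OF \<nu>(1) \<nu>1 t \<theta>' order_refl profile_mixture(1)[OF SD] profile_mixture(2)[OF SD] profile_mixture(3)[OF SD t]])
      (rule refl | assumption)+
qed

text \<open>As the transform of a nonnegative function it is dominated by its value on the real
  axis; the existence of the process thus replaces an estimate of the quotient of Gamma
  functions.\<close>

lemma inverse_stable_mellin_bounded:
  assumes \<nu>: "0 < \<nu>" "\<nu> \<le> 1"
    and S: "\<nu> < 1 \<Longrightarrow> stable_subordinator M \<nu> \<tau>" and D: "\<nu> < 1 \<Longrightarrow> marginal_density M \<tau> h" and \<theta>: "\<theta> > - 1"
  shows "\<exists>C. \<forall>y. cmod (inverse_stable_mellin \<nu> 1 (Complex \<theta> y)) \<le> C"
proof (cases "\<nu> = 1")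
  case True
  then have "cmod (inverse_stable_mellin \<nu> 1 (Complex \<theta> y)) \<le> 1" for y
    using inverse_stable_mellin_one[of "Complex \<theta> y" 1] \<theta> by simp
  then show ?thesis by blast
next
  case False
  then have \<nu>1: "\<nu> < 1" using \<nu> by simp
  note SD = S[OF \<nu>1] D[OF \<nu>1] \<nu>(1) \<nu>1
  let ?F = "\<lambda>s. stable_profile \<nu> (ln s / \<nu> - ln 1) / \<nu>"
  have "inverse_stable_mellin \<nu> 1 (Complex \<theta> y) = mellin ?F (Complex \<theta> y)" for y
    by (rule mellin_inverse_stable[symmetric, OF profile_mixture(1)[OF SD] profile_mixture(2)[OF SD] order_refl _ \<nu>(1) \<nu>1 zero_less_one profile_mixture(3)[OF SD zero_less_one]])
       (use \<theta> in auto)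
  moreover have "cmod (mellin ?F (Complex \<theta> y)) \<le> cmod (mellin ?F (of_real (Re (Complex \<theta> y))))" for y
    by (rule norm_mellin_le) (rule profile_mixture(2)[OF SD])
  ultimately have "cmod (inverse_stable_mellin \<nu> 1 (Complex \<theta> y)) \<le> cmod (mellin ?F (of_real \<theta>))" for y
    by (simp only: complex.sel)
  then show ?thesis by blast
qed

section \<open>The Bessel representation for \<nu> = 1/(2n + 1)\<close>

lemma prod_lessThan_add: "(\<Prod>k<n + m. f k) = (\<Prod>k<n. f k) * (\<Prod>k<m. f (n + k :: nat))" for f :: "nat \<Rightarrow> real"
  by (induction m) (auto simp: mult.assoc)

text \<open>Put N = 1/\<nu>. Since (1 - \<nu>)/4 = \<nu> n/2, the two Gamma arguments in the j-th
  moment are \<nu> p + (j+1)/N and \<nu> p + (n+j+1)/N. Together they are the factors of Gauss's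
  formula at x = \<nu> p except k = 0. Dividing by the missing Gamma (\<nu> p) leaves Gamma p /
  Gamma (\<nu> p), and raising both arguments by 1 costs a factor \<nu>.\<close>

lemma prod_Q_moment:
  fixes n :: nat and \<nu> p :: real
  assumes n: "n \<ge> 1" and \<nu>: "\<nu> = 1 / (2 * real n + 1)" and p: "p > 0"
  shows "(\<Prod>j\<le>n - 1. Q_moment \<nu> (p + 1 + real n / 2 + real j)) = \<nu> powr (real n) * pi ^ n * \<nu> * \<nu> powr (p - 1/2) * (Gamma (1 + p) / Gamma (1 + \<nu> * p))"
proof -
  have \<nu>0: "\<nu> > 0" using \<nu> by simp
  let ?N = "Suc (2 * n)"
  have N: "real ?N = 1 / \<nu>" unfolding \<nu> by simp
  let ?g = "\<lambda>k. Gamma (\<nu> * p + real (Suc k) / real ?N)"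
  have a: "(1 - \<nu>) / 4 = \<nu> * (real n / 2)" unfolding \<nu> by (simp add: field_simps)
  have "Q_moment \<nu> (p + 1 + real n / 2 + real j) = \<nu> / 2 * (?g j * ?g (n + j))" for j
  proof -
    have "\<nu> * (p + 1 + real n / 2 + real j) - (1 - \<nu>) / 4 = \<nu> * p + real (Suc j) / real ?N"
      "\<nu> * (p + 1 + real n / 2 + real j) + (1 - \<nu>) / 4 = \<nu> * p + real (Suc (n + j)) / real ?N"
      unfolding a N by (simp_all add: algebra_simps)
    then show ?thesis by (simp only: Q_moment_def)
  qed
  then have "(\<Prod>j\<le>n - 1. Q_moment \<nu> (p + 1 + real n / 2 + real j)) = (\<Prod>j<n. \<nu> / 2 * (?g j * ?g (n + j)))"
    using n by (intro prod.cong) auto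
  also have "\<dots> = (\<nu> / 2) ^ n * ((\<Prod>j<n. ?g j) * (\<Prod>j<n. ?g (n + j)))"
    by (simp only: prod.distrib prod_constant card_lessThan)
  also have "(\<Prod>j<n. ?g j) * (\<Prod>j<n. ?g (n + j)) = (\<Prod>k<2 * n. ?g k)"
    using prod_lessThan_add[of ?g n n] by (simp only: mult_2)
  finally have 1: "(\<Prod>j\<le>n - 1. Q_moment \<nu> (p + 1 + real n / 2 + real j)) = (\<nu> / 2) ^ n * (\<Prod>k<2 * n. ?g k)" .
  have "Gamma (real ?N * (\<nu> * p)) = real ?N powr (real ?N * (\<nu> * p) - 1/2) / sqrt (2 * pi) ^ (?N - 1) * (\<Prod>k<?N. Gamma (\<nu> * p + real k / real ?N))"
    using \<nu>0 p by (intro Gamma_multiplication_real) auto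
  moreover have "real ?N * (\<nu> * p) = p" unfolding N using \<nu>0 by simp
  moreover have "(\<Prod>k<?N. Gamma (\<nu> * p + real k / real ?N)) = Gamma (\<nu> * p) * (\<Prod>k<2 * n. ?g k)"
    by (subst prod.lessThan_Suc_shift) simp
  moreover have "sqrt (2 * pi) ^ (?N - 1) = (2 * pi) ^ n" by (simp add: power_mult)
  moreover have "real ?N powr (p - 1/2) = 1 / \<nu> powr (p - 1/2)"
    unfolding N using \<nu>0 by (simp add: powr_divide)
  ultimately have "Gamma p = 1 / \<nu> powr (p - 1/2) / (2 * pi) ^ n * (Gamma (\<nu> * p) * (\<Prod>k<2 * n. ?g k))"
    by (simp only:)
  moreover have "\<nu> powr (p - 1/2) > 0" using \<nu>0 by simp
  moreover have "(2 * pi) ^ n > 0" by simp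
  ultimately have 2: "Gamma (\<nu> * p) * (\<Prod>k<2 * n. ?g k) = Gamma p * \<nu> powr (p - 1/2) * (2 * pi) ^ n"
    by (simp add: field_simps)
  have Gamma_1_plus: "Gamma (1 + z) = z * Gamma z" if "z > 0" for z :: real
  proof -
    have "z \<notin> \<int>\<^sub>\<le>\<^sub>0" using nonpos_Ints_nonpos[of z] that by auto
    from Gamma_plus1[OF this] show ?thesis by (simp add: add.commute)
  qed
  have G1: "Gamma (1 + p) = p * Gamma p" by (rule Gamma_1_plus[OF p])
  have G2: "Gamma (1 + \<nu> * p) = \<nu> * p * Gamma (\<nu> * p)" by (rule Gamma_1_plus[OF mult_pos_pos[OF \<nu>0 p]])
  have G0: "Gamma (\<nu> * p) > 0" using \<nu>0 p by (intro Gamma_real_pos) simp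
  have "(\<Prod>k<2 * n. ?g k) = Gamma p / Gamma (\<nu> * p) * \<nu> powr (p - 1/2) * (2 * pi) ^ n"
    using 2 G0 by (simp add: field_simps)
  also have "Gamma p / Gamma (\<nu> * p) = \<nu> * (Gamma (1 + p) / Gamma (1 + \<nu> * p))"
    unfolding G1 G2 using p \<nu>0 G0 by simp
  finally have 3: "(\<Prod>k<2 * n. ?g k) = \<nu> * (Gamma (1 + p) / Gamma (1 + \<nu> * p)) * \<nu> powr (p - 1/2) * (2 * pi) ^ n" .
  have "(\<nu> / 2) ^ n * (2 * pi) ^ n = \<nu> powr (real n) * pi ^ n"
    using \<nu>0 by (simp add: powr_realpow power_divide power_mult_distrib)
  note 4 = this
  have "(\<nu> / 2) ^ n * (\<nu> * (Gamma (1 + p) / Gamma (1 + \<nu> * p)) * \<nu> powr (p - 1/2) * (2 * pi) ^ n) =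
      ((\<nu> / 2) ^ n * (2 * pi) ^ n) * (\<nu> * (Gamma (1 + p) / Gamma (1 + \<nu> * p)) * \<nu> powr (p - 1/2))"
    by (simp only: mult_ac)
  then show ?thesis unfolding 1 3 4 by (simp only: mult_ac)
qed

text \<open>The prefactor of the Bessel representation; it is what makes the weighted iterated
  kernel have the moments of the inverse stable law.\<close>

definition v_factor :: "real \<Rightarrow> real \<Rightarrow> real" where
  "v_factor \<nu> t = \<nu> powr ((1 - 3 * \<nu>) / (4 * \<nu>)) / (pi\<^sup>2 * t powr (3 * \<nu>)) powr ((1 - \<nu>) / (4 * \<nu>))"

lemma v_factor_eq:
  assumes n: "n \<ge> 1" and \<nu>: "\<nu> = 1 / (2 * real n + 1)" and t: "t > 0"
  shows "v_factor \<nu> t = \<nu> powr ((real n - 1) / 2) / (pi ^ n * t powr (3 * \<nu> * real n / 2))"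
proof -
  have e: "(1 - 3 * \<nu>) / (4 * \<nu>) = (real n - 1) / 2" "(1 - \<nu>) / (4 * \<nu>) = real n / 2"
    unfolding \<nu> by (simp_all add: field_simps)
  have "(pi\<^sup>2) powr (real n / 2) = pi ^ n"
  proof -
    have "(pi\<^sup>2) powr (real n / 2) = (pi powr 2) powr (real n / 2)" by (simp add: powr_numeral)
    also have "\<dots> = pi powr (real n)" by (subst powr_powr) simp
    finally show ?thesis by (simp add: powr_realpow)
  qed
  then have "(pi\<^sup>2 * t powr (3 * \<nu>)) powr (real n / 2) = pi ^ n * t powr (3 * \<nu> * real n / 2)"
    using t by (simp add: powr_mult powr_powr)
  then show ?thesis unfolding v_factor_def e by (simp only:)
qed

text \<open>The weight s^(n/2 + 1) raises the exponent from p to q = p + 1 + n/2, at which the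
  Bessel moments are the Gauss factors. The last argument t^\<nu>/\<nu> supplies t^(\<nu> p), and
  \<open>v_factor\<close> cancels the remaining constants.\<close>

lemma v_function_mellin:
  fixes n :: nat and \<nu> p t :: real
  assumes n: "n \<ge> 1" and \<nu>: "\<nu> = 1 / (2 * real n + 1)" and t: "t > 0" and p: "p > 0"
  shows "(\<integral>\<^sup>+u. ennreal (v_factor \<nu> t * (exp u powr (real n / 2 + 1) * v_function n \<nu> (exp u) t) * exp (p * u)) \<partial>lborel)
    = ennreal (t powr (\<nu> * p) * (Gamma (1 + p) / Gamma (1 + \<nu> * p)))"
proof -
  have \<nu>0: "0 < \<nu>" "\<nu> < 1" using n by (auto simp: \<nu>)
  define r where "r = t powr \<nu> / \<nu>"
  have r: "r > 0" using t \<nu>0 by (simp add: r_def)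
  define q where "q = p + 1 + real n / 2"
  have a: "(1 - \<nu>) / 4 = \<nu> * (real n / 2)" unfolding \<nu> by (simp add: field_simps)
  have q: "(1 - \<nu>) / 4 < \<nu> * q"
    unfolding a q_def using \<nu>0 p by (intro mult_strict_left_mono) auto
  note I = iterated_Q_mellin[OF \<nu>0 r, where k = "n - 1"]
  have vf0: "v_factor \<nu> t \<ge> 0" by (simp add: v_factor_def)
  have [measurable]: "(\<lambda>s. iterated_Q (n - 1) \<nu> s r) \<in> borel_measurable borel" by (rule I(1))
  have "(\<integral>\<^sup>+u. ennreal (v_factor \<nu> t * (exp u powr (real n / 2 + 1) * v_function n \<nu> (exp u) t) * exp (p * u)) \<partial>lborel) =
      (\<integral>\<^sup>+u. ennreal (v_factor \<nu> t) * ennreal (iterated_Q (n - 1) \<nu> (exp u) r * exp (q * u)) \<partial>lborel)"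
  proof (intro nn_integral_cong)
    fix u
    have "exp (q * u) = exp u powr (real n / 2 + 1) * exp (p * u)"
      by (simp add: powr_def q_def algebra_simps flip: exp_add)
    then show "ennreal (v_factor \<nu> t * (exp u powr (real n / 2 + 1) * v_function n \<nu> (exp u) t) * exp (p * u)) =
        ennreal (v_factor \<nu> t) * ennreal (iterated_Q (n - 1) \<nu> (exp u) r * exp (q * u))"
      using I(2)[of "exp u"] vf0 by (simp add: v_function_def r_def mult_ac flip: ennreal_mult)
  qed
  also have "\<dots> = ennreal (v_factor \<nu> t) * (\<integral>\<^sup>+u. ennreal (iterated_Q (n - 1) \<nu> (exp u) r * exp (q * u)) \<partial>lborel)"
    by (rule nn_integral_cmult) measurable
  also have "(\<integral>\<^sup>+u. ennreal (iterated_Q (n - 1) \<nu> (exp u) r * exp (q * u)) \<partial>lborel) =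
      ennreal ((\<Prod>j\<le>n - 1. Q_moment \<nu> (q + real j)) * r powr (q + real (n - 1)))"
    by (rule I(3)[OF q])
  also have "ennreal (v_factor \<nu> t) * ennreal ((\<Prod>j\<le>n - 1. Q_moment \<nu> (q + real j)) * r powr (q + real (n - 1))) =
      ennreal (v_factor \<nu> t * ((\<Prod>j\<le>n - 1. Q_moment \<nu> (q + real j)) * r powr (q + real (n - 1))))"
  proof -
    have "0 \<le> (\<Prod>j\<le>n - 1. Q_moment \<nu> (q + real j))"
    proof (intro prod_nonneg ballI Q_moment_nonneg \<nu>0)
      fix j
      have "\<nu> * q \<le> \<nu> * (q + real j)" using \<nu>0 by (intro mult_left_mono) auto
      then show "(1 - \<nu>) / 4 < \<nu> * (q + real j)" using q by linarith
    qed
    then have "0 \<le> (\<Prod>j\<le>n - 1. Q_moment \<nu> (q + real j)) * r powr (q + real (n - 1))" by (rule mult_nonneg_nonneg) simp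
    with vf0 show ?thesis by (rule ennreal_mult[symmetric])
  qed
  also have "v_factor \<nu> t * ((\<Prod>j\<le>n - 1. Q_moment \<nu> (q + real j)) * r powr (q + real (n - 1))) = t powr (\<nu> * p) * (Gamma (1 + p) / Gamma (1 + \<nu> * p))"
  proof -
    let ?R = "Gamma (1 + p) / Gamma (1 + \<nu> * p)"
    let ?e = "p + 3 * real n / 2"
    \<comment> \<open>One power of r per integration, n - 1 in all, gives the exponent q + n - 1 = p
      + 3n/2 and hence the power of t in \<open>v_factor\<close>. The powers of \<nu> from
      \<open>v_factor\<close> and the moments add up to the same exponent and cancel the \<nu> in
      r.\<close>
    have e: "q + real (n - 1) = ?e" using n by (simp add: q_def of_nat_diff field_simps)
    have rp: "r powr ?e = t powr (\<nu> * p) * t powr (3 * \<nu> * real n / 2) / \<nu> powr ?e"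
    proof -
      have "(t powr \<nu>) powr ?e = t powr (\<nu> * p + 3 * \<nu> * real n / 2)" by (simp add: powr_powr algebra_simps)
      then show ?thesis unfolding r_def using t \<nu>0 by (simp add: powr_divide powr_add)
    qed
    have np: "\<nu> powr ((real n - 1) / 2) * (\<nu> powr (real n) * \<nu> * \<nu> powr (p - 1/2)) = \<nu> powr ?e"
    proof -
      have "\<nu> powr ((real n - 1) / 2) * (\<nu> powr (real n) * \<nu> powr 1 * \<nu> powr (p - 1/2)) = \<nu> powr ((real n - 1) / 2 + (real n + 1 + (p - 1/2)))"
        by (simp only: powr_add)
      also have "(real n - 1) / 2 + (real n + 1 + (p - 1/2)) = ?e" by (simp add: field_simps)
      finally show ?thesis using \<nu>0 by simp
    qed
    let ?V = "\<nu> powr (real n) * \<nu> * \<nu> powr (p - 1/2)" and ?T = "t powr (3 * \<nu> * real n / 2)"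
    have pos: "\<nu> powr ?e > 0" "?T > 0" "pi ^ n > 0" using \<nu>0 t by simp_all
    \<comment> \<open>With the powers abstracted to variables, the cancellation is pure field
      arithmetic.\<close>
    have cancel: "A / (P * T) * ((V * P * R) * (X * T / E)) = X * R"
      if "A * V = E" "E > 0" "T > 0" "P > 0" for A E P R T V X :: real
    proof -
      have "A \<noteq> 0" "V \<noteq> 0" using that by auto
      then show ?thesis using that(3,4) unfolding that(1)[symmetric] by (simp add: field_simps)
    qed
    have "v_factor \<nu> t * ((\<Prod>j\<le>n - 1. Q_moment \<nu> (q + real j)) * r powr (q + real (n - 1))) =
        \<nu> powr ((real n - 1) / 2) / (pi ^ n * ?T) * ((?V * pi ^ n * ?R) * (t powr (\<nu> * p) * ?T / \<nu> powr ?e))"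
      unfolding e rp v_factor_eq[OF n \<nu> t] unfolding q_def prod_Q_moment[OF n \<nu> p] by (simp only: mult_ac)
    also have "\<dots> = t powr (\<nu> * p) * ?R" by (rule cancel[OF np pos])
    finally show ?thesis .
  qed
  finally show ?thesis .
qed

text \<open>For n > 0 both sides are mixtures of the Gamma kernel whose mixing functions have the
  same moments, so they share one Mellin-Barnes integral. For n = 0 the prefactor is 1 and the point
  mass evaluates the kernel directly.\<close>

lemma u_tilde_eq_v_integral:
  fixes n :: nat
  assumes \<gamma>: "\<gamma> > 0" and \<mu>: "\<mu> > 0" and \<nu>: "\<nu> = 1 / (2 * real n + 1)"
    and S: "\<nu> < 1 \<Longrightarrow> stable_subordinator M \<nu> \<tau>" and D: "\<nu> < 1 \<Longrightarrow> marginal_density M \<tau> h"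
    and x: "x > 0" and t: "t > 0"
  shows "u_tilde \<gamma> \<mu> \<nu> h x t = \<gamma> * x powr (\<gamma> * \<mu> - 1) / Gamma \<mu> * v_factor \<nu> t
    * v_integral n \<nu> t (\<lambda>s. s powr (1 / (4 * \<nu>) - 1 / 4 - \<mu>) * exp (- (x powr \<gamma> / s)))"
proof (cases "n = 0")
  case True
  then have \<nu>1: "\<nu> = 1" using \<nu> by simp
  have p: "(t powr (1 / \<gamma>)) powr (\<gamma> * \<mu>) = t powr \<mu>" "(t powr (1 / \<gamma>)) powr \<gamma> = t"
    using \<gamma> t by (simp_all add: powr_powr)
  have v1: "v_factor 1 t = 1" using t by (simp add: v_factor_def)
  have u: "u_tilde \<gamma> \<mu> 1 h x t = \<gamma> * x powr (\<gamma> * \<mu> - 1) / (t powr \<mu> * Gamma \<mu>) * exp (- (x powr \<gamma> / t))"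
    unfolding u_tilde_def g_tilde_def g_density_def p by simp
  have "v_integral n 1 t (\<lambda>s. s powr (1 / (4 * 1) - 1 / 4 - \<mu>) * exp (- (x powr \<gamma> / s))) = 1 / t powr \<mu> * exp (- (x powr \<gamma> / t))"
    by (simp add: v_integral_def True powr_minus_divide)
  then show ?thesis unfolding \<nu>1 v1 u by (simp add: mult_ac)
next
  case False
  then have n: "n \<ge> 1" by simp
  have \<nu>0: "0 < \<nu>" "\<nu> < 1" using n by (auto simp: \<nu>)
  let ?c = "\<gamma> * ln x"
  let ?F = "\<lambda>s. v_factor \<nu> t * (s powr (real n / 2 + 1) * v_function n \<nu> s t)"
  have r: "t powr \<nu> / \<nu> > 0" using t \<nu>0 by simp
  note I = iterated_Q_mellin[OF \<nu>0 r, where k = "n - 1"]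
  have v[measurable]: "(\<lambda>s. v_function n \<nu> s t) \<in> borel_measurable borel"
    using I(1) by (simp add: v_function_def)
  have v0: "0 \<le> v_function n \<nu> s t" for s using I(2) by (simp add: v_function_def)
  have vf0: "v_factor \<nu> t \<ge> 0" by (simp add: v_factor_def)
  let ?k = "\<lambda>u. exp (?c - u) powr \<mu> * exp (- exp (?c - u))"
  have "complex_of_real (\<gamma> / (x * Gamma \<mu>) * (\<integral>u. ?k u * ?F (exp u) \<partial>lborel)) = complex_of_real (u_tilde \<gamma> \<mu> \<nu> h x t)"
  proof -
    \<comment> \<open>The line Re \<eta> = 1 lies to the right of 0, as it must: the moments of the
      iterated kernel are available for p > 0.\<close>
    have "complex_of_real (\<integral>u. ?k u * ?F (exp u) \<partial>lborel) = complex_of_real (1 / (2 * pi)) *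
        (\<integral>y. Gamma (of_real \<mu> + Complex 1 y) * inverse_stable_mellin \<nu> t (Complex 1 y) * exp (- Complex 1 y * of_real ?c) \<partial>lborel)"
      by (rule mixture_mellin_barnes[where a = 0, OF \<nu>0 t _ _ _ _ _ v_function_mellin[OF n \<nu> t]])
        (use \<mu> v0 vf0 in auto)
    moreover have "complex_of_real (u_tilde \<gamma> \<mu> \<nu> h x t) = of_real (\<gamma> / (x * Gamma \<mu>)) * (complex_of_real (1 / (2 * pi)) *
        (\<integral>y. Gamma (of_real \<mu> + Complex 1 y) * inverse_stable_mellin \<nu> t (Complex 1 y) * exp (- Complex 1 y * of_real ?c) \<partial>lborel))"
      by (rule u_tilde_mellin_barnes[OF \<gamma> \<mu> \<nu>0(1) less_imp_le[OF \<nu>0(2)] _ _ _ x t])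
         (use S D \<mu> in auto)
    ultimately show ?thesis by (simp only: of_real_mult)
  qed
  then have 1: "u_tilde \<gamma> \<mu> \<nu> h x t = \<gamma> / (x * Gamma \<mu>) * (\<integral>u. ?k u * ?F (exp u) \<partial>lborel)"
    by (simp only: of_real_eq_iff)
  \<comment> \<open>The exponent 1/(4\<nu>) - 1/4 of the theorem is n/2. It arises from the weight
    s^(n/2 + 1), with one power of s used up by ds = s du.\<close>
  have e: "1 / (4 * \<nu>) - 1 / 4 - \<mu> = real n / 2 - \<mu>"
    unfolding \<nu> by (simp add: field_simps)
  let ?g = "\<lambda>s. s powr (real n / 2 - \<mu>) * exp (- (x powr \<gamma> / s)) * v_function n \<nu> s t"
  have "(\<integral>u. ?k u * ?F (exp u) \<partial>lborel) = (\<integral>u. x powr (\<gamma> * \<mu>) * v_factor \<nu> t * (exp u *\<^sub>R ?g (exp u)) \<partial>lborel)"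
  proof (intro Bochner_Integration.integral_cong refl)
    fix u
    have a1: "exp (?c - u) = x powr \<gamma> / exp u" using x by (simp add: exp_diff powr_def)
    have a2: "exp (?c - u) powr \<mu> = x powr (\<gamma> * \<mu>) * exp u powr (- \<mu>)"
      using x by (simp add: powr_def algebra_simps flip: exp_add)
    have a3: "exp u powr (- \<mu>) * exp u powr (real n / 2 + 1) = exp u * exp u powr (real n / 2 - \<mu>)"
      by (simp add: powr_def algebra_simps flip: exp_add)
    have "?k u * ?F (exp u) = x powr (\<gamma> * \<mu>) * v_factor \<nu> t * ((exp u powr (- \<mu>) * exp u powr (real n / 2 + 1)) * exp (- (x powr \<gamma> / exp u)) * v_function n \<nu> (exp u) t)"
      unfolding a2 unfolding a1 by (simp only: mult_ac)
    then show "?k u * ?F (exp u) = x powr (\<gamma> * \<mu>) * v_factor \<nu> t * (exp u *\<^sub>R ?g (exp u))"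
      unfolding a3 by (simp only: real_scaleR_def mult_ac)
  qed
  also have "\<dots> = x powr (\<gamma> * \<mu>) * v_factor \<nu> t * (\<integral>u. exp u *\<^sub>R ?g (exp u) \<partial>lborel)"
    by (rule integral_mult_right_zero)
  also have "(\<integral>u. exp u *\<^sub>R ?g (exp u) \<partial>lborel) = (LBINT s:{0<..}. ?g s)"
    by (rule set_integral_exp_substitution[symmetric]) measurable
  finally have 2: "(\<integral>u. ?k u * ?F (exp u) \<partial>lborel) = x powr (\<gamma> * \<mu>) * v_factor \<nu> t * (LBINT s:{0<..}. ?g s)" .
  have "x powr (\<gamma> * \<mu> - 1) = x powr (\<gamma> * \<mu>) / x" using x by (simp add: powr_diff)
  then show ?thesis unfolding 1 2 e v_integral_def using False by (simp add: mult_ac)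
qed

theorem theorem1:
  fixes \<gamma> \<mu> \<nu> :: real
    and M :: "'a measure"
    and \<tau> :: "real \<Rightarrow> 'a \<Rightarrow> real"
    and h :: "real \<Rightarrow> real \<Rightarrow> real"
  assumes "\<gamma> > 0" and "\<mu> > 0" and "0 < \<nu>" and "\<nu> \<le> 1"
    and "\<nu> < 1 \<Longrightarrow> stable_subordinator M \<nu> \<tau>"
    and "\<nu> < 1 \<Longrightarrow> marginal_density M \<tau> h"
  shows "(\<forall>n::nat. \<nu> = 1 / (2 * real n + 1) \<longrightarrow>
           solves_fractional_equation \<gamma> \<mu> \<nu> (u_tilde \<gamma> \<mu> \<nu> h) \<and>
           (\<forall>x>0. \<forall>t>0.
              u_tilde \<gamma> \<mu> \<nu> h x t =
                \<gamma> * x powr (\<gamma> * \<mu> - 1) / Gamma \<mu>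
                * (\<nu> powr ((1 - 3 * \<nu>) / (4 * \<nu>))
                    / (pi\<^sup>2 * t powr (3 * \<nu>)) powr ((1 - \<nu>) / (4 * \<nu>)))
                * v_integral n \<nu> t
                    (\<lambda>s. s powr (1 / (4 * \<nu>) - 1 / 4 - \<mu>) * exp (- (x powr \<gamma> / s))))) \<and>
         solves_fractional_equation \<gamma> \<mu> \<nu> (u_tilde \<gamma> \<mu> \<nu> h) \<and>
         (\<forall>\<theta> > - min 1 \<mu>. \<forall>x>0. \<forall>t>0.
            complex_of_real (u_tilde \<gamma> \<mu> \<nu> h x t) =
              of_real (\<gamma> / x)
              * fox_H 2 0 [(1, \<nu>), (\<mu>, 0)] [(1, 1), (\<mu>, 1)] \<theta> (x powr \<gamma> / t powr \<nu>))"
proof -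
  have rep: "complex_of_real (u_tilde \<gamma> \<mu> \<nu> h x t) = of_real (\<gamma> / (x * Gamma \<mu>)) * (complex_of_real (1 / (2 * pi)) *
        (\<integral>y. Gamma (of_real \<mu> + Complex \<theta> y) * inverse_stable_mellin \<nu> t (Complex \<theta> y) * exp (- Complex \<theta> y * of_real (\<gamma> * ln x)) \<partial>lborel))"
    if "\<theta> > - min 1 \<mu>" "x > 0" "t > 0" for \<theta> x t
    by (rule u_tilde_mellin_barnes[OF assms(1-4) _ _ that]) (use assms(5,6) in auto)
  have bounded: "\<exists>C. \<forall>y. cmod (inverse_stable_mellin \<nu> 1 (Complex \<theta> y)) \<le> C" if "\<theta> > - 1" for \<theta>
    by (rule inverse_stable_mellin_bounded[OF assms(3,4) _ _ that]) (use assms(5,6) in auto)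
  \<comment> \<open>The equation holds for every \<nu> in (0, 1]; the claim for \<nu> = 1/(2n + 1)
    is an instance.\<close>
  have sol: "solves_fractional_equation \<gamma> \<mu> \<nu> (u_tilde \<gamma> \<mu> \<nu> h)"
    by (rule mellin_barnes_solution[OF assms(1-4) rep bounded])
  moreover have "complex_of_real (u_tilde \<gamma> \<mu> \<nu> h x t) =
      of_real (\<gamma> / x) * fox_H 2 0 [(1, \<nu>), (\<mu>, 0)] [(1, 1), (\<mu>, 1)] \<theta> (x powr \<gamma> / t powr \<nu>)"
    if "\<theta> > - min 1 \<mu>" "x > 0" "t > 0" for \<theta> x t
    using rep[OF that] mellin_barnes_eq_fox_H[OF that(2,3)] by (rule trans)
  moreover have "u_tilde \<gamma> \<mu> \<nu> h x t =
      \<gamma> * x powr (\<gamma> * \<mu> - 1) / Gamma \<mu>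
      * (\<nu> powr ((1 - 3 * \<nu>) / (4 * \<nu>)) / (pi\<^sup>2 * t powr (3 * \<nu>)) powr ((1 - \<nu>) / (4 * \<nu>)))
      * v_integral n \<nu> t (\<lambda>s. s powr (1 / (4 * \<nu>) - 1 / 4 - \<mu>) * exp (- (x powr \<gamma> / s)))"
    if "\<nu> = 1 / (2 * real n + 1)" "x > 0" "t > 0" for n x t
    unfolding v_factor_def[symmetric]
    by (rule u_tilde_eq_v_integral[OF assms(1,2) that(1) _ _ that(2,3)]) (use assms(5,6) in auto)
  ultimately show ?thesis by blast
qed

end
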